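(* There is a universal constant $C>0$ such that the following holds. Let $\mathbf\Omega\in\mathbb{F}^{N\times k}$ be a test matrix that satisfies the quadratic form condition with parameters $a,b\ge 0$. Let $r\ge1$ and $\alpha\in(0,1)$. If $k\ge C(1-\alpha)^{-2}(a+b)\,r$, then $\mathbf\Omega$ is an oblivious subspace injection (OSI) with subspace dimension $r$ and injectivity $\alpha$. In particular, there are universal constants $C_1,C_2>0$ such that an rMPS test matrix $\mathbf\Omega\in\mathbb{F}^{d^n\times k}$ of bond dimension $\chi$ is an OSI with subspace dimension $r$ and injectivity $\alpha\ge\frac12$ whenever $k\ge C_1r$ and $\chi\ge C_2n$.
   Context: $\mathbb{F}\in\{\mathbb{R},\mathbb{C}\}$. A random vector $\boldsymbol\omega\in\mathbb{F}^N$ is isotropic if $\mathbb{E}[\boldsymbol\omega\boldsymbol\omega^*]=\mathbf I$. An isotropic random vector $\boldsymbol\omega$ satisfies the quadratic form condition with parameters $a,b\ge0$ if $\operatorname{Var}(\boldsymbol\omega^*\mathbf A\boldsymbol\omega)\le a\|\mathbf A\|_{\rm F}^2+b\operatorname{Tr}(\mathbf A)^2$ for every positive semidefinite (psd) matrix $\mathbf A\in\mathbb{F}^{N\times N}$. A random matrix $\mathbf\Omega\in\mathbb{F}^{N\times k}$ (test matrix) satisfies the quadratic form condition if $\mathbf\Omega=k^{-1/2}[\boldsymbol\omega_1,\dots,\boldsymbol\omega_k]$ with iid columns $\boldsymbol\omega_i$ that satisfy the quadratic form condition. OSI: a test matrix $\mathbf\Omega=k^{-1/2}[\boldsymbol\omega_1,\dots,\boldsymbol\omega_k]\in\mathbb{F}^{N\times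 k}$ with iid isotropic $\boldsymbol\omega_i$ is an oblivious subspace injection with subspace dimension $r$ and injectivity $\alpha$ if, for every $r$-dimensional linear subspace $\mathsf L\subseteq\mathbb{F}^N$, with probability at least $0.99$ one has $\|\mathbf\Omega^*\boldsymbol x\|_2^2\ge\alpha\|\boldsymbol x\|_2^2$ for all $\boldsymbol x\in\mathsf L$. rMPS: Let $d,\chi\ge1$, $n\ge2$ be integers. An rMPS over $\mathbb{F}$ of order $n$, physical dimension $d$, bond dimension $\chi$ is the random vector in $\mathbb{F}^{d^n}$ with entries $\boldsymbol\omega(i_1,\dots,i_n)=\sum_{\alpha_1,\dots,\alpha_{n-1}=1}^{\chi}G_1(i_1,\alpha_1)G_2(\alpha_1,i_2,\alpha_2)\cdots G_{n-1}(\alpha_{n-2},i_{n-1},\alpha_{n-1})G_n(\alpha_{n-1},i_n)$, $(i_1,\dots,i_n)\in\{1,\dots,d\}^n$, where $G_1\in\mathbb{F}^{d\times\chi}$, $G_n\in\mathbb{F}^{\chi\times d}$, $G_p\in\mathbb{F}^{\chi\times d\times\chi}$ ($1<p<n$) have independent entries, those of $G_p$ with law $\mathcal N_{\mathbb F}(0,\sigma_p^2)$, $\sigma_p^2=1/\chi$ for $1<p<n$ and $\sigma_p^2=1/\sqrt\chi$ for $p\in\{1,n\}$. ($\mathcal N_{\mathbb C}(0,\sigma^2)$ is the law of $g_1+\mathrm{i}g_2$ with $g_1,g_2$ independent $\mathcal N_{\mathbb R}(0,\sigma^2/2)$.) An rMPS test matrix is $k^{-1/2}[\boldsymbol\omega_1,\dots,\boldsymbol\omega_k]$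 with $\boldsymbol\omega_i$ iid rMPS vectors. *)

theory Defs
  imports
    "HOL-Probability.Probability"
    "HOL-Library.Function_Algebras"
    "Jordan_Normal_Form.Conjugate"
begin

text \<open>
  The scalar field is a type \<open>'f\<close> of the class below, instantiated to \<^typ>\<open>real\<close> and \<^typ>\<open>complex\<close> in the theorem;
  \<^const>\<open>conjugate\<close> is the identity on the reals and complex conjugation on the complex numbers,
  and \<open>0 \<le> z\<close> says for complex \<open>z\<close> that \<open>z\<close> is real and nonnegative.

  A vector over a finite index set \<open>I\<close> is a function \<open>'i \<Rightarrow> 'f\<close> of which only the values on \<open>I\<close>
  matter. The dimension is thus a term, not a type, so constants can be chosen before it.

  Random vectors and random matrices are represented by their laws. All notions below depend
  only on the law, and so a constant can be chosen before the probability space: with a type of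
  sample points as a parameter, a constant could depend on that type.
\<close>


class scalar_field = real_normed_field + banach + second_countable_topology + conjugatable_ordered_field

instance real :: scalar_field ..
instance complex :: scalar_field ..


section \<open>Vectors and subspaces\<close>

definition fscale :: "'f::field \<Rightarrow> ('i \<Rightarrow> 'f) \<Rightarrow> 'i \<Rightarrow> 'f" where
  "fscale c x = (\<lambda>i. c * x i)"

interpretation fvec: vector_space fscale
  by unfold_locales (auto simp: fscale_def fun_eq_iff algebra_simps)

definition coord_space :: "'i set \<Rightarrow> ('i \<Rightarrow> 'f::zero) set" where
  "coord_space I = {x. \<forall>i. i \<notin> I \<longrightarrow> x i = 0}"

definition subspace_of_dim :: "'i set \<Rightarrow> nat \<Rightarrow> ('i \<Rightarrow> 'f::field) set \<Rightarrow> bool" where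
  "subspace_of_dim I r L \<longleftrightarrow> L \<subseteq> coord_space I \<and> fvec.subspace L \<and> fvec.dim L = r"


section \<open>Random vectors and the quadratic form condition\<close>

definition random_vector :: "'i set \<Rightarrow> ('i \<Rightarrow> 'f::scalar_field) measure \<Rightarrow> bool" where
  "random_vector I \<nu> \<longleftrightarrow> prob_space \<nu> \<and> sets \<nu> = sets (Pi\<^sub>M I (\<lambda>_. borel))"

definition isotropic ::
    "'i set \<Rightarrow> ('i \<Rightarrow> 'f::scalar_field) measure \<Rightarrow> bool" where
  "isotropic I \<nu> \<longleftrightarrow>
     random_vector I \<nu> \<and>
     (\<forall>i\<in>I. \<forall>j\<in>I. integrable \<nu> (\<lambda>\<omega>. \<omega> i * conjugate (\<omega> j)) \<and>
        (\<integral>\<omega>. \<omega> i * conjugate (\<omega> j) \<partial>\<nu>) = (if i = j then 1 else 0))"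

definition quad_form :: "'i set \<Rightarrow> ('i \<Rightarrow> 'i \<Rightarrow> 'f::scalar_field) \<Rightarrow> ('i \<Rightarrow> 'f) \<Rightarrow> 'f" where
  "quad_form I A x = (\<Sum>i\<in>I. \<Sum>j\<in>I. conjugate (x i) * A i j * x j)"

definition psd :: "'i set \<Rightarrow> ('i \<Rightarrow> 'i \<Rightarrow> 'f::scalar_field) \<Rightarrow> bool" where
  "psd I A \<longleftrightarrow> (\<forall>i\<in>I. \<forall>j\<in>I. A j i = conjugate (A i j)) \<and> (\<forall>x. 0 \<le> quad_form I A x)"

definition frobenius_sq :: "'i set \<Rightarrow> ('i \<Rightarrow> 'i \<Rightarrow> 'f::scalar_field) \<Rightarrow> real" where
  "frobenius_sq I A = (\<Sum>i\<in>I. \<Sum>j\<in>I. (norm (A i j))\<^sup>2)"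

definition mtrace :: "'i set \<Rightarrow> ('i \<Rightarrow> 'i \<Rightarrow> 'f::scalar_field) \<Rightarrow> 'f" where
  "mtrace I A = (\<Sum>i\<in>I. A i i)"

definition var :: "'a measure \<Rightarrow> ('a \<Rightarrow> 'f::scalar_field) \<Rightarrow> real" where
  "var M X = (\<integral>\<omega>. (norm (X \<omega> - (\<integral>\<omega>'. X \<omega>' \<partial>M)))\<^sup>2 \<partial>M)"

text \<open>
  For psd \<open>A\<close> the quadratic form and the trace are real and nonnegative elements of \<open>'f\<close>; norms
  only serve to turn them into elements of \<^typ>\<open>real\<close>. Square integrability is required explicitly:
  the integral of a function that is not integrable is \<open>0\<close>, so without it an infinite variance
  would satisfy the bound.
\<close>

definition quadratic_form_condition ::
    "'i set \<Rightarrow> ('i \<Rightarrow> 'f::scalar_field) measure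
      \<Rightarrow> real \<Rightarrow> real \<Rightarrow> bool" where
  "quadratic_form_condition I \<nu> a b \<longleftrightarrow>
     0 \<le> a \<and> 0 \<le> b \<and> isotropic I \<nu> \<and>
     (\<forall>A. psd I A \<longrightarrow>
        integrable \<nu> (\<lambda>\<omega>. (norm (quad_form I A \<omega>))\<^sup>2) \<and>
        var \<nu> (quad_form I A) \<le> a * frobenius_sq I A + b * (norm (mtrace I A))\<^sup>2)"


section \<open>Test matrices\<close>

text \<open>
  The law of the random matrix with \<open>k\<close> columns \<open>k\<^bsup>-1/2\<^esup> \<omega>\<^sub>j\<close>, where the \<open>\<omega>\<^sub>j\<close> are independent with
  law \<open>\<nu>\<close>. A matrix is a function on \<open>I \<times> {1..k}\<close>.
\<close>

definition test_matrix ::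
    "'i set \<Rightarrow> nat \<Rightarrow> ('i \<Rightarrow> 'f::scalar_field) measure \<Rightarrow> ('i \<times> nat \<Rightarrow> 'f) measure" where
  "test_matrix I k \<nu> =
     distr (Pi\<^sub>M {1..k} (\<lambda>_. \<nu>)) (Pi\<^sub>M (I \<times> {1..k}) (\<lambda>_. borel))
       (\<lambda>\<omega>. restrict (\<lambda>(i, j). (1 / sqrt (real k)) *\<^sub>R \<omega> j i) (I \<times> {1..k}))"

definition matrix_quadratic_form_condition ::
    "'i set \<Rightarrow> nat \<Rightarrow> ('i \<times> nat \<Rightarrow> 'f::scalar_field) measure
      \<Rightarrow> real \<Rightarrow> real \<Rightarrow> bool" where
  "matrix_quadratic_form_condition I k P a b \<longleftrightarrow>
     (\<exists>\<nu>. quadratic_form_condition I \<nu> a b \<and> P = test_matrix I k \<nu>)"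

definition sq_norm_adjoint_mult ::
    "'i set \<Rightarrow> nat \<Rightarrow> ('i \<times> nat \<Rightarrow> 'f::scalar_field) \<Rightarrow> ('i \<Rightarrow> 'f) \<Rightarrow> real" where
  "sq_norm_adjoint_mult I k \<Omega> x = (\<Sum>j=1..k. (norm (\<Sum>i\<in>I. conjugate (\<Omega> (i, j)) * x i))\<^sup>2)"

definition oblivious_subspace_injection ::
    "'i set \<Rightarrow> nat \<Rightarrow> ('i \<times> nat \<Rightarrow> 'f::scalar_field) measure
      \<Rightarrow> nat \<Rightarrow> real \<Rightarrow> bool" where
  "oblivious_subspace_injection I k P r \<alpha> \<longleftrightarrow>
     (\<exists>\<nu>. isotropic I \<nu> \<and> P = test_matrix I k \<nu>) \<and>
     (\<forall>L. subspace_of_dim I r L \<longrightarrow>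
        measure P {\<Omega> \<in> space P.
          \<forall>x\<in>L. sq_norm_adjoint_mult I k \<Omega> x \<ge> \<alpha> * (\<Sum>i\<in>I. (norm (x i))\<^sup>2)} \<ge> 0.99)"


section \<open>Random matrix product states\<close>

text \<open>The Gaussian laws take the variance as parameter, not the standard deviation.\<close>

definition real_gaussian :: "real \<Rightarrow> real measure" where
  "real_gaussian v = density lborel (\<lambda>x. ennreal (normal_density 0 (sqrt v) x))"

definition complex_gaussian :: "real \<Rightarrow> complex measure" where
  "complex_gaussian v =
     distr (real_gaussian (v / 2) \<Otimes>\<^sub>M real_gaussian (v / 2)) borel (\<lambda>(g1, g2). Complex g1 g2)"

text \<open>
  The bond dimension is \<open>D\<close>. The positions of the scalar entries of all cores: \<open>First i \<alpha>\<close> stands for \<open>G\<^sub>1(i, \<alpha>)\<close>,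
  \<open>Inner p \<alpha> i \<beta>\<close> for \<open>G\<^sub>p(\<alpha>, i, \<beta>)\<close> and \<open>Last \<alpha> i\<close> for \<open>G\<^sub>n(\<alpha>, i)\<close>.
\<close>

datatype core_entry = First nat nat | Inner nat nat nat nat | Last nat nat

definition core_entries :: "nat \<Rightarrow> nat \<Rightarrow> nat \<Rightarrow> core_entry set" where
  "core_entries d D n =
     {First i \<alpha> | i \<alpha>. i \<in> {1..d} \<and> \<alpha> \<in> {1..D}} \<union>
     {Inner p \<alpha> i \<beta> | p \<alpha> i \<beta>. p \<in> {1<..<n} \<and> \<alpha> \<in> {1..D} \<and> i \<in> {1..d} \<and> \<beta> \<in> {1..D}} \<union>
     {Last \<alpha> i | \<alpha> i. \<alpha> \<in> {1..D} \<and> i \<in> {1..d}}"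

fun core_variance :: "nat \<Rightarrow> core_entry \<Rightarrow> real" where
  "core_variance D (First _ _) = 1 / sqrt (real D)"
| "core_variance D (Inner _ _ _ _) = 1 / real D"
| "core_variance D (Last _ _) = 1 / sqrt (real D)"

definition multi_indices :: "nat \<Rightarrow> nat \<Rightarrow> (nat \<Rightarrow> nat) set" where
  "multi_indices d n = ({1..n} \<rightarrow>\<^sub>E {1..d})"

definition mps_entry :: "nat \<Rightarrow> nat \<Rightarrow> (core_entry \<Rightarrow> 'f::scalar_field) \<Rightarrow> (nat \<Rightarrow> nat) \<Rightarrow> 'f" where
  "mps_entry D n G i =
     (\<Sum>\<alpha> \<in> {1..n - 1} \<rightarrow>\<^sub>E {1..D}.
        G (First (i 1) (\<alpha> 1)) *
        (\<Prod>p \<in> {1<..<n}. G (Inner p (\<alpha> (p - 1)) (i p) (\<alpha> p))) *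
        G (Last (\<alpha> (n - 1)) (i n)))"

text \<open>The law of an rMPS; \<open>gauss v\<close> is the centred Gaussian law of variance \<open>v\<close> over \<open>'f\<close>.\<close>

definition rmps ::
    "(real \<Rightarrow> 'f::scalar_field measure) \<Rightarrow> nat \<Rightarrow> nat \<Rightarrow> nat \<Rightarrow> ((nat \<Rightarrow> nat) \<Rightarrow> 'f) measure" where
  "rmps gauss d D n =
     distr (Pi\<^sub>M (core_entries d D n) (\<lambda>e. gauss (core_variance D e)))
       (Pi\<^sub>M (multi_indices d n) (\<lambda>_. borel))
       (\<lambda>G. restrict (mps_entry D n G) (multi_indices d n))"

definition rmps_test_matrix ::
    "(real \<Rightarrow> 'f::scalar_field measure) \<Rightarrow> nat \<Rightarrow> nat \<Rightarrow> nat \<Rightarrow> nat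
      \<Rightarrow> ((nat \<Rightarrow> nat) \<times> nat \<Rightarrow> 'f) measure" where
  "rmps_test_matrix gauss d D n k = test_matrix (multi_indices d n) k (rmps gauss d D n)"

end

theory Submission
  imports Defs
begin

text \<open>
  Both parts rest on one inequality: if the isotropic vector \<open>\<omega>\<close> satisfies
  \<open>Var \<bar>\<langle>\<omega>, x\<rangle>\<bar>\<^sup>2 \<le> s \<parallel>x\<parallel>\<^sup>4\<close> for all \<open>x\<close>, then a number of columns proportional to
  \<open>s r / (1 - \<alpha>)\<^sup>2\<close> suffices. Write \<open>S(x)\<close> for the squared norm of the adjoint of the test
  matrix applied to \<open>x\<close>, the mean of the \<open>\<bar>\<langle>\<omega>\<^sub>j, x\<rangle>\<bar>\<^sup>2\<close> over the columns.

  For one fixed \<open>x\<close> the terms of \<open>S(x)\<close> are nonnegative with a bounded second moment, so their mean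
  has a Gaussian lower tail (\<open>iid_lower_tail\<close>). A bound uniform over the unit sphere of a subspace of
  dimension \<open>r\<close> usually takes a net together with an upper bound on \<open>S\<close>, but heavy-tailed columns give
  no good upper bound. Randomized rounding replaces it. In real coordinates with respect to an
  orthonormal basis there are at most \<open>m = 2 r\<close> coordinates; round each of them independently to one of the two
  neighbouring multiples of \<open>1 / sqrt m\<close>, keeping the mean. The expectation of the quadratic form
  \<open>S - \<parallel>\<cdot>\<parallel>\<^sup>2\<close> at the rounded point differs from its value at \<open>x\<close> only by its diagonal entries times
  variances of size at most \<open>1 / m\<close>. Hence, if \<open>S - \<parallel>\<cdot>\<parallel>\<^sup>2\<close> is not very negative at any lattice point with coordinate
  vector of norm at most 2, and its diagonal is small on average, then it is not very negative on the unit sphere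
  (\<open>energy_lower_bound_from_grid\<close>). There are only \<open>48\<^sup>m\<close> such lattice points
  (\<open>lattice_ball_card\<close>), which the exponentially small tails absorb, and the average of
  \<open>m\<close> diagonal entries is controlled by Chebyshev's inequality.

  The tail bound loses a factor \<open>1 + s\<close> where the claim has \<open>s\<close>. This is harmless in dimension two or
  more, because isotropy then forces \<open>s\<close> to be at least a constant
  (\<open>rank_one_variance_lower_bound\<close>); in dimension one Chebyshev's inequality alone is enough.

  The quadratic form condition at the psd matrix \<open>x x\<^sup>*\<close> gives \<open>s = a + b\<close>. For matrix product states
  the fourth moment of \<open>\<langle>\<omega>, x\<rangle>\<close> is bounded by induction over the cores, contracting \<open>x\<close> with
  them from the last one on. Each contraction turns a tensor into \<open>D\<close> independent Gaussian slices
  with equal expected squared norm; the sum of their squared norms has second moment at most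
  \<open>1 + 2 / D\<close> times its squared mean (\<open>core_moments\<close>). Only the first core, which leaves a scalar,
  costs a factor 3. So the fourth moment is at most \<open>3 (1 + 2 / D)\<^bsup>n - 1\<^esup> \<parallel>x\<parallel>\<^sup>4\<close>
  (\<open>mps_moments\<close>), which is a constant times \<open>\<parallel>x\<parallel>\<^sup>4\<close> once \<open>D\<close> is at least \<open>n\<close>.
\<close>

section \<open>The real and the complex field\<close>

text \<open>
  The two assumptions are the facts about the real and complex numbers that the proof needs beyond the axioms
  of scalar fields; stating them as a class lets one proof serve both fields. The element \<open>u\<close> of
  the second assumption is \<open>\<i>\<close> over the complex numbers; over the reals it is
  \<open>0\<close>. Working with two real coordinates in both cases costs a constant factor only.
\<close>

class rc_field = scalar_field +
  assumes scaleR_norm_square: "(norm x)\<^sup>2 *\<^sub>R 1 = x * conjugate x"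
    and real_coordinates:
      "\<exists>u. norm u \<le> 1 \<and> (\<forall>z. \<exists>s t. z = s *\<^sub>R 1 + t *\<^sub>R u \<and> (norm z)\<^sup>2 = s\<^sup>2 + t\<^sup>2)"

instance real :: rc_field
proof
  show "(norm x)\<^sup>2 *\<^sub>R 1 = x * conjugate x" for x :: real
    by (simp add: power2_eq_square)
  have "\<exists>s t. z = s *\<^sub>R 1 + t *\<^sub>R 0 \<and> (norm z)\<^sup>2 = s\<^sup>2 + t\<^sup>2" for z :: real
    by (rule exI[of _ z], rule exI[of _ 0]) simp
  then show "\<exists>u::real. norm u \<le> 1 \<and>
      (\<forall>z. \<exists>s t. z = s *\<^sub>R 1 + t *\<^sub>R u \<and> (norm z)\<^sup>2 = s\<^sup>2 + t\<^sup>2)"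
    by (intro exI[of _ 0]) auto
qed

instance complex :: rc_field
proof
  show "(norm x)\<^sup>2 *\<^sub>R 1 = x * conjugate x" for x :: complex
    using complex_norm_square[of x] by (simp add: scaleR_conv_of_real)
  have "\<exists>s t. z = s *\<^sub>R 1 + t *\<^sub>R \<i> \<and> (norm z)\<^sup>2 = s\<^sup>2 + t\<^sup>2" for z :: complex
    by (rule exI[of _ "Re z"], rule exI[of _ "Im z"]) (auto simp: complex_eq_iff cmod_power2)
  then show "\<exists>u::complex. norm u \<le> 1 \<and>
      (\<forall>z. \<exists>s t. z = s *\<^sub>R 1 + t *\<^sub>R u \<and> (norm z)\<^sup>2 = s\<^sup>2 + t\<^sup>2)"
    by (intro exI[of _ \<i>]) auto
qed

lemma of_real_norm_square: "of_real ((norm x)\<^sup>2) = (x :: 'f::rc_field) * conjugate x"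
  using scaleR_norm_square[of x] by (simp add: of_real_def)

lemma norm_conjugate [simp]: "norm (conjugate x) = norm (x :: 'f::rc_field)"
proof (cases "x = 0")
  case False
  have "norm (of_real ((norm x)\<^sup>2) :: 'f) = norm (x * conjugate x)"
    by (simp only: of_real_norm_square)
  then have "norm x * norm x = norm x * norm (conjugate x)"
    by (simp add: norm_mult power2_eq_square)
  then show ?thesis using False by simp
qed simp

lemma conjugate_diff: "conjugate (x - y) = conjugate x - conjugate (y :: 'f::rc_field)"
  using conjugate_dist_add[of x "- y"] by (simp add: conjugate_neg)

lemma conjugate_of_real [simp]: "conjugate (of_real r :: 'f::rc_field) = of_real r"
proof (cases "r = 0")
  case False
  have "(of_real r :: 'f) * of_real r = of_real r * conjugate (of_real r)"
    using of_real_norm_square[of "of_real r :: 'f"] by (simp add: power2_eq_square)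
  then show ?thesis using False by simp
qed simp

lemma continuous_on_conjugate: "continuous_on UNIV (conjugate :: 'f::rc_field \<Rightarrow> 'f)"
  unfolding continuous_on_iff
  by (auto simp: dist_norm conjugate_diff[symmetric])

lemma borel_measurable_conjugate [measurable]:
  "(conjugate :: 'f::rc_field \<Rightarrow> 'f) \<in> borel_measurable borel"
  by (rule borel_measurable_continuous_onI[OF continuous_on_conjugate])

lemma norm_add_square:
  "of_real ((norm (p + q))\<^sup>2) =
     of_real ((norm p)\<^sup>2) + of_real ((norm q)\<^sup>2) + (p * conjugate q + q * conjugate (p :: 'f::rc_field))"
  unfolding of_real_norm_square by (simp add: conjugate_dist_add algebra_simps)

text \<open>
  Along a real line the squared norm is a quadratic polynomial whose leading coefficient does not depend on
  the base point; polarization expresses the linear coefficient by squared norms, so that no real part has to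
  be defined.
\<close>

lemma norm_add_real_multiple_square:
  fixes p q :: "'f::rc_field"
  shows "(norm (p + of_real \<tau> * q))\<^sup>2 =
    (norm p)\<^sup>2 + \<tau> * ((norm (p + q))\<^sup>2 - (norm p)\<^sup>2 - (norm q)\<^sup>2) + \<tau>\<^sup>2 * (norm q)\<^sup>2"
proof -
  have c: "of_real ((norm (p + q))\<^sup>2 - (norm p)\<^sup>2 - (norm q)\<^sup>2) = p * conjugate q + q * conjugate p"
    unfolding of_real_diff norm_add_square by simp
  have "(of_real ((norm (p + of_real \<tau> * q))\<^sup>2) :: 'f) =
    of_real ((norm p)\<^sup>2 + \<tau> * ((norm (p + q))\<^sup>2 - (norm p)\<^sup>2 - (norm q)\<^sup>2) + \<tau>\<^sup>2 * (norm q)\<^sup>2)"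
    unfolding norm_add_square of_real_add of_real_mult c
    by (simp add: conjugate_dist_mul norm_mult power_mult_distrib algebra_simps of_real_norm_square
        flip: of_real_power) 
  then show ?thesis by (simp only: of_real_eq_iff)
qed

lemma norm_parallelogram:
  "(norm (p + q))\<^sup>2 + (norm (p - q))\<^sup>2 = 2 * (norm p)\<^sup>2 + 2 * (norm (q :: 'f::rc_field))\<^sup>2"
  using norm_add_real_multiple_square[of p "-1" q] by simp

section \<open>Inner products and orthonormal families\<close>

definition ip :: "'i set \<Rightarrow> ('i \<Rightarrow> 'f::rc_field) \<Rightarrow> ('i \<Rightarrow> 'f) \<Rightarrow> 'f" where
  "ip I x y = (\<Sum>i\<in>I. conjugate (x i) * y i)"

definition nsq :: "'i set \<Rightarrow> ('i \<Rightarrow> 'f::rc_field) \<Rightarrow> real" where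
  "nsq I x = (\<Sum>i\<in>I. (norm (x i))\<^sup>2)"

lemma nsq_nonneg [simp]: "0 \<le> nsq I x"
  by (simp add: nsq_def sum_nonneg)

lemma of_real_nsq: "of_real (nsq I x) = ip I x x"
  unfolding nsq_def ip_def of_real_sum of_real_norm_square by (simp add: mult.commute)

lemma ip_add_right: "ip I x (\<lambda>i. y i + z i) = ip I x y + ip I x z"
  by (simp add: ip_def algebra_simps sum.distrib)

lemma ip_scale_right: "ip I x (\<lambda>i. c * y i) = c * ip I x y"
  by (simp add: ip_def sum_distrib_left mult_ac)

lemma ip_sum_right: "ip I x (\<lambda>i. \<Sum>l\<in>B. z l * y l i) = (\<Sum>l\<in>B. z l * ip I x (y l))"
proof -
  have "ip I x (\<lambda>i. \<Sum>l\<in>B. z l * y l i) = (\<Sum>i\<in>I. \<Sum>l\<in>B. z l * (conjugate (x i) * y l i))"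
    by (simp add: ip_def sum_distrib_left mult_ac)
  also have "\<dots> = (\<Sum>l\<in>B. \<Sum>i\<in>I. z l * (conjugate (x i) * y l i))"
    by (rule sum.swap)
  finally show ?thesis by (simp add: ip_def sum_distrib_left)
qed

lemma conjugate_ip: "finite I \<Longrightarrow> conjugate (ip I x y) = ip I y x"
  by (simp add: ip_def sum_conjugate conjugate_dist_mul mult.commute)

lemma ip_sum_left:
  assumes "finite I" "finite B"
  shows "ip I (\<lambda>i. \<Sum>l\<in>B. z l * y l i) x = (\<Sum>l\<in>B. conjugate (z l) * ip I (y l) x)"
proof -
  have "ip I (\<lambda>i. \<Sum>l\<in>B. z l * y l i) x = conjugate (ip I x (\<lambda>i. \<Sum>l\<in>B. z l * y l i))"
    using assms by (simp add: conjugate_ip)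
  also have "\<dots> = (\<Sum>l\<in>B. conjugate (z l) * ip I (y l) x)"
    using assms by (simp add: ip_sum_right sum_conjugate conjugate_dist_mul conjugate_ip)
  finally show ?thesis .
qed

lemma ip_cong: "(\<And>i. i \<in> I \<Longrightarrow> x i = x' i) \<Longrightarrow> (\<And>i. i \<in> I \<Longrightarrow> y i = y' i) \<Longrightarrow> ip I x y = ip I x' y'"
  by (simp add: ip_def)

lemma nsq_cong: "(\<And>i. i \<in> I \<Longrightarrow> x i = x' i) \<Longrightarrow> nsq I x = nsq I x'"
  by (simp add: nsq_def)

lemma nsq_scale: "nsq I (\<lambda>i. c * x i) = (norm c)\<^sup>2 * nsq I x"
  by (simp add: nsq_def norm_mult power_mult_distrib sum_distrib_left)

definition orthonormal :: "'i set \<Rightarrow> nat \<Rightarrow> (nat \<Rightarrow> 'i \<Rightarrow> 'f::rc_field) \<Rightarrow> bool" where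
  "orthonormal I m e \<longleftrightarrow> (\<forall>l<m. \<forall>l'<m. ip I (e l) (e l') = (if l = l' then 1 else 0))"

lemma nsq_orthonormal_combination:
  assumes "finite I" "orthonormal I m e"
  shows "nsq I (\<lambda>i. \<Sum>l<m. z l * e l i) = (\<Sum>l<m. (norm (z l))\<^sup>2)"
proof -
  have "(of_real (nsq I (\<lambda>i. \<Sum>l<m. z l * e l i)) :: 'b) =
      (\<Sum>l<m. conjugate (z l) * (\<Sum>l'<m. z l' * ip I (e l) (e l')))"
    by (simp only: of_real_nsq ip_sum_left[OF assms(1) finite_lessThan] ip_sum_right[of I "e _"])
  also have "\<dots> = (\<Sum>l<m. conjugate (z l) * (\<Sum>l'<m. if l = l' then z l' else 0))"
    using assms(2) by (intro sum.cong refl arg_cong2[of _ _ _ _ "(*)"]) (auto simp: orthonormal_def)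
  also have "\<dots> = (\<Sum>l<m. of_real ((norm (z l))\<^sup>2))"
    unfolding of_real_norm_square by (simp add: mult.commute)
  finally show ?thesis by (simp only: of_real_eq_iff flip: of_real_sum)
qed

lemma orthonormal_nsq:
  fixes e :: "nat \<Rightarrow> 'i \<Rightarrow> 'f::rc_field"
  assumes "orthonormal I m e" "l < m"
  shows "nsq I (e l) = 1"
proof -
  have "(of_real (nsq I (e l)) :: 'f) = of_real 1"
    using assms by (simp add: of_real_nsq orthonormal_def)
  then show ?thesis by (simp only: of_real_eq_iff)
qed

text \<open>
  The vectors matter only on \<open>I\<close>, and the family \<open>e\<close> may be shorter than
  \<open>B\<close>: a vector whose component orthogonal to the family vanishes on \<open>I\<close> adds
  nothing.
\<close>

lemma Gram_Schmidt:
  fixes B :: "('i \<Rightarrow> 'f::rc_field) set"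
  assumes "finite I" "finite B"
  shows "\<exists>m e. m \<le> card B \<and> orthonormal I m e \<and>
    (\<forall>b\<in>B. \<exists>z. \<forall>i\<in>I. b i = (\<Sum>l<m. z l * e l i))"
  using assms(2)
proof (induction B)
  case empty
  then show ?case by (intro exI[of _ 0]) (auto simp: orthonormal_def)
next
  case (insert b B)
  then obtain m e where m: "m \<le> card B" and e: "orthonormal I m e"
    and comb: "\<And>b. b \<in> B \<Longrightarrow> \<exists>z. \<forall>i\<in>I. b i = (\<Sum>l<m. z l * e l i)" by blast
  define v where "v = (\<lambda>i. b i + (\<Sum>l<m. (- ip I (e l) b) * e l i))"
  have b: "b i = v i + (\<Sum>l<m. ip I (e l) b * e l i)" for i
    by (simp add: v_def sum_negf)
  have orth: "ip I (e l) v = 0" if "l < m" for l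
  proof -
    have "ip I (e l) v = ip I (e l) b + (\<Sum>l'<m. (- ip I (e l') b) * ip I (e l) (e l'))"
      unfolding v_def ip_add_right ip_sum_right ..
    also have "(\<Sum>l'<m. (- ip I (e l') b) * ip I (e l) (e l')) = (\<Sum>l'<m. if l = l' then - ip I (e l') b else 0)"
      using e that by (intro sum.cong refl) (auto simp: orthonormal_def)
    finally show ?thesis using that by simp
  qed
  show ?case
  proof (cases "nsq I v = 0")
    case True
    then have "\<forall>i\<in>I. v i = 0"
      using assms(1) by (simp add: nsq_def sum_nonneg_eq_0_iff)
    then have "\<exists>z. \<forall>i\<in>I. b i = (\<Sum>l<m. z l * e l i)"
      by (intro exI[of _ "\<lambda>l. ip I (e l) b"]) (simp add: b[symmetric] b)
    with m e comb insert show ?thesis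
      by (intro exI[of _ m] exI[of _ e]) auto
  next
    case False
    define \<rho> where "\<rho> = sqrt (nsq I v)"
    have \<rho>: "\<rho> > 0" "\<rho>\<^sup>2 = nsq I v" using False nsq_nonneg[of I v] by (auto simp: \<rho>_def order_le_less simp del: nsq_nonneg)
    define w where "w = (\<lambda>i. of_real (1 / \<rho>) * v i)"
    have vw: "v i = of_real \<rho> * w i" for i using \<rho> by (simp add: w_def)
    have "nsq I w = 1"
      unfolding w_def nsq_scale using \<rho> False by (simp add: norm_divide power_divide)
    then have ww: "ip I w w = 1"
      by (simp flip: of_real_nsq)
    have ew: "ip I (e l) w = 0" if "l < m" for l
      unfolding w_def ip_scale_right orth[OF that] by simp
    have we: "ip I w (e l) = 0" if "l < m" for l
      using conjugate_ip[OF assms(1), of "e l" w] ew[OF that] by simp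
    have e': "orthonormal I (Suc m) (e(m := w))"
      using e by (auto simp: orthonormal_def ww ew we less_Suc_eq)
    have "\<exists>z. \<forall>i\<in>I. b' i = (\<Sum>l<Suc m. z l * (e(m := w)) l i)" if "b' \<in> insert b B" for b'
    proof (cases "b' = b")
      case True
      show ?thesis
        by (rule exI[of _ "\<lambda>l. if l = m then of_real \<rho> else ip I (e l) b"])
           (simp add: True b[of _] vw add.commute)
    next
      case False
      then obtain z where "\<forall>i\<in>I. b' i = (\<Sum>l<m. z l * e l i)" using comb \<open>b' \<in> insert b B\<close> by blast
      then show ?thesis by (intro exI[of _ "z(m := 0)"]) simp
    qed
    moreover have "Suc m \<le> card (insert b B)" using m insert.hyps by simp
    ultimately show ?thesis using e' by blast
  qed
qed

lemma sum_fun_apply: "(\<Sum>j\<in>J. g j) i = (\<Sum>j\<in>J. g j i)"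
  by (induction J rule: infinite_finite_induct) auto

lemma subspace_orthonormal_basis:
  fixes L :: "('i \<Rightarrow> 'f::rc_field) set"
  assumes I: "finite I" and L: "subspace_of_dim I r L"
  shows "\<exists>m e. m \<le> r \<and> orthonormal I m e \<and> (\<forall>x\<in>L. \<exists>z. \<forall>i\<in>I. x i = (\<Sum>l<m. z l * e l i))"
proof -
  define unit where "unit = (\<lambda>(j::'i) i. if i = j then 1 else 0 :: 'f)"
  obtain B where B: "B \<subseteq> L" "fvec.independent B" "L \<subseteq> fvec.span B" "card B = fvec.dim L"
    using fvec.basis_exists by blast
  have "B \<subseteq> fvec.span (unit ` I)"
  proof
    fix x assume "x \<in> B"
    then have x: "x i = 0" if "i \<notin> I" for i
      using B(1) L that by (auto simp: subspace_of_dim_def coord_space_def)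
    have "x = (\<Sum>j\<in>I. fscale (x j) (unit j))"
      using I x by (auto simp: fun_eq_iff sum_fun_apply fscale_def unit_def if_distrib sum.delta cong: if_cong)
    also have "\<dots> \<in> fvec.span (unit ` I)"
      by (intro fvec.span_sum fvec.span_scale fvec.span_base) auto
    finally show "x \<in> fvec.span (unit ` I)" .
  qed
  then have finB: "finite B"
    using fvec.independent_span_bound[of "unit ` I" B] I B(2) by auto
  obtain m e where m: "m \<le> card B" and e: "orthonormal I m e"
    and comb: "\<And>b. b \<in> B \<Longrightarrow> \<exists>z. \<forall>i\<in>I. b i = (\<Sum>l<m. z l * e l i)"
    using Gram_Schmidt[OF I finB] by blast
  obtain Z where Z: "\<And>b i. b \<in> B \<Longrightarrow> i \<in> I \<Longrightarrow> b i = (\<Sum>l<m. Z b l * e l i)"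
    using bchoice[of B "\<lambda>b z. \<forall>i\<in>I. b i = (\<Sum>l<m. z l * e l i)"] comb by blast
  have "\<exists>z. \<forall>i\<in>I. x i = (\<Sum>l<m. z l * e l i)" if x: "x \<in> L" for x
  proof -
    obtain c where c: "x = (\<Sum>b\<in>B. fscale (c b) b)"
      using subsetD[OF B(3) x] unfolding fvec.span_finite[OF finB] by (rule imageE)
    have "x i = (\<Sum>l<m. (\<Sum>b\<in>B. c b * Z b l) * e l i)" if "i \<in> I" for i
    proof -
      have "x i = (\<Sum>b\<in>B. c b * b i)" by (simp add: c sum_fun_apply fscale_def)
      also have "\<dots> = (\<Sum>b\<in>B. \<Sum>l<m. c b * Z b l * e l i)"
      proof (rule sum.cong[OF refl])
        fix b assume "b \<in> B"
        show "c b * b i = (\<Sum>l<m. c b * Z b l * e l i)"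
          unfolding Z[OF \<open>b \<in> B\<close> that] by (simp add: sum_distrib_left mult.assoc)
      qed
      also have "\<dots> = (\<Sum>l<m. \<Sum>b\<in>B. c b * Z b l * e l i)" by (rule sum.swap)
      finally show ?thesis by (simp add: sum_distrib_right)
    qed
    then show ?thesis by (intro exI[of _ "\<lambda>l. \<Sum>b\<in>B. c b * Z b l"]) blast
  qed
  moreover have "m \<le> r" using m B(4) L by (simp add: subspace_of_dim_def)
  ultimately show ?thesis using e by (intro exI[of _ m] exI[of _ e]) simp
qed

section \<open>Rounding to a lattice\<close>

text \<open>
  Round \<open>t\<close> to one of the two neighbouring multiples of \<open>\<delta>\<close> at random, with
  mean \<open>t\<close>. The linear term averages out and the quadratic one has mean at most
  \<open>\<delta>\<^sup>2 max d 0\<close>, so one of the two outcomes is at most that.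
\<close>

lemma two_point_rounding:
  fixes c d t \<delta> :: real
  assumes "\<delta> > 0"
  shows "\<exists>z::int. \<bar>\<delta> * of_int z - t\<bar> \<le> \<delta> \<and>
    (\<delta> * of_int z - t) * c + (\<delta> * of_int z - t)\<^sup>2 * d \<le> \<delta>\<^sup>2 * max d 0"
proof -
  define z where "z = \<lfloor>t / \<delta>\<rfloor>"
  define a where "a = t / \<delta> - of_int z"
  have a: "0 \<le> a" "a < 1" unfolding a_def z_def by linarith+
  have t: "t = \<delta> * (of_int z + a)" using assms by (simp add: a_def)
  define f where "f = (\<lambda>\<tau>. \<tau> * c + \<tau>\<^sup>2 * d)"
  have mean: "(1 - a) * f (- (\<delta> * a)) + a * f (\<delta> * (1 - a)) = \<delta>\<^sup>2 * (a * (1 - a)) * d"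
    by (simp add: f_def algebra_simps power2_eq_square)
  have "a * (1 - a) \<le> 1 * 1" using a by (intro mult_mono) auto
  then have "(a * (1 - a)) * max d 0 \<le> 1 * max d 0"
    by (intro mult_right_mono) auto
  moreover have "(a * (1 - a)) * d \<le> (a * (1 - a)) * max d 0"
    using a by (intro mult_left_mono) auto
  ultimately have "(a * (1 - a)) * d \<le> 1 * max d 0" by linarith
  then have "\<delta>\<^sup>2 * ((a * (1 - a)) * d) \<le> \<delta>\<^sup>2 * (1 * max d 0)"
    by (intro mult_left_mono) auto
  with mean have le: "(1 - a) * f (- (\<delta> * a)) + a * f (\<delta> * (1 - a)) \<le> \<delta>\<^sup>2 * max d 0"
    by (simp add: mult.assoc)
  have "f (- (\<delta> * a)) \<le> \<delta>\<^sup>2 * max d 0 \<or> f (\<delta> * (1 - a)) \<le> \<delta>\<^sup>2 * max d 0"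
  proof (rule ccontr)
    assume "\<not> ?thesis"
    then have gt: "\<delta>\<^sup>2 * max d 0 < f (- (\<delta> * a))" "\<delta>\<^sup>2 * max d 0 < f (\<delta> * (1 - a))" by auto
    have "\<delta>\<^sup>2 * max d 0 = (1 - a) * (\<delta>\<^sup>2 * max d 0) + a * (\<delta>\<^sup>2 * max d 0)" by (simp add: algebra_simps)
    also have "\<dots> < (1 - a) * f (- (\<delta> * a)) + a * f (\<delta> * (1 - a))"
      using gt a by (intro add_less_le_mono mult_strict_left_mono mult_left_mono) auto
    finally show False using le by simp
  qed
  then show ?thesis
  proof
    assume "f (- (\<delta> * a)) \<le> \<delta>\<^sup>2 * max d 0"
    moreover have "\<delta> * of_int z - t = - (\<delta> * a)" by (simp add: t algebra_simps)
    ultimately show ?thesis using a assms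
      by (intro exI[of _ z]) (simp add: f_def abs_mult)
  next
    assume "f (\<delta> * (1 - a)) \<le> \<delta>\<^sup>2 * max d 0"
    moreover have "\<delta> * of_int (z + 1) - t = \<delta> * (1 - a)" by (simp add: t algebra_simps)
    ultimately show ?thesis using a assms
      by (intro exI[of _ "z + 1"]) (simp add: f_def abs_mult)
  qed
qed

text \<open>
  Derandomized rounding, one coordinate at a time. The bound adds up because rounding one coordinate leaves
  the diagonal coefficients \<open>d\<close> of the others unchanged.
\<close>

lemma quadratic_rounding:
  fixes f :: "('l \<Rightarrow> real) \<Rightarrow> real" and d :: "'l \<Rightarrow> real" and \<delta> :: real
  assumes "finite \<Lambda>" "\<delta> > 0"
    and quad: "\<And>l t. l \<in> \<Lambda> \<Longrightarrow> \<exists>c. \<forall>\<tau>. f (t(l := t l + \<tau>)) = f t + \<tau> * c + \<tau>\<^sup>2 * d l"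
  shows "\<exists>z::'l \<Rightarrow> int. (\<forall>l\<in>\<Lambda>. \<bar>\<delta> * of_int (z l) - t l\<bar> \<le> \<delta>) \<and>
    f (\<lambda>l. if l \<in> \<Lambda> then \<delta> * of_int (z l) else t l) \<le> f t + (\<Sum>l\<in>\<Lambda>. \<delta>\<^sup>2 * max (d l) 0)"
  using assms(1) quad
proof (induction \<Lambda>)
  case empty
  then show ?case by simp
next
  case (insert l \<Lambda>)
  obtain z where z: "\<forall>l\<in>\<Lambda>. \<bar>\<delta> * of_int (z l) - t l\<bar> \<le> \<delta>"
    and fz: "f (\<lambda>l. if l \<in> \<Lambda> then \<delta> * of_int (z l) else t l) \<le> f t + (\<Sum>l\<in>\<Lambda>. \<delta>\<^sup>2 * max (d l) 0)"
    using insert.IH insert.prems by blast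
  define s where "s = (\<lambda>l. if l \<in> \<Lambda> then \<delta> * of_int (z l) else t l)"
  have sl: "s l = t l" using insert.hyps by (simp add: s_def)
  obtain c where c: "\<And>\<tau>. f (s(l := s l + \<tau>)) = f s + \<tau> * c + \<tau>\<^sup>2 * d l"
    using insert.prems[of l s] by blast
  obtain y :: int where y: "\<bar>\<delta> * of_int y - t l\<bar> \<le> \<delta>"
      "(\<delta> * of_int y - t l) * c + (\<delta> * of_int y - t l)\<^sup>2 * d l \<le> \<delta>\<^sup>2 * max (d l) 0"
    using two_point_rounding[OF assms(2)] by blast
  have "(\<lambda>l'. if l' \<in> insert l \<Lambda> then \<delta> * of_int ((z(l := y)) l') else t l') =
      s(l := s l + (\<delta> * of_int y - t l))"
    using insert.hyps by (auto simp: s_def fun_eq_iff)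
  then have "f (\<lambda>l'. if l' \<in> insert l \<Lambda> then \<delta> * of_int ((z(l := y)) l') else t l') \<le>
      f t + (\<Sum>l\<in>insert l \<Lambda>. \<delta>\<^sup>2 * max (d l) 0)"
    using c[of "\<delta> * of_int y - t l"] y(2) fz insert.hyps unfolding s_def[symmetric] by simp
  moreover have "\<forall>l'\<in>insert l \<Lambda>. \<bar>\<delta> * of_int ((z(l := y)) l') - t l'\<bar> \<le> \<delta>"
    using z y(1) by auto
  ultimately show ?case by blast
qed

text \<open>
  With spacing \<open>1 / sqrt (card \<Lambda>)\<close> these are the lattice points of Euclidean norm at most
  2: rounding a unit vector moves each coordinate by at most the spacing, hence the vector by at most 1.
\<close>

definition lattice_ball :: "'l set \<Rightarrow> ('l \<Rightarrow> int) set" where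
  "lattice_ball \<Lambda> = {z \<in> \<Lambda> \<rightarrow>\<^sub>E UNIV. (\<Sum>l\<in>\<Lambda>. (z l)\<^sup>2) \<le> 4 * int (card \<Lambda>)}"

lemma sum_half_power_abs: "(\<Sum>j\<in>{- int n..int n}. (1/2::real) ^ nat \<bar>j\<bar>) \<le> 3 - 2 * (1/2) ^ n"
proof (induction n)
  case (Suc n)
  have eq: "{- int (Suc n)..int (Suc n)} = insert (- int (Suc n)) (insert (int (Suc n)) {- int n..int n})"
    by auto
  have "nat (int n + 1) = Suc n" "nat (1 + int n) = Suc n" by auto
  then show ?case unfolding eq using Suc by simp
qed simp

lemma abs_le_square_int: "\<bar>j\<bar> \<le> (j::int)\<^sup>2"
  by (metis abs_ge_zero linorder_not_less mult_le_cancel_left1 mult_less_0_iff order_refl power2_abs power2_eq_square abs_0 abs_le_zero_iff mult_eq_0_iff int_one_le_iff_zero_less)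

text \<open>
  An integer satisfies \<open>\<bar>j\<bar> \<le> j\<^sup>2\<close>, so the weight
  \<open>\<Prod>\<^sub>l 16 \<cdot> 2\<^bsup>-\<bar>z l\<bar>\<^esup>\<close> is at least 1 on the ball. The
  sum of the weights over a box factorizes, and each factor is at most \<open>16 \<cdot> 3\<close>.
\<close>

lemma lattice_ball_card:
  assumes "finite \<Lambda>"
  shows "finite (lattice_ball \<Lambda>)" "real (card (lattice_ball \<Lambda>)) \<le> 48 ^ card \<Lambda>"
proof -
  define m where "m = card \<Lambda>"
  define Q where "Q = (\<Lambda> \<rightarrow>\<^sub>E {- int (4 * m)..int (4 * m)})"
  have sum_abs: "(\<Sum>l\<in>\<Lambda>. \<bar>z l\<bar>) \<le> 4 * int m" if "z \<in> lattice_ball \<Lambda>" for z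
  proof -
    have "(\<Sum>l\<in>\<Lambda>. \<bar>z l\<bar>) \<le> (\<Sum>l\<in>\<Lambda>. (z l)\<^sup>2)" by (intro sum_mono abs_le_square_int)
    with that show ?thesis by (simp add: lattice_ball_def m_def)
  qed
  have sub: "lattice_ball \<Lambda> \<subseteq> Q"
  proof
    fix z assume z: "z \<in> lattice_ball \<Lambda>"
    have "\<bar>z l\<bar> \<le> 4 * int m" if "l \<in> \<Lambda>" for l
      using sum_abs[OF z] member_le_sum[OF that, of "\<lambda>l. \<bar>z l\<bar>"] assms by simp
    with z show "z \<in> Q" by (fastforce simp: Q_def lattice_ball_def PiE_iff)
  qed
  have finQ: "finite Q" unfolding Q_def using assms by (intro finite_PiE) auto
  then show fin: "finite (lattice_ball \<Lambda>)" using sub finite_subset by blast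
  define w where "w = (\<lambda>z::'a \<Rightarrow> int. \<Prod>l\<in>\<Lambda>. 16 * (1/2::real) ^ nat \<bar>z l\<bar>)"
  have w1: "1 \<le> w z" if "z \<in> lattice_ball \<Lambda>" for z
  proof -
    have "int (\<Sum>l\<in>\<Lambda>. nat \<bar>z l\<bar>) = (\<Sum>l\<in>\<Lambda>. \<bar>z l\<bar>)" by simp
    then have le: "(\<Sum>l\<in>\<Lambda>. nat \<bar>z l\<bar>) \<le> 4 * m" using sum_abs[OF that] by linarith
    have "w z = 16 ^ m * (1/2) ^ (\<Sum>l\<in>\<Lambda>. nat \<bar>z l\<bar>)"
      by (simp add: w_def prod.distrib m_def power_sum)
    also have "\<dots> \<ge> 16 ^ m * (1/2) ^ (4 * m)"
      using le by (intro mult_left_mono power_decreasing) auto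
    also have "16 ^ m * (1/2::real) ^ (4 * m) = 1"
    proof -
      have "(1/2::real) ^ (4 * m) = (1/16) ^ m" by (simp add: power_mult power_divide)
      then show ?thesis by (simp add: power_divide)
    qed
    finally show ?thesis by simp
  qed
  have w0: "0 \<le> w z" for z by (simp add: w_def prod_nonneg)
  have "real (card (lattice_ball \<Lambda>)) = (\<Sum>z\<in>lattice_ball \<Lambda>. 1)" by simp
  also have "\<dots> \<le> (\<Sum>z\<in>lattice_ball \<Lambda>. w z)" by (intro sum_mono w1)
  also have "\<dots> \<le> (\<Sum>z\<in>Q. w z)" using finQ sub w0 by (intro sum_mono2) auto
  also have "\<dots> = (\<Prod>l\<in>\<Lambda>. \<Sum>j\<in>{- int (4 * m)..int (4 * m)}. 16 * (1/2) ^ nat \<bar>j\<bar>)"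
    unfolding w_def Q_def using assms by (subst prod_sum_PiE) auto
  also have "\<dots> \<le> (\<Prod>l\<in>\<Lambda>. 48)"
  proof (intro prod_mono conjI sum_nonneg)
    have "(\<Sum>j\<in>{- int (4 * m)..int (4 * m)}. (1/2::real) ^ nat \<bar>j\<bar>) \<le> 3"
      using sum_half_power_abs[of "4 * m"] zero_le_power[of "1/2::real" "4 * m"] by linarith
    then show "(\<Sum>j\<in>{- int (4 * m)..int (4 * m)}. 16 * (1/2::real) ^ nat \<bar>j\<bar>) \<le> 48"
      by (simp flip: sum_distrib_left)
  qed auto
  finally show "real (card (lattice_ball \<Lambda>)) \<le> 48 ^ card \<Lambda>" by simp
qed

section \<open>Sample means of independent variables\<close>

lemma exp_minus_le: "exp (- y) \<le> 1 - y + y\<^sup>2 / 2" if "0 \<le> (y::real)"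
proof -
  let ?f = "\<lambda>y::real. 1 - y + y\<^sup>2 / 2 - exp (- y)"
  have "?f 0 \<le> ?f y"
  proof (rule DERIV_nonneg_imp_nondecreasing[OF that])
    fix x :: real assume "0 \<le> x"
    have "(?f has_real_derivative (- 1 + x + exp (- x))) (at x)"
      by (auto intro!: derivative_eq_intros)
    moreover have "0 \<le> - 1 + x + exp (- x)" using exp_ge_add_one_self[of "- x"] by simp
    ultimately show "\<exists>D. (?f has_real_derivative D) (at x) \<and> 0 \<le> D" by blast
  qed
  then show ?thesis by simp
qed

text \<open>
  Chernoff's method for lower tails. Since \<open>exp (- y) \<le> 1 - y + y\<^sup>2 / 2\<close> holds for all
  \<open>y \<ge> 0\<close>, the second moment alone controls the Laplace transform, however heavy the upper
  tail is.
\<close>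

lemma iid_lower_tail:
  fixes \<nu> :: "'a measure" and Y :: "'a \<Rightarrow> real"
  assumes "prob_space \<nu>" and [measurable]: "Y \<in> borel_measurable \<nu>"
    and Y0: "\<And>x. 0 \<le> Y x" and Y1: "integrable \<nu> Y" and Y2: "integrable \<nu> (\<lambda>x. (Y x)\<^sup>2)"
    and h: "(\<integral>x. (Y x)\<^sup>2 \<partial>\<nu>) \<le> h" "h > 0" and \<epsilon>: "\<epsilon> \<ge> 0" and k: "1 \<le> k"
  shows "measure (Pi\<^sub>M {1..k} (\<lambda>_. \<nu>))
      {\<omega> \<in> space (Pi\<^sub>M {1..k} (\<lambda>_. \<nu>)). (\<Sum>j=1..k. Y (\<omega> j)) / real k \<le> (\<integral>x. Y x \<partial>\<nu>) - \<epsilon>}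
    \<le> exp (- (real k * \<epsilon>\<^sup>2 / (2 * h)))"
proof -
  interpret \<nu>: prob_space \<nu> by fact
  interpret P: product_prob_space "\<lambda>_::nat. \<nu>" "{1..k}" by unfold_locales
  let ?M = "Pi\<^sub>M {1..k} (\<lambda>_. \<nu>)"
  define \<mu> where "\<mu> = (\<integral>x. Y x \<partial>\<nu>)"
  \<comment> \<open>The minimizer of \<open>- \<theta> \<epsilon> + \<theta>\<^sup>2 h / 2\<close>.\<close>
  define \<theta> where "\<theta> = \<epsilon> / h"
  have \<theta>: "\<theta> \<ge> 0" using h \<epsilon> by (simp add: \<theta>_def)
  have int: "integrable \<nu> (\<lambda>x. exp (- (\<theta> * Y x)))"
    by (rule \<nu>.integrable_const_bound[where B=1]) (use \<theta> Y0 in auto)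
  have "(\<integral>x. exp (- (\<theta> * Y x)) \<partial>\<nu>) \<le> (\<integral>x. 1 - \<theta> * Y x + \<theta>\<^sup>2 / 2 * (Y x)\<^sup>2 \<partial>\<nu>)"
    using int Y1 Y2 exp_minus_le[OF mult_nonneg_nonneg[OF \<theta> Y0]]
    by (intro integral_mono) (auto simp: power_mult_distrib)
  also have "\<dots> = 1 - \<theta> * \<mu> + \<theta>\<^sup>2 / 2 * (\<integral>x. (Y x)\<^sup>2 \<partial>\<nu>)"
    using Y1 Y2 by (simp add: \<mu>_def \<nu>.prob_space)
  also have "\<dots> \<le> 1 + (- \<theta> * \<mu> + \<theta>\<^sup>2 / 2 * h)"
    using h by (simp add: mult_left_mono)
  also have "\<dots> \<le> exp (- \<theta> * \<mu> + \<theta>\<^sup>2 / 2 * h)" by (rule exp_ge_add_one_self)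
  finally have mgf: "(\<integral>x. exp (- (\<theta> * Y x)) \<partial>\<nu>) \<le> exp (- \<theta> * \<mu> + \<theta>\<^sup>2 / 2 * h)" .
  let ?Z = "\<lambda>\<omega>. \<Prod>j\<in>{1..k}. exp (- (\<theta> * Y (\<omega> j)))"
  have intZ: "integrable ?M ?Z"
    by (rule P.product_integrable_prod) (auto intro: int)
  have EZ: "(\<integral>\<omega>. ?Z \<omega> \<partial>?M) = (\<integral>x. exp (- (\<theta> * Y x)) \<partial>\<nu>) ^ k"
    by (subst P.product_integral_prod) (auto intro: int)
  define a where "a = exp (- (\<theta> * (real k * (\<mu> - \<epsilon>))))"
  have Z: "?Z \<omega> = exp (- (\<theta> * (\<Sum>j=1..k. Y (\<omega> j))))" for \<omega>
    by (simp add: exp_sum sum_distrib_left flip: sum_negf)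
  have "measure ?M {\<omega> \<in> space ?M. (\<Sum>j=1..k. Y (\<omega> j)) / real k \<le> \<mu> - \<epsilon>}
      \<le> measure ?M {\<omega> \<in> space ?M. ?Z \<omega> \<ge> a}"
  proof (rule P.finite_measure_mono)
    show "{\<omega> \<in> space ?M. (\<Sum>j=1..k. Y (\<omega> j)) / real k \<le> \<mu> - \<epsilon>} \<subseteq> {\<omega> \<in> space ?M. ?Z \<omega> \<ge> a}"
    proof (safe, goal_cases)
      case (1 \<omega>)
      then have "(\<Sum>j=1..k. Y (\<omega> j)) \<le> real k * (\<mu> - \<epsilon>)" using k by (simp add: field_simps)
      then show ?case unfolding Z a_def using mult_left_mono[OF _ \<theta>] by simp
    qed
    show "{\<omega> \<in> space ?M. ?Z \<omega> \<ge> a} \<in> sets ?M" by measurable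
  qed
  also have "\<dots> \<le> (\<integral>\<omega>. ?Z \<omega> \<partial>?M) / a"
    using intZ by (rule integral_Markov_inequality_measure[OF _ sets.top]) (auto simp: a_def prod_nonneg)
  also have "\<dots> \<le> exp (- \<theta> * \<mu> + \<theta>\<^sup>2 / 2 * h) ^ k / a"
    unfolding EZ by (intro divide_right_mono power_mono mgf) (auto simp: a_def)
  also have "\<dots> = exp (real k * (- \<theta> * \<mu> + \<theta>\<^sup>2 / 2 * h) + \<theta> * (real k * (\<mu> - \<epsilon>)))"
    unfolding a_def exp_of_nat_mult[symmetric] exp_diff[symmetric] by simp
  also have "real k * (- \<theta> * \<mu> + \<theta>\<^sup>2 / 2 * h) + \<theta> * (real k * (\<mu> - \<epsilon>)) = - (real k * \<epsilon>\<^sup>2 / (2 * h))"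
    using h by (simp add: \<theta>_def field_simps power2_eq_square)
  finally show ?thesis unfolding \<mu>_def .
qed

lemma iid_second_moment:
  fixes \<nu> :: "'a measure" and Y :: "'a \<Rightarrow> real"
  assumes "prob_space \<nu>"
    and Y1: "integrable \<nu> Y" and Y2: "integrable \<nu> (\<lambda>x. (Y x)\<^sup>2)"
    and mean: "(\<integral>x. Y x \<partial>\<nu>) = \<mu>" and k: "1 \<le> k"
  shows "integrable (Pi\<^sub>M {1..k} (\<lambda>_. \<nu>)) (\<lambda>\<omega>. ((\<Sum>j=1..k. Y (\<omega> j)) / real k - \<mu>)\<^sup>2)"
    and "(\<integral>\<omega>. ((\<Sum>j=1..k. Y (\<omega> j)) / real k - \<mu>)\<^sup>2 \<partial>Pi\<^sub>M {1..k} (\<lambda>_. \<nu>)) =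
      (\<integral>x. (Y x - \<mu>)\<^sup>2 \<partial>\<nu>) / real k"
proof -
  interpret \<nu>: prob_space \<nu> by fact
  interpret PS: product_sigma_finite "\<lambda>_::nat. \<nu>" by unfold_locales
  let ?M = "Pi\<^sub>M {1..k} (\<lambda>_. \<nu>)"
  define W where "W = (\<lambda>x. Y x - \<mu>)"
  have W1: "integrable \<nu> W" "(\<integral>x. W x \<partial>\<nu>) = 0"
    using Y1 mean by (auto simp: W_def \<nu>.prob_space)
  have "integrable \<nu> (\<lambda>x. (Y x)\<^sup>2 - 2 * \<mu> * Y x + \<mu>\<^sup>2)"
    using Y1 Y2 by (intro Bochner_Integration.integrable_add Bochner_Integration.integrable_diff) auto
  then have W2: "integrable \<nu> (\<lambda>x. W x * W x)"
    by (rule Bochner_Integration.integrable_cong[THEN iffD1, rotated 2]) (auto simp: W_def power2_eq_square algebra_simps)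
  have pair: "integrable ?M (\<lambda>\<omega>. W (\<omega> j) * W (\<omega> j'))"
      "(\<integral>\<omega>. W (\<omega> j) * W (\<omega> j') \<partial>?M) = (if j = j' then \<integral>x. W x * W x \<partial>\<nu> else 0)"
    if j: "j \<in> {1..k}" "j' \<in> {1..k}" for j j'
  proof -
    \<comment> \<open>Written as a product over all coordinates, the integrand integrates factor by factor also for \<open>j = j'\<close>.\<close>
    define g where "g = (\<lambda>i x. (if i = j then W x else 1) * (if i = j' then W x else 1))"
    have g: "integrable \<nu> (g i)" for i
      using W1 W2 by (cases "i = j"; cases "i = j'") (auto simp: g_def)
    have prod_g: "(\<Prod>i\<in>{1..k}. g i (\<omega> i)) = W (\<omega> j) * W (\<omega> j')" for \<omega>
      using j by (simp add: g_def prod.distrib)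
    have "integrable ?M (\<lambda>\<omega>. \<Prod>i\<in>{1..k}. g i (\<omega> i))"
      by (rule PS.product_integrable_prod) (auto intro: g)
    then show "integrable ?M (\<lambda>\<omega>. W (\<omega> j) * W (\<omega> j'))" by (simp only: prod_g)
    have "(\<integral>\<omega>. W (\<omega> j) * W (\<omega> j') \<partial>?M) = (\<Prod>i\<in>{1..k}. \<integral>x. g i x \<partial>\<nu>)"
      unfolding prod_g[symmetric] by (rule PS.product_integral_prod) (auto intro: g)
    also have "\<dots> = (if j = j' then \<integral>x. W x * W x \<partial>\<nu> else 0)"
    proof (cases "j = j'")
      case True
      have "(\<Prod>i\<in>{1..k}. \<integral>x. g i x \<partial>\<nu>) = (\<Prod>i\<in>{1..k}. if i = j then \<integral>x. W x * W x \<partial>\<nu> else 1)"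
        using True by (intro prod.cong refl) (auto simp: g_def \<nu>.prob_space)
      with True j show ?thesis by simp
    next
      case False
      then have "(\<integral>x. g j x \<partial>\<nu>) = 0" using W1 by (simp add: g_def)
      with False j show ?thesis by (auto intro!: prod_zero)
    qed
    finally show "(\<integral>\<omega>. W (\<omega> j) * W (\<omega> j') \<partial>?M) = (if j = j' then \<integral>x. W x * W x \<partial>\<nu> else 0)" .
  qed
  have sq: "((\<Sum>j=1..k. Y (\<omega> j)) / real k - \<mu>)\<^sup>2 =
      (\<Sum>j=1..k. \<Sum>j'=1..k. W (\<omega> j) * W (\<omega> j')) / (real k)\<^sup>2" for \<omega>
  proof -
    have "(\<Sum>j=1..k. W (\<omega> j)) = (\<Sum>j=1..k. Y (\<omega> j)) - real k * \<mu>"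
      by (simp add: W_def sum_subtractf)
    then have "(\<Sum>j=1..k. Y (\<omega> j)) / real k - \<mu> = (\<Sum>j=1..k. W (\<omega> j)) / real k"
      using k by (simp add: field_simps)
    then show ?thesis by (simp add: power_divide power2_eq_square sum_product)
  qed
  show "integrable ?M (\<lambda>\<omega>. ((\<Sum>j=1..k. Y (\<omega> j)) / real k - \<mu>)\<^sup>2)"
    unfolding sq using pair(1) by (intro integrable_divide Bochner_Integration.integrable_sum) auto
  have "(\<integral>\<omega>. ((\<Sum>j=1..k. Y (\<omega> j)) / real k - \<mu>)\<^sup>2 \<partial>?M) =
      (\<Sum>j=1..k. \<Sum>j'=1..k. \<integral>\<omega>. W (\<omega> j) * W (\<omega> j') \<partial>?M) / (real k)\<^sup>2"
  proof -
    have "(\<integral>\<omega>. (\<Sum>j=1..k. \<Sum>j'=1..k. W (\<omega> j) * W (\<omega> j')) \<partial>?M) =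
        (\<Sum>j=1..k. \<integral>\<omega>. (\<Sum>j'=1..k. W (\<omega> j) * W (\<omega> j')) \<partial>?M)"
      using pair(1) by (intro Bochner_Integration.integral_sum Bochner_Integration.integrable_sum)
    also have "\<dots> = (\<Sum>j=1..k. \<Sum>j'=1..k. \<integral>\<omega>. W (\<omega> j) * W (\<omega> j') \<partial>?M)"
      using pair(1) by (intro sum.cong refl Bochner_Integration.integral_sum)
    finally show ?thesis unfolding sq by simp
  qed
  also have "\<dots> = (\<Sum>j=1..k. \<Sum>j'=1..k. if j = j' then \<integral>x. W x * W x \<partial>\<nu> else 0) / (real k)\<^sup>2"
    using pair(2) by (intro arg_cong2[of _ _ _ _ "(/)"] sum.cong refl) auto
  also have "\<dots> = (\<integral>x. W x * W x \<partial>\<nu>) / real k"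
    using k by (simp add: power2_eq_square)
  finally show "(\<integral>\<omega>. ((\<Sum>j=1..k. Y (\<omega> j)) / real k - \<mu>)\<^sup>2 \<partial>?M) = (\<integral>x. (Y x - \<mu>)\<^sup>2 \<partial>\<nu>) / real k"
    by (simp add: W_def power2_eq_square)
qed

section \<open>Variance of rank-one quadratic forms\<close>

lemma isotropic_second_moment:
  fixes \<nu> :: "('i \<Rightarrow> 'f::rc_field) measure"
  assumes "finite I" "isotropic I \<nu>"
  shows "integrable \<nu> (\<lambda>\<omega>. (norm (ip I \<omega> x))\<^sup>2)" "(\<integral>\<omega>. (norm (ip I \<omega> x))\<^sup>2 \<partial>\<nu>) = nsq I x"
proof -
  have expand: "(of_real ((norm (ip I \<omega> x))\<^sup>2) :: 'f) =
      (\<Sum>i\<in>I. \<Sum>j\<in>I. (x j * conjugate (x i)) * (\<omega> i * conjugate (\<omega> j)))" for \<omega>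
  proof -
    have "(of_real ((norm (ip I \<omega> x))\<^sup>2) :: 'f) = ip I x \<omega> * ip I \<omega> x"
      by (simp only: of_real_norm_square conjugate_ip[OF assms(1)] mult.commute)
    then show ?thesis by (simp add: ip_def sum_product mult_ac)
  qed
  have iso: "integrable \<nu> (\<lambda>\<omega>. \<omega> i * conjugate (\<omega> j))"
      "(\<integral>\<omega>. \<omega> i * conjugate (\<omega> j) \<partial>\<nu>) = (if i = j then 1 else 0)" if "i \<in> I" "j \<in> I" for i j
    using assms(2) that by (auto simp: isotropic_def)
  have int: "integrable \<nu> (\<lambda>\<omega>. of_real ((norm (ip I \<omega> x))\<^sup>2) :: 'f)"
    unfolding expand by (intro Bochner_Integration.integrable_sum integrable_mult_right iso)
  show int_real: "integrable \<nu> (\<lambda>\<omega>. (norm (ip I \<omega> x))\<^sup>2)"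
    using integrable_norm[OF int] by (simp add: norm_power)
  have "(of_real (\<integral>\<omega>. (norm (ip I \<omega> x))\<^sup>2 \<partial>\<nu>) :: 'f) = (\<integral>\<omega>. of_real ((norm (ip I \<omega> x))\<^sup>2) \<partial>\<nu>)"
    by (rule integral_bounded_linear[OF bounded_linear_of_real int_real, symmetric])
  also have "\<dots> = (\<Sum>i\<in>I. \<integral>\<omega>. (\<Sum>j\<in>I. (x j * conjugate (x i)) * (\<omega> i * conjugate (\<omega> j))) \<partial>\<nu>)"
    unfolding expand
    by (intro Bochner_Integration.integral_sum Bochner_Integration.integrable_sum integrable_mult_right iso)
  also have "\<dots> = (\<Sum>i\<in>I. \<Sum>j\<in>I. \<integral>\<omega>. (x j * conjugate (x i)) * (\<omega> i * conjugate (\<omega> j)) \<partial>\<nu>)"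
    by (intro sum.cong refl Bochner_Integration.integral_sum integrable_mult_right iso)
  also have "\<dots> = (\<Sum>i\<in>I. \<Sum>j\<in>I. if i = j then x j * conjugate (x i) else 0)"
    using iso by (intro sum.cong refl) (auto simp: integral_mult_right)
  also have "\<dots> = of_real (nsq I x)"
    using assms(1) by (simp add: nsq_def of_real_norm_square of_real_sum del: of_real_power)
  finally show "(\<integral>\<omega>. (norm (ip I \<omega> x))\<^sup>2 \<partial>\<nu>) = nsq I x"
    by (simp only: of_real_eq_iff)
qed

lemma rank_one_variance_eq:
  fixes \<nu> :: "('i \<Rightarrow> 'f::rc_field) measure"
  assumes I: "finite I" and iso: "isotropic I \<nu>"
    and int4: "integrable \<nu> (\<lambda>\<omega>. ((norm (ip I \<omega> x))\<^sup>2)\<^sup>2)"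
  shows "(\<integral>\<omega>. ((norm (ip I \<omega> x))\<^sup>2 - nsq I x)\<^sup>2 \<partial>\<nu>) =
    (\<integral>\<omega>. ((norm (ip I \<omega> x))\<^sup>2)\<^sup>2 \<partial>\<nu>) - (nsq I x)\<^sup>2"
proof -
  interpret prob_space \<nu> using iso by (simp add: isotropic_def random_vector_def)
  have "(\<integral>\<omega>. ((norm (ip I \<omega> x))\<^sup>2 - nsq I x)\<^sup>2 \<partial>\<nu>) =
      (\<integral>\<omega>. ((norm (ip I \<omega> x))\<^sup>2)\<^sup>2 - 2 * nsq I x * (norm (ip I \<omega> x))\<^sup>2 + (nsq I x)\<^sup>2 \<partial>\<nu>)"
    by (simp add: power2_eq_square algebra_simps)
  also have "\<dots> = (\<integral>\<omega>. ((norm (ip I \<omega> x))\<^sup>2)\<^sup>2 \<partial>\<nu>) - 2 * nsq I x * nsq I x + (nsq I x)\<^sup>2"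
    using isotropic_second_moment[OF I iso, of x] int4 by (simp add: prob_space)
  finally show ?thesis by (simp add: power2_eq_square)
qed

text \<open>
  This is the quadratic form condition for the rank-one matrices \<open>x x\<^sup>*\<close> only, whose
  Frobenius norm and trace both equal \<open>nsq I x\<close>. It is all that the injection property takes from
  the law.
\<close>

definition rank_one_variance_bound ::
    "'i set \<Rightarrow> ('i \<Rightarrow> 'f::rc_field) measure \<Rightarrow> real \<Rightarrow> bool" where
  "rank_one_variance_bound I \<nu> s \<longleftrightarrow> 0 \<le> s \<and> isotropic I \<nu> \<and>
     (\<forall>x. integrable \<nu> (\<lambda>\<omega>. ((norm (ip I \<omega> x))\<^sup>2)\<^sup>2) \<and>
        (\<integral>\<omega>. ((norm (ip I \<omega> x))\<^sup>2 - nsq I x)\<^sup>2 \<partial>\<nu>) \<le> s * (nsq I x)\<^sup>2)"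

lemma rank_one_fourth_moment:
  fixes \<nu> :: "('i \<Rightarrow> 'f::rc_field) measure"
  assumes I: "finite I" and \<nu>: "rank_one_variance_bound I \<nu> s"
  shows "(\<integral>\<omega>. ((norm (ip I \<omega> x))\<^sup>2)\<^sup>2 \<partial>\<nu>) \<le> (1 + s) * (nsq I x)\<^sup>2"
proof -
  have iso: "isotropic I \<nu>" and int4: "integrable \<nu> (\<lambda>\<omega>. ((norm (ip I \<omega> x))\<^sup>2)\<^sup>2)"
    and var: "(\<integral>\<omega>. ((norm (ip I \<omega> x))\<^sup>2 - nsq I x)\<^sup>2 \<partial>\<nu>) \<le> s * (nsq I x)\<^sup>2"
    using \<nu> by (auto simp: rank_one_variance_bound_def)
  show ?thesis using var unfolding rank_one_variance_eq[OF I iso int4] by (simp add: distrib_right)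
qed

text \<open>
  For \<open>A = \<bar>p\<bar>\<^sup>2\<close> and \<open>B = \<bar>q\<bar>\<^sup>2\<close> the four squares
  on the right add up to
  \<open>2 (A + B)\<^sup>2 + 2 (A + U)\<^sup>2 + 2 c\<^sup>2 + 2 c\<^sub>u\<^sup>2\<close>, where
  \<open>U = \<bar>u q\<bar>\<^sup>2\<close> and \<open>c\<close>, \<open>c\<^sub>u\<close> are twice the real
  inner products of \<open>p\<close> with \<open>q\<close> and \<open>u q\<close>. As \<open>1\<close> and
  \<open>u\<close> provide all real coordinates, \<open>c\<^sup>2 + c\<^sub>u\<^sup>2 \<ge> 4 A B\<close>. So
  the right-hand side is at least \<open>6 (A + B)\<^sup>2\<close>, and a square is above its tangent at 2.
\<close>

lemma two_coordinates_bound: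
  fixes p q u :: "'f::rc_field"
  assumes u: "\<And>z::'f. \<exists>s t. z = s *\<^sub>R 1 + t *\<^sub>R u \<and> (norm z)\<^sup>2 = s\<^sup>2 + t\<^sup>2"
  shows "24 * ((norm p)\<^sup>2 + (norm q)\<^sup>2 - 1) \<le>
    ((norm (p + q))\<^sup>2)\<^sup>2 + ((norm (p - q))\<^sup>2)\<^sup>2 + ((norm (p + u * q))\<^sup>2)\<^sup>2 + ((norm (p - u * q))\<^sup>2)\<^sup>2
    + 2 * ((norm p)\<^sup>2)\<^sup>2 + 4 * ((norm q)\<^sup>2)\<^sup>2"
proof -
  define A where "A = (norm p)\<^sup>2"
  define B where "B = (norm q)\<^sup>2"
  define U where "U = (norm (u * q))\<^sup>2"
  define c where "c = (norm (p + q))\<^sup>2 - A - B"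
  define cu where "cu = (norm (p + u * q))\<^sup>2 - A - U"
  define w where "w = p * conjugate q"
  have c: "(of_real c :: 'f) = w + conjugate w"
    unfolding c_def A_def B_def of_real_diff norm_add_square
    by (simp add: w_def conjugate_dist_mul mult.commute)
  have cu: "(of_real cu :: 'f) = w * conjugate u + conjugate w * u"
    unfolding cu_def A_def U_def of_real_diff norm_add_square
    by (simp add: w_def conjugate_dist_mul mult_ac)
  obtain s t where w: "w = s *\<^sub>R 1 + t *\<^sub>R u" and nw: "(norm w)\<^sup>2 = s\<^sup>2 + t\<^sup>2" using u by blast
  have w': "w = of_real s + of_real t * u" using w by (simp add: scaleR_conv_of_real)
  then have cw: "conjugate w = of_real s + of_real t * conjugate u"
    by (simp add: conjugate_dist_add conjugate_dist_mul)
  have "(of_real (2 * (norm w)\<^sup>2) :: 'f) = w * conjugate w + conjugate w * w"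
    by (simp add: of_real_norm_square mult.commute del: of_real_power)
  also have "\<dots> = w * (of_real s + of_real t * conjugate u) + conjugate w * (of_real s + of_real t * u)"
    using w' cw by metis
  also have "\<dots> = of_real (s * c + t * cu)"
    by (simp add: c cu algebra_simps)
  finally have W: "2 * (norm w)\<^sup>2 = s * c + t * cu" by (simp only: of_real_eq_iff)
  have AB: "A * B = (norm w)\<^sup>2" by (simp add: A_def B_def w_def norm_mult power_mult_distrib)
  have "4 * (A * B) \<le> c\<^sup>2 + cu\<^sup>2"
  proof (cases "A * B = 0")
    case False
    have "0 \<le> (s * cu - t * c)\<^sup>2" by simp
    then have "(s * c + t * cu)\<^sup>2 \<le> (s\<^sup>2 + t\<^sup>2) * (c\<^sup>2 + cu\<^sup>2)"
      by (simp add: power2_eq_square algebra_simps)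
    then have "(A * B) * (4 * (A * B)) \<le> (A * B) * (c\<^sup>2 + cu\<^sup>2)"
      unfolding AB W[symmetric] nw[symmetric] by (simp add: power2_eq_square)
    moreover have "0 < A * B" using False by (simp add: A_def B_def order_le_less)
    ultimately show ?thesis by (simp only: mult_le_cancel_left_pos)
  next
    case True
    moreover have "0 \<le> c\<^sup>2 + cu\<^sup>2" by simp
    ultimately show ?thesis by linarith
  qed
  moreover have eqs: "(norm (p + q))\<^sup>2 = A + B + c" "(norm (p - q))\<^sup>2 = A + B - c"
      "(norm (p + u * q))\<^sup>2 = A + U + cu" "(norm (p - u * q))\<^sup>2 = A + U - cu"
    using norm_parallelogram[of p q] norm_parallelogram[of p "u * q"]
    by (auto simp: A_def B_def U_def c_def cu_def)
  moreover have "0 \<le> A" "0 \<le> U" by (auto simp: A_def U_def)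
  ultimately have "4 * (A * B) + A\<^sup>2 \<le> c\<^sup>2 + cu\<^sup>2 + (A + U)\<^sup>2"
    by (intro add_mono power_mono) auto
  moreover have "0 \<le> (A + B - 2)\<^sup>2" by simp
  ultimately show ?thesis unfolding eqs A_def[symmetric] B_def[symmetric]
    by (simp add: power2_eq_square algebra_simps)
qed

text \<open>
  If all one-dimensional marginals had constant modulus, then so would
  \<open>p = \<langle>\<omega>, e\<^sub>0\<rangle>\<close>,
  \<open>q = \<langle>\<omega>, e\<^sub>1\<rangle>\<close> and \<open>p \<plusminus> q\<close>,
  \<open>p \<plusminus> u q\<close>, which is impossible. Quantitatively, take expectations in
  \<open>two_coordinates_bound\<close>: isotropy makes the left-hand side 24, and the fourth moment bound
  makes the right-hand side at most \<open>22 (1 + s)\<close>.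
\<close>

lemma rank_one_variance_lower_bound:
  fixes e :: "nat \<Rightarrow> 'i \<Rightarrow> 'f::rc_field" and \<nu> :: "('i \<Rightarrow> 'f::rc_field) measure"
  assumes I: "finite I" and \<nu>: "rank_one_variance_bound I \<nu> s"
    and e: "orthonormal I m e" and m: "2 \<le> m"
  shows "1 / 11 \<le> s"
proof -
  have iso: "isotropic I \<nu>" and int4: "\<And>x. integrable \<nu> (\<lambda>\<omega>. ((norm (ip I \<omega> x))\<^sup>2)\<^sup>2)" and s: "0 \<le> s"
    using \<nu> by (auto simp: rank_one_variance_bound_def)
  interpret prob_space \<nu> using iso by (simp add: isotropic_def random_vector_def)
  obtain u :: 'f where u1: "norm u \<le> 1"
    and u: "\<And>z::'f. \<exists>s t. z = s *\<^sub>R 1 + t *\<^sub>R u \<and> (norm z)\<^sup>2 = s\<^sup>2 + t\<^sup>2"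
    using real_coordinates by blast
  let ?F = "\<lambda>x \<omega>. ((norm (ip I \<omega> x))\<^sup>2)\<^sup>2"
  let ?x = "e 0" and ?y = "e 1"
  let ?v = "\<lambda>c i. ?x i + c * ?y i"
  have F: "expectation (?F x) \<le> (1 + s) * (nsq I x)\<^sup>2" for x
    by (rule rank_one_fourth_moment[OF I \<nu>])
  have xy: "nsq I ?x = 1" "nsq I ?y = 1" using orthonormal_nsq[OF e] m by auto
  have nv: "nsq I (?v c) \<le> 2" if "norm c \<le> 1" for c
  proof -
    have "nsq I (?v c) = nsq I (\<lambda>i. \<Sum>l<2. (if l = 0 then 1 else c) * e l i)"
      by (intro nsq_cong) (simp add: numeral_2_eq_2)
    also have "\<dots> = 1 + (norm c)\<^sup>2"
    proof -
      have "orthonormal I 2 e" using e m by (auto simp: orthonormal_def)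
      then show ?thesis
        by (subst nsq_orthonormal_combination[OF I]) (auto simp: numeral_2_eq_2)
    qed
    also have "\<dots> \<le> 2" using power_mono[OF that, of 2] by simp
    finally show ?thesis .
  qed
  have Fv: "expectation (?F (?v c)) \<le> (1 + s) * 4" if "norm c \<le> 1" for c
  proof -
    have "(nsq I (?v c))\<^sup>2 \<le> 2\<^sup>2" using nv[OF that] by (intro power_mono) auto
    then have "(1 + s) * (nsq I (?v c))\<^sup>2 \<le> (1 + s) * 4" using s by (intro mult_left_mono) auto
    with F[of "?v c"] show ?thesis by linarith
  qed
  have ipv: "ip I \<omega> (?v c) = ip I \<omega> ?x + c * ip I \<omega> ?y" for \<omega> c
    unfolding ip_add_right ip_scale_right ..
  have "24 = expectation (\<lambda>\<omega>. 24 * ((norm (ip I \<omega> ?x))\<^sup>2 + (norm (ip I \<omega> ?y))\<^sup>2 - 1))"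
    using isotropic_second_moment[OF I iso] xy by (simp add: prob_space)
  also have "\<dots> \<le> expectation (\<lambda>\<omega>. ?F (?v 1) \<omega> + ?F (?v (-1)) \<omega> + ?F (?v u) \<omega> + ?F (?v (-u)) \<omega>
      + 2 * ?F ?x \<omega> + 4 * ?F ?y \<omega>)"
  proof (rule integral_mono)
    show "integrable \<nu> (\<lambda>\<omega>. 24 * ((norm (ip I \<omega> ?x))\<^sup>2 + (norm (ip I \<omega> ?y))\<^sup>2 - 1))"
      using isotropic_second_moment(1)[OF I iso] by simp
    show "integrable \<nu> (\<lambda>\<omega>. ?F (?v 1) \<omega> + ?F (?v (-1)) \<omega> + ?F (?v u) \<omega> + ?F (?v (-u)) \<omega>
      + 2 * ?F ?x \<omega> + 4 * ?F ?y \<omega>)"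
      by (intro Bochner_Integration.integrable_add integrable_mult_right int4)
    show "24 * ((norm (ip I \<omega> ?x))\<^sup>2 + (norm (ip I \<omega> ?y))\<^sup>2 - 1) \<le>
      ?F (?v 1) \<omega> + ?F (?v (-1)) \<omega> + ?F (?v u) \<omega> + ?F (?v (-u)) \<omega> + 2 * ?F ?x \<omega> + 4 * ?F ?y \<omega>" for \<omega>
      unfolding ipv using two_coordinates_bound[OF u, of "ip I \<omega> ?x" "ip I \<omega> ?y"] by simp
  qed
  also have "\<dots> = expectation (?F (?v 1)) + expectation (?F (?v (-1))) + expectation (?F (?v u))
      + expectation (?F (?v (-u))) + 2 * expectation (?F ?x) + 4 * expectation (?F ?y)"
    by (subst Bochner_Integration.integral_add | intro Bochner_Integration.integrable_add integrable_mult_right int4)+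
       simp
  also have "\<dots> \<le> (1 + s) * 4 + (1 + s) * 4 + (1 + s) * 4 + (1 + s) * 4 + 2 * (1 + s) + 4 * (1 + s)"
  proof -
    have "expectation (?F ?x) \<le> 1 + s" "expectation (?F ?y) \<le> 1 + s"
      using F[of ?x] F[of ?y] unfolding xy by simp_all
    then show ?thesis using u1 by (intro add_mono mult_left_mono Fv) auto
  qed
  finally show ?thesis by simp
qed

section \<open>Sample energies\<close>

text \<open>
  The squared norm of \<open>\<Omega>\<^sup>* x\<close> for the test matrix \<open>\<Omega>\<close> with
  columns \<open>k\<^bsup>-1/2\<^esup> \<omega>\<^sub>j\<close>; see
  \<open>sq_norm_adjoint_mult_test_matrix\<close>.
\<close>

definition sample_energy :: "'i set \<Rightarrow> nat \<Rightarrow> (nat \<Rightarrow> 'i \<Rightarrow> 'f::rc_field) \<Rightarrow> ('i \<Rightarrow> 'f) \<Rightarrow> real" where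
  "sample_energy I k \<omega> x = (\<Sum>j=1..k. (norm (ip I (\<omega> j) x))\<^sup>2) / real k"

lemma sample_energy_nonneg [simp]: "0 \<le> sample_energy I k \<omega> x"
  by (simp add: sample_energy_def sum_nonneg)

lemma sample_energy_cong:
  "(\<And>i. i \<in> I \<Longrightarrow> x i = x' i) \<Longrightarrow> sample_energy I k \<omega> x = sample_energy I k \<omega> x'"
  unfolding sample_energy_def by (intro arg_cong2[of _ _ _ _ "(/)"] sum.cong refl) (simp add: ip_def)

lemma sample_energy_scale:
  "sample_energy I k \<omega> (\<lambda>i. c * x i) = (norm c)\<^sup>2 * sample_energy I k \<omega> x"
  by (simp add: sample_energy_def ip_scale_right norm_mult power_mult_distrib sum_distrib_left)

lemma nsq_add_real_multiple:
  fixes x b :: "'i \<Rightarrow> 'f::rc_field"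
  shows "nsq I (\<lambda>i. x i + of_real \<tau> * b i) =
    nsq I x + \<tau> * (nsq I (\<lambda>i. x i + b i) - nsq I x - nsq I b) + \<tau>\<^sup>2 * nsq I b"
  unfolding nsq_def norm_add_real_multiple_square
  by (simp add: sum.distrib sum_subtractf sum_distrib_left right_diff_distrib)

lemma sample_energy_add_real_multiple:
  fixes x b :: "'i \<Rightarrow> 'f::rc_field"
  shows "sample_energy I k \<omega> (\<lambda>i. x i + of_real \<tau> * b i) =
    sample_energy I k \<omega> x + \<tau> * (sample_energy I k \<omega> (\<lambda>i. x i + b i)
      - sample_energy I k \<omega> x - sample_energy I k \<omega> b) + \<tau>\<^sup>2 * sample_energy I k \<omega> b"
proof -
  have "(\<Sum>j=1..k. (norm (ip I (\<omega> j) (\<lambda>i. x i + of_real \<tau> * b i)))\<^sup>2) =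
    (\<Sum>j=1..k. (norm (ip I (\<omega> j) x))\<^sup>2) + \<tau> * ((\<Sum>j=1..k. (norm (ip I (\<omega> j) (\<lambda>i. x i + b i)))\<^sup>2)
      - (\<Sum>j=1..k. (norm (ip I (\<omega> j) x))\<^sup>2) - (\<Sum>j=1..k. (norm (ip I (\<omega> j) b))\<^sup>2))
      + \<tau>\<^sup>2 * (\<Sum>j=1..k. (norm (ip I (\<omega> j) b))\<^sup>2)"
    unfolding ip_add_right ip_scale_right norm_add_real_multiple_square
    by (simp add: sum.distrib sum_subtractf sum_distrib_left right_diff_distrib)
  then show ?thesis unfolding sample_energy_def
    by (simp add: add_divide_distrib diff_divide_distrib right_diff_distrib)
qed

text \<open>
  Real coordinates on the span of \<open>e\<close>: every vector of the span is a real combination of the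
  vectors \<open>e l\<close> and \<open>u e l\<close>.
\<close>

definition real_direction :: "'f::rc_field \<Rightarrow> (nat \<Rightarrow> 'i \<Rightarrow> 'f) \<Rightarrow> nat \<times> bool \<Rightarrow> 'i \<Rightarrow> 'f" where
  "real_direction u e = (\<lambda>(l, c) i. (if c then u else 1) * e l i)"

definition real_combination ::
    "nat \<Rightarrow> 'f::rc_field \<Rightarrow> (nat \<Rightarrow> 'i \<Rightarrow> 'f) \<Rightarrow> (nat \<times> bool \<Rightarrow> real) \<Rightarrow> 'i \<Rightarrow> 'f" where
  "real_combination m u e t =
    (\<lambda>i. \<Sum>l\<in>{..<m} \<times> UNIV. of_real (t l) * real_direction u e l i)"

lemma sum_times_bool:
  "(\<Sum>l\<in>{..<m} \<times> (UNIV :: bool set). g l) = (\<Sum>l<m. g (l, False) + g (l, True))"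
proof -
  have "(\<Sum>l\<in>{..<m} \<times> (UNIV :: bool set). g l) = (\<Sum>l<m. \<Sum>c\<in>UNIV. g (l, c))"
    by (simp add: sum.cartesian_product)
  then show ?thesis by (simp add: UNIV_bool)
qed

lemma real_combination_eq:
  "real_combination m u e t =
    (\<lambda>i. \<Sum>l<m. (of_real (t (l, False)) + of_real (t (l, True)) * u) * e l i)"
  by (simp add: real_combination_def sum_times_bool real_direction_def algebra_simps)

lemma real_combination_update:
  assumes "l \<in> {..<m} \<times> UNIV"
  shows "real_combination m u e (t(l := t l + \<tau>)) =
    (\<lambda>i. real_combination m u e t i + of_real \<tau> * real_direction u e l i)"
proof
  fix i
  have "real_combination m u e (t(l := t l + \<tau>)) i = (\<Sum>l'\<in>{..<m} \<times> UNIV.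
      of_real (t l') * real_direction u e l' i + (if l = l' then of_real \<tau> * real_direction u e l' i else 0))"
    unfolding real_combination_def by (intro sum.cong refl) (auto simp: algebra_simps)
  also have "\<dots> = real_combination m u e t i + of_real \<tau> * real_direction u e l i"
    using assms by (simp add: sum.distrib real_combination_def)
  finally show "real_combination m u e (t(l := t l + \<tau>)) i =
    real_combination m u e t i + of_real \<tau> * real_direction u e l i" .
qed

lemma nsq_real_combination_le:
  assumes "finite I" "orthonormal I m e" "norm u \<le> 1"
  shows "nsq I (real_combination m u e t) \<le> 2 * (\<Sum>l\<in>{..<m} \<times> UNIV. (t l)\<^sup>2)"
proof -
  have "(norm (of_real (t (l, False)) + of_real (t (l, True)) * u))\<^sup>2 \<le>
      2 * ((t (l, False))\<^sup>2 + (t (l, True))\<^sup>2)" for l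
  proof -
    have "norm (of_real (t (l, False)) + of_real (t (l, True)) * u) \<le>
        \<bar>t (l, False)\<bar> + \<bar>t (l, True)\<bar> * norm u"
      by (rule order_trans[OF norm_triangle_ineq]) (simp add: norm_mult)
    also have "\<dots> \<le> \<bar>t (l, False)\<bar> + \<bar>t (l, True)\<bar>"
      using mult_left_mono[OF assms(3), of "\<bar>t (l, True)\<bar>"] by simp
    finally have "(norm (of_real (t (l, False)) + of_real (t (l, True)) * u))\<^sup>2 \<le>
        (\<bar>t (l, False)\<bar> + \<bar>t (l, True)\<bar>)\<^sup>2"
      by (intro power_mono) auto
    also have "\<dots> \<le> 2 * ((t (l, False))\<^sup>2 + (t (l, True))\<^sup>2)"
      using sum_squares_bound[of "\<bar>t (l, False)\<bar>" "\<bar>t (l, True)\<bar>"] by (simp add: power2_sum)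
    finally show ?thesis .
  qed
  then show ?thesis
    unfolding real_combination_eq nsq_orthonormal_combination[OF assms(1,2)] sum_times_bool
      sum_distrib_left by (rule sum_mono)
qed

definition grid_point :: "nat \<Rightarrow> 'f::rc_field \<Rightarrow> (nat \<Rightarrow> 'i \<Rightarrow> 'f) \<Rightarrow> (nat \<times> bool \<Rightarrow> int) \<Rightarrow> 'i \<Rightarrow> 'f" where
  "grid_point m u e z = real_combination m u e (\<lambda>l. 1 / sqrt (2 * real m) * of_int (z l))"

lemma nsq_grid_point_le:
  assumes "finite I" "orthonormal I m e" "norm u \<le> 1" "z \<in> lattice_ball ({..<m} \<times> UNIV)" "m > 0"
  shows "nsq I (grid_point m u e z) \<le> 8"
proof -
  have "(\<Sum>l\<in>{..<m} \<times> UNIV. (z l)\<^sup>2) \<le> 4 * int (2 * m)"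
    using assms(4) by (simp add: lattice_ball_def card_cartesian_product)
  then have "real_of_int (\<Sum>l\<in>{..<m} \<times> UNIV. (z l)\<^sup>2) \<le> real_of_int (4 * int (2 * m))"
    by (simp only: of_int_le_iff)
  then have z: "(\<Sum>l\<in>{..<m} \<times> UNIV. (of_int (z l))\<^sup>2) \<le> 8 * real m"
    by simp
  have "(\<Sum>l\<in>{..<m} \<times> UNIV. (1 / sqrt (2 * real m) * of_int (z l))\<^sup>2) =
      (\<Sum>l\<in>{..<m} \<times> UNIV. (of_int (z l))\<^sup>2) / (2 * real m)"
    by (simp add: power_divide sum_divide_distrib)
  also have "\<dots> \<le> 4" using z \<open>m > 0\<close> by (simp add: field_simps)
  finally show ?thesis
    using nsq_real_combination_le[OF assms(1-3), of "\<lambda>l. 1 / sqrt (2 * real m) * of_int (z l)"]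
    unfolding grid_point_def by linarith
qed

text \<open>
  Apply \<open>quadratic_rounding\<close> to \<open>f = sample_energy - nsq\<close> in real coordinates. At
  the rounded point \<open>f\<close> exceeds \<open>- \<tau>\<close>, and rounding increases \<open>f\<close>
  by at most the mean of the positive parts of its diagonal coefficients, which is at most
  \<open>\<tau>\<close> by \<open>d \<le> \<tau> / 2 + d\<^sup>2 / (2 \<tau>)\<close>.
\<close>

lemma energy_lower_bound_from_grid:
  fixes e :: "nat \<Rightarrow> 'i \<Rightarrow> 'f::rc_field"
  assumes I: "finite I" and e: "orthonormal I m e" and m: "m > 0" and \<tau>: "\<tau> > 0"
    and u: "norm u \<le> 1" "\<And>z. \<exists>s t. z = s *\<^sub>R 1 + t *\<^sub>R u \<and> (norm z)\<^sup>2 = s\<^sup>2 + t\<^sup>2"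
    and grid: "\<And>z. z \<in> lattice_ball ({..<m} \<times> UNIV) \<Longrightarrow>
      nsq I (grid_point m u e z) - \<tau> < sample_energy I k \<omega> (grid_point m u e z)"
    and diag: "(\<Sum>l\<in>{..<m} \<times> UNIV. (sample_energy I k \<omega> (real_direction u e l) - nsq I (real_direction u e l))\<^sup>2)
      \<le> 2 * real m * \<tau>\<^sup>2"
    and y: "(\<Sum>l<m. (norm (y l))\<^sup>2) = 1"
  shows "1 - 2 * \<tau> \<le> sample_energy I k \<omega> (\<lambda>i. \<Sum>l<m. y l * e l i)"
proof -
  let ?\<Lambda> = "{..<m} \<times> (UNIV :: bool set)"
  define \<delta> where "\<delta> = 1 / sqrt (2 * real m)"
  have \<delta>: "\<delta> > 0" "\<delta>\<^sup>2 * (2 * real m) = 1" using m by (auto simp: \<delta>_def power_divide)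
  obtain s t where st: "\<And>z. z = s z *\<^sub>R 1 + t z *\<^sub>R u \<and> (norm z)\<^sup>2 = (s z)\<^sup>2 + (t z)\<^sup>2"
    using u(2) by metis
  define T where "T = (\<lambda>(l, c). if c then t (y l) else s (y l))"
  have yT: "of_real (T (l, False)) + of_real (T (l, True)) * u = y l" for l
    using st[of "y l"] by (simp add: T_def scaleR_conv_of_real)
  have x: "real_combination m u e T = (\<lambda>i. \<Sum>l<m. y l * e l i)"
    unfolding real_combination_eq yT ..
  have sumT: "(\<Sum>l\<in>?\<Lambda>. (T l)\<^sup>2) = 1"
    using st y unfolding sum_times_bool by (simp add: T_def)
  define f where "f = (\<lambda>t. sample_energy I k \<omega> (real_combination m u e t) - nsq I (real_combination m u e t))"
  define d where "d = (\<lambda>l. sample_energy I k \<omega> (real_direction u e l) - nsq I (real_direction u e l))"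
  have quad: "\<exists>c. \<forall>\<tau>. f (t(l := t l + \<tau>)) = f t + \<tau> * c + \<tau>\<^sup>2 * d l" if "l \<in> ?\<Lambda>" for l t
    unfolding f_def d_def real_combination_update[OF that] sample_energy_add_real_multiple
      nsq_add_real_multiple
    by (rule exI[of _ "(sample_energy I k \<omega> (\<lambda>i. real_combination m u e t i + real_direction u e l i)
        - sample_energy I k \<omega> (real_combination m u e t) - sample_energy I k \<omega> (real_direction u e l))
      - (nsq I (\<lambda>i. real_combination m u e t i + real_direction u e l i)
        - nsq I (real_combination m u e t) - nsq I (real_direction u e l))"])
       (simp add: algebra_simps)
  have "\<exists>z::nat \<times> bool \<Rightarrow> int. (\<forall>l\<in>?\<Lambda>. \<bar>\<delta> * of_int (z l) - T l\<bar> \<le> \<delta>) \<and>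
      f (\<lambda>l. if l \<in> ?\<Lambda> then \<delta> * of_int (z l) else T l) \<le> f T + (\<Sum>l\<in>?\<Lambda>. \<delta>\<^sup>2 * max (d l) 0)"
    by (rule quadratic_rounding[OF _ \<delta>(1) quad]) auto
  then obtain z :: "nat \<times> bool \<Rightarrow> int" where
    z: "\<And>l. l \<in> ?\<Lambda> \<Longrightarrow> \<bar>\<delta> * of_int (z l) - T l\<bar> \<le> \<delta>" and
    fz: "f (\<lambda>l. if l \<in> ?\<Lambda> then \<delta> * of_int (z l) else T l) \<le> f T + (\<Sum>l\<in>?\<Lambda>. \<delta>\<^sup>2 * max (d l) 0)"
    by (elim exE conjE) blast
  define z' where "z' = restrict z ?\<Lambda>"
  have "(\<delta> * of_int (z l))\<^sup>2 \<le> 2 * (T l)\<^sup>2 + 2 * \<delta>\<^sup>2" if "l \<in> ?\<Lambda>" for l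
  proof -
    have "(\<delta> * of_int (z l) - T l)\<^sup>2 \<le> \<delta>\<^sup>2"
      using z[OF that] \<delta>(1) abs_le_square_iff[of "\<delta> * of_int (z l) - T l" \<delta>] by simp
    moreover have "0 \<le> (\<delta> * of_int (z l) - 2 * T l)\<^sup>2" by simp
    ultimately show ?thesis by (simp add: power2_eq_square algebra_simps)
  qed
  then have "(\<Sum>l\<in>?\<Lambda>. (\<delta> * of_int (z l))\<^sup>2) \<le> (\<Sum>l\<in>?\<Lambda>. 2 * (T l)\<^sup>2 + 2 * \<delta>\<^sup>2)"
    by (rule sum_mono)
  also have "\<dots> = 4"
    using \<delta>(2) by (simp add: sum.distrib sumT card_cartesian_product mult_ac flip: sum_distrib_left)
  finally have "\<delta>\<^sup>2 * (\<Sum>l\<in>?\<Lambda>. (of_int (z l))\<^sup>2) \<le> \<delta>\<^sup>2 * (4 * (2 * real m))"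
    using \<delta>(2) by (simp add: power_mult_distrib sum_distrib_left)
  then have "(\<Sum>l\<in>?\<Lambda>. (real_of_int (z l))\<^sup>2) \<le> 4 * (2 * real m)"
    using \<delta>(1) by (simp only: mult_le_cancel_left_pos zero_less_power)
  then have "real_of_int (\<Sum>l\<in>?\<Lambda>. (z l)\<^sup>2) \<le> real_of_int (4 * int (2 * m))" by simp
  then have "(\<Sum>l\<in>?\<Lambda>. (z l)\<^sup>2) \<le> 4 * int (2 * m)" by (simp only: of_int_le_iff)
  then have z'_ball: "z' \<in> lattice_ball ?\<Lambda>"
    by (auto simp: lattice_ball_def z'_def card_cartesian_product)
  have "real_combination m u e (\<lambda>l. if l \<in> ?\<Lambda> then \<delta> * of_int (z l) else T l) = grid_point m u e z'"
    unfolding grid_point_def real_combination_eq by (simp add: z'_def \<delta>_def)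
  then have "- \<tau> < f (\<lambda>l. if l \<in> ?\<Lambda> then \<delta> * of_int (z l) else T l)"
    using grid[OF z'_ball] by (simp add: f_def)
  with fz have "- \<tau> < f T + \<delta>\<^sup>2 * (\<Sum>l\<in>?\<Lambda>. max (d l) 0)"
    by (simp add: sum_distrib_left)
  moreover have "\<delta>\<^sup>2 * (\<Sum>l\<in>?\<Lambda>. max (d l) 0) \<le> \<tau>"
  proof -
    have "max (d l) 0 \<le> \<tau> / 2 + (d l)\<^sup>2 / (2 * \<tau>)" for l
    proof -
      have "0 \<le> (d l - \<tau>)\<^sup>2" by simp
      then have "2 * \<tau> * d l \<le> \<tau>\<^sup>2 + (d l)\<^sup>2" by (simp add: power2_eq_square algebra_simps)
      then have "d l \<le> (\<tau>\<^sup>2 + (d l)\<^sup>2) / (2 * \<tau>)" using \<tau> by (simp add: field_simps)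
      moreover have "(\<tau>\<^sup>2 + (d l)\<^sup>2) / (2 * \<tau>) = \<tau> / 2 + (d l)\<^sup>2 / (2 * \<tau>)"
        using \<tau> by (simp add: field_simps power2_eq_square)
      ultimately show ?thesis using \<tau> by simp
    qed
    then have "(\<Sum>l\<in>?\<Lambda>. max (d l) 0) \<le> (\<Sum>l\<in>?\<Lambda>. \<tau> / 2 + (d l)\<^sup>2 / (2 * \<tau>))" by (rule sum_mono)
    also have "\<dots> = real m * \<tau> + (\<Sum>l\<in>?\<Lambda>. (d l)\<^sup>2) / (2 * \<tau>)"
      by (simp add: sum.distrib sum_divide_distrib card_cartesian_product)
    also have "\<dots> \<le> real m * \<tau> + 2 * real m * \<tau>\<^sup>2 / (2 * \<tau>)"
      using diag \<tau> by (intro add_left_mono divide_right_mono) (auto simp: d_def)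
    also have "\<dots> = 2 * real m * \<tau>" using \<tau> by (simp add: power2_eq_square)
    finally have "\<delta>\<^sup>2 * (\<Sum>l\<in>?\<Lambda>. max (d l) 0) \<le> \<delta>\<^sup>2 * (2 * real m * \<tau>)"
      by (intro mult_left_mono) auto
    then show ?thesis using \<delta>(2) by (simp add: mult.assoc[symmetric])
  qed
  moreover have "nsq I (real_combination m u e T) = 1"
    unfolding x using nsq_orthonormal_combination[OF I e] y by simp
  ultimately have "1 - 2 * \<tau> \<le> sample_energy I k \<omega> (real_combination m u e T)"
    by (simp add: f_def)
  then show ?thesis unfolding x .
qed

section \<open>Deviations of the sample energy\<close>

lemma measurable_random_vector_component:
  "random_vector I \<nu> \<Longrightarrow> i \<in> I \<Longrightarrow> (\<lambda>\<omega>. \<omega> i) \<in> borel_measurable \<nu>"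
  by (subst measurable_cong_sets[of \<nu> "Pi\<^sub>M I (\<lambda>_. borel)"]) (auto simp: random_vector_def)

lemma measurable_ip:
  assumes "random_vector I \<nu>"
  shows "(\<lambda>\<omega>. ip I \<omega> x) \<in> borel_measurable \<nu>"
  unfolding ip_def
  by (intro borel_measurable_sum borel_measurable_times borel_measurable_const
      measurable_compose[OF measurable_random_vector_component[OF assms] borel_measurable_conjugate])

lemma measurable_sample_energy:
  assumes "random_vector I \<nu>"
  shows "(\<lambda>\<omega>. sample_energy I k \<omega> x) \<in> borel_measurable (Pi\<^sub>M {1..k} (\<lambda>_. \<nu>))"
proof -
  have [measurable]: "(\<lambda>\<omega>. ip I (\<omega> j) x) \<in> borel_measurable (Pi\<^sub>M {1..k} (\<lambda>_. \<nu>))" if "j \<in> {1..k}" for j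
    by (rule measurable_compose[OF measurable_component_singleton[OF that] measurable_ip[OF assms]])
  show ?thesis unfolding sample_energy_def by measurable
qed

lemma sample_energy_variance:
  assumes I: "finite I" and \<nu>: "rank_one_variance_bound I \<nu> s" and k: "1 \<le> k"
  shows "integrable (Pi\<^sub>M {1..k} (\<lambda>_. \<nu>)) (\<lambda>\<omega>. (sample_energy I k \<omega> x - nsq I x)\<^sup>2)"
    and "(\<integral>\<omega>. (sample_energy I k \<omega> x - nsq I x)\<^sup>2 \<partial>Pi\<^sub>M {1..k} (\<lambda>_. \<nu>)) \<le> s * (nsq I x)\<^sup>2 / real k"
proof -
  have iso: "isotropic I \<nu>" and int4: "integrable \<nu> (\<lambda>\<omega>. ((norm (ip I \<omega> x))\<^sup>2)\<^sup>2)"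
    and var: "(\<integral>\<omega>. ((norm (ip I \<omega> x))\<^sup>2 - nsq I x)\<^sup>2 \<partial>\<nu>) \<le> s * (nsq I x)\<^sup>2"
    using \<nu> by (auto simp: rank_one_variance_bound_def)
  have P: "prob_space \<nu>" using iso by (simp add: isotropic_def random_vector_def)
  note m2 = iid_second_moment[OF P isotropic_second_moment(1)[OF I iso, of x] int4
      isotropic_second_moment(2)[OF I iso, of x] k]
  show "integrable (Pi\<^sub>M {1..k} (\<lambda>_. \<nu>)) (\<lambda>\<omega>. (sample_energy I k \<omega> x - nsq I x)\<^sup>2)"
    unfolding sample_energy_def by (rule m2(1))
  show "(\<integral>\<omega>. (sample_energy I k \<omega> x - nsq I x)\<^sup>2 \<partial>Pi\<^sub>M {1..k} (\<lambda>_. \<nu>)) \<le> s * (nsq I x)\<^sup>2 / real k"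
    unfolding sample_energy_def m2(2) using var by (rule divide_right_mono) simp
qed

lemma sample_energy_lower_tail:
  assumes I: "finite I" and \<nu>: "rank_one_variance_bound I \<nu> s" and k: "1 \<le> k"
    and x: "nsq I x \<le> R" "0 < R" and \<tau>: "0 \<le> \<tau>"
  shows "measure (Pi\<^sub>M {1..k} (\<lambda>_. \<nu>))
      {\<omega> \<in> space (Pi\<^sub>M {1..k} (\<lambda>_. \<nu>)). sample_energy I k \<omega> x \<le> nsq I x - \<tau>}
    \<le> exp (- (real k * \<tau>\<^sup>2 / (2 * ((1 + s) * R\<^sup>2))))"
proof -
  have iso: "isotropic I \<nu>" and int4: "integrable \<nu> (\<lambda>\<omega>. ((norm (ip I \<omega> x))\<^sup>2)\<^sup>2)" and s: "0 \<le> s"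
    using \<nu> by (auto simp: rank_one_variance_bound_def)
  have rv: "random_vector I \<nu>" using iso by (simp add: isotropic_def)
  then have P: "prob_space \<nu>" by (simp add: random_vector_def)
  note m2 = isotropic_second_moment[OF I iso, of x]
  have "(nsq I x)\<^sup>2 \<le> R\<^sup>2" using x by (intro power_mono) auto
  then have "(1 + s) * (nsq I x)\<^sup>2 \<le> (1 + s) * R\<^sup>2" using s by (intro mult_left_mono) auto
  then have h: "(\<integral>\<omega>. ((norm (ip I \<omega> x))\<^sup>2)\<^sup>2 \<partial>\<nu>) \<le> (1 + s) * R\<^sup>2"
    using rank_one_fourth_moment[OF I \<nu>, of x] by linarith
  have "(\<lambda>\<omega>. (norm (ip I \<omega> x))\<^sup>2) \<in> borel_measurable \<nu>"
    using measurable_ip[OF rv] by measurable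
  from iid_lower_tail[OF P this _ m2(1) int4 h _ \<tau> k] show ?thesis
    unfolding m2(2) sample_energy_def using s x by simp
qed

section \<open>Uniform lower bounds on the sample energy\<close>

text \<open>
  The two numerical bounds that compare the number of lattice points with the tail probabilities.
\<close>

lemma forty_eight_le_exp_4: "48 \<le> exp (4::real)"
proof -
  have "1 + 1/2 + (1/2)\<^sup>2 / 2 \<le> exp (1/2::real)" by (rule exp_lower_Taylor_quadratic) simp
  then have "(13/8::real) ^ 8 \<le> exp (1/2) ^ 8"
    by (intro power_mono) (simp_all add: power2_eq_square)
  also have "\<dots> = exp 4" by (simp flip: exp_of_nat_mult)
  finally show ?thesis by (simp add: eval_nat_numeral)
qed

lemma exp_minus_8_le: "exp (- 8) \<le> (1 / 256 :: real)"
proof -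
  have "(2::real) ^ 8 \<le> exp 1 ^ 8" using exp_ge_add_one_self[of "1::real"] by (intro power_mono) auto
  also have "\<dots> = exp 8" by (simp flip: exp_of_nat_mult)
  finally show ?thesis by (simp add: exp_minus field_simps)
qed

text \<open>
  Here \<open>s\<close> may be arbitrarily small, and Chebyshev's inequality is the bound that is proportional
  to \<open>s\<close>.
\<close>

lemma uniform_lower_bound_at_most_one_direction:
  fixes e :: "nat \<Rightarrow> 'i \<Rightarrow> 'f::rc_field"
  assumes I: "finite I" and \<nu>: "rank_one_variance_bound I \<nu> s" and k: "1 \<le> k"
    and e: "orthonormal I m e" and m: "m \<le> 1" and r: "1 \<le> r" and \<alpha>: "\<alpha> < 1"
    and size: "100000 / (1 - \<alpha>)\<^sup>2 * s * real r \<le> real k"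
  shows "\<exists>G\<in>sets (Pi\<^sub>M {1..k} (\<lambda>_. \<nu>)). 0.99 \<le> measure (Pi\<^sub>M {1..k} (\<lambda>_. \<nu>)) G \<and>
    (\<forall>\<omega>\<in>G. \<forall>y. \<alpha> * (\<Sum>l<m. (norm (y l))\<^sup>2) \<le> sample_energy I k \<omega> (\<lambda>i. \<Sum>l<m. y l * e l i))"
proof -
  let ?M = "Pi\<^sub>M {1..k} (\<lambda>_. \<nu>)"
  have s: "0 \<le> s" and rv: "random_vector I \<nu>"
    using \<nu> by (auto simp: rank_one_variance_bound_def isotropic_def)
  then interpret \<nu>: prob_space \<nu> by (simp add: random_vector_def)
  interpret P: prob_space "Pi\<^sub>M {1..k} (\<lambda>_. \<nu>)" by (rule prob_space_PiM) unfold_locales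
  show ?thesis
  proof (cases "m = 0")
    case True
    then show ?thesis using P.prob_space by (intro bexI[of _ "space ?M"]) auto
  next
    case False
    with m have m1: "m = 1" by simp
    have e0: "nsq I (e 0) = 1" using orthonormal_nsq[OF e] m1 by simp
    define Bad where "Bad = {\<omega> \<in> space ?M. (1 - \<alpha>)\<^sup>2 \<le> (sample_energy I k \<omega> (e 0) - nsq I (e 0))\<^sup>2}"
    have Bad: "Bad \<in> sets ?M"
      unfolding Bad_def using measurable_sample_energy[OF rv] by measurable
    note var = sample_energy_variance[OF I \<nu> k, of "e 0"]
    have "measure ?M Bad \<le> (\<integral>\<omega>. (sample_energy I k \<omega> (e 0) - nsq I (e 0))\<^sup>2 \<partial>?M) / (1 - \<alpha>)\<^sup>2"
      unfolding Bad_def using var(1) by (rule integral_Markov_inequality_measure[OF _ sets.top]) (use \<alpha> in auto)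
    also have "\<dots> \<le> s * (nsq I (e 0))\<^sup>2 / real k / (1 - \<alpha>)\<^sup>2"
      using var(2) by (rule divide_right_mono) simp
    also have "\<dots> \<le> 1 / 100"
    proof -
      have "s * 1 \<le> s * real r" using s r by (intro mult_left_mono) auto
      moreover have "100000 * (s * real r) \<le> real k * (1 - \<alpha>)\<^sup>2"
        using size \<alpha> by (simp add: field_simps)
      ultimately have "100 * s \<le> real k * (1 - \<alpha>)\<^sup>2" using s by linarith
      then show ?thesis using k \<alpha> by (simp add: e0 field_simps)
    qed
    finally have "measure ?M Bad \<le> 1 / 100" .
    then have "0.99 \<le> measure ?M (space ?M - Bad)" using P.prob_compl[OF Bad] by simp
    moreover have "\<alpha> * (\<Sum>l<m. (norm (y l))\<^sup>2) \<le> sample_energy I k \<omega> (\<lambda>i. \<Sum>l<m. y l * e l i)"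
      if "\<omega> \<in> space ?M - Bad" for \<omega> y
    proof -
      have "(sample_energy I k \<omega> (e 0) - 1)\<^sup>2 < (1 - \<alpha>)\<^sup>2" using that by (auto simp: Bad_def e0)
      then have "\<bar>sample_energy I k \<omega> (e 0) - 1\<bar> < \<bar>1 - \<alpha>\<bar>"
        by (metis abs_le_square_iff not_le)
      then have "\<alpha> \<le> sample_energy I k \<omega> (e 0)" using \<alpha> by linarith
      then have "(norm (y 0))\<^sup>2 * \<alpha> \<le> (norm (y 0))\<^sup>2 * sample_energy I k \<omega> (e 0)"
        by (intro mult_left_mono) auto
      then show ?thesis by (simp add: m1 sample_energy_scale mult.commute)
    qed
    ultimately show ?thesis using Bad by (intro bexI[of _ "space ?M - Bad"]) auto
  qed
qed

text \<open>
  The bad event is that the diagonal is large on average, with probability at most \<open>1/200\<close>, or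
  that the energy is too small at one of the at most \<open>48\<^bsup>2 r\<^esup> \<le> exp (8 r)\<close> grid
  points. The factor 100000 makes each of the latter events have probability at most
  \<open>exp (- 16 r)\<close>.
\<close>

lemma uniform_lower_bound_many_directions:
  fixes e :: "nat \<Rightarrow> 'i \<Rightarrow> 'f::rc_field"
  assumes I: "finite I" and \<nu>: "rank_one_variance_bound I \<nu> s" and k: "1 \<le> k"
    and e: "orthonormal I m e" and m: "2 \<le> m" "m \<le> r" and \<alpha>: "\<alpha> < 1"
    and size: "100000 / (1 - \<alpha>)\<^sup>2 * s * real r \<le> real k"
  shows "\<exists>G\<in>sets (Pi\<^sub>M {1..k} (\<lambda>_. \<nu>)). 0.99 \<le> measure (Pi\<^sub>M {1..k} (\<lambda>_. \<nu>)) G \<and>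
    (\<forall>\<omega>\<in>G. \<forall>y. \<alpha> * (\<Sum>l<m. (norm (y l))\<^sup>2) \<le> sample_energy I k \<omega> (\<lambda>i. \<Sum>l<m. y l * e l i))"
proof -
  let ?M = "Pi\<^sub>M {1..k} (\<lambda>_. \<nu>)"
  let ?\<Lambda> = "{..<m} \<times> (UNIV :: bool set)"
  have rv: "random_vector I \<nu>"
    using \<nu> by (auto simp: rank_one_variance_bound_def isotropic_def)
  then interpret \<nu>: prob_space \<nu> by (simp add: random_vector_def)
  interpret P: prob_space "Pi\<^sub>M {1..k} (\<lambda>_. \<nu>)" by (rule prob_space_PiM) unfold_locales
  note [measurable] = measurable_sample_energy[OF rv]
  have s: "1 / 11 \<le> s" by (rule rank_one_variance_lower_bound[OF I \<nu> e m(1)])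
  obtain u :: 'f where u1: "norm u \<le> 1"
    and u: "\<And>z::'f. \<exists>s t. z = s *\<^sub>R 1 + t *\<^sub>R u \<and> (norm z)\<^sup>2 = s\<^sup>2 + t\<^sup>2"
    using real_coordinates by blast
  \<comment> \<open>Half of the loss \<open>1 - \<alpha>\<close> goes to the grid points and half to the diagonal.\<close>
  define \<tau> where "\<tau> = (1 - \<alpha>) / 2"
  have \<tau>: "0 < \<tau>" using \<alpha> by (simp add: \<tau>_def)
  have k\<tau>: "25000 * s * real r \<le> real k * \<tau>\<^sup>2"
  proof -
    have "100000 * (s * real r) \<le> real k * (1 - \<alpha>)\<^sup>2"
      using size \<alpha> by (simp add: field_simps)
    then show ?thesis by (simp add: \<tau>_def power_divide mult.assoc)
  qed
  define D where "D = (\<lambda>\<omega>. \<Sum>l\<in>?\<Lambda>.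
    (sample_energy I k \<omega> (real_direction u e l) - nsq I (real_direction u e l))\<^sup>2)"
  define Bad_diag where "Bad_diag = {\<omega> \<in> space ?M. 2 * real m * \<tau>\<^sup>2 \<le> D \<omega>}"
  define Bad where "Bad = (\<lambda>z. {\<omega> \<in> space ?M.
    sample_energy I k \<omega> (grid_point m u e z) \<le> nsq I (grid_point m u e z) - \<tau>})"
  have sets: "Bad_diag \<in> sets ?M" "\<And>z. Bad z \<in> sets ?M"
    unfolding Bad_diag_def D_def Bad_def by measurable
  have "measure ?M Bad_diag \<le> 1 / 200"
  proof -
    have intD: "integrable ?M D"
      unfolding D_def by (intro Bochner_Integration.integrable_sum sample_energy_variance[OF I \<nu> k])
    have one: "nsq I (real_direction u e l) \<le> 1" if "l \<in> ?\<Lambda>" for l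
    proof -
      obtain j c where l: "l = (j, c)" "j < m" using \<open>l \<in> ?\<Lambda>\<close> by auto
      have "(norm u)\<^sup>2 \<le> 1" using power_mono[OF u1, of 2] by simp
      then show ?thesis
        using orthonormal_nsq[OF e l(2)] unfolding l(1) real_direction_def
        by (cases c) (simp_all add: nsq_scale)
    qed
    have "(\<integral>\<omega>. D \<omega> \<partial>?M) = (\<Sum>l\<in>?\<Lambda>. \<integral>\<omega>.
        (sample_energy I k \<omega> (real_direction u e l) - nsq I (real_direction u e l))\<^sup>2 \<partial>?M)"
      unfolding D_def by (intro Bochner_Integration.integral_sum sample_energy_variance[OF I \<nu> k])
    also have "\<dots> \<le> (\<Sum>l\<in>?\<Lambda>. s / real k)"
    proof (rule sum_mono)
      fix l assume l: "l \<in> ?\<Lambda>"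
      have "(nsq I (real_direction u e l))\<^sup>2 \<le> 1" using one[OF l] by (intro power_le_one) auto
      then have "s * (nsq I (real_direction u e l))\<^sup>2 / real k \<le> s * 1 / real k"
        using s by (intro divide_right_mono mult_left_mono) auto
      then show "(\<integral>\<omega>. (sample_energy I k \<omega> (real_direction u e l) - nsq I (real_direction u e l))\<^sup>2 \<partial>?M) \<le> s / real k"
        using sample_energy_variance(2)[OF I \<nu> k, of "real_direction u e l"] by simp
    qed
    also have "\<dots> = 2 * real m * (s / real k)" by (simp add: card_cartesian_product)
    finally have ED: "(\<integral>\<omega>. D \<omega> \<partial>?M) \<le> 2 * real m * (s / real k)" .
    have "measure ?M Bad_diag \<le> (\<integral>\<omega>. D \<omega> \<partial>?M) / (2 * real m * \<tau>\<^sup>2)"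
      unfolding Bad_diag_def
      by (rule integral_Markov_inequality_measure[OF intD sets.top]) (use m \<tau> in \<open>auto simp: D_def sum_nonneg\<close>)
    also have "\<dots> \<le> 2 * real m * (s / real k) / (2 * real m * \<tau>\<^sup>2)"
      using ED by (rule divide_right_mono) simp
    also have "\<dots> = s / (real k * \<tau>\<^sup>2)" using m by simp
    also have "\<dots> \<le> 1 / 200"
    proof -
      have "s * 1 \<le> s * real r" using s m by (intro mult_left_mono) auto
      then have "200 * s \<le> real k * \<tau>\<^sup>2" using k\<tau> s by linarith
      then show ?thesis using k \<tau> by (simp add: field_simps)
    qed
    finally show ?thesis .
  qed
  moreover have "measure ?M (\<Union>z\<in>lattice_ball ?\<Lambda>. Bad z) \<le> 1 / 256"
  proof -
    have Bad: "measure ?M (Bad z) \<le> exp (- (16 * real r))" if "z \<in> lattice_ball ?\<Lambda>" for z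
    proof -
      have "measure ?M (Bad z) \<le> exp (- (real k * \<tau>\<^sup>2 / (2 * ((1 + s) * 8\<^sup>2))))"
        unfolding Bad_def using nsq_grid_point_le[OF I e u1 that] m \<tau>
        by (intro sample_energy_lower_tail[OF I \<nu> k]) auto
      also have "\<dots> \<le> exp (- (16 * real r))"
      proof -
        \<comment> \<open>The lower bound \<open>1 / 11\<close> on \<open>s\<close> turns \<open>1 + s\<close> into \<open>12 s\<close>.\<close>
        have "16 * real r * (2 * ((1 + s) * 8\<^sup>2)) \<le> 16 * real r * (2 * ((12 * s) * 8\<^sup>2))"
          using s by (intro mult_left_mono mult_right_mono) auto
        also have "\<dots> \<le> 25000 * s * real r" using s by (simp add: mult_right_mono)
        finally have "16 * real r * (2 * ((1 + s) * 8\<^sup>2)) \<le> real k * \<tau>\<^sup>2" using k\<tau> by linarith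
        then have "16 * real r \<le> real k * \<tau>\<^sup>2 / (2 * ((1 + s) * 8\<^sup>2))"
          using s by (subst pos_le_divide_eq) auto
        then show ?thesis by simp
      qed
      finally show ?thesis .
    qed
    have "measure ?M (\<Union>z\<in>lattice_ball ?\<Lambda>. Bad z) \<le> (\<Sum>z\<in>lattice_ball ?\<Lambda>. measure ?M (Bad z))"
      using sets by (intro P.finite_measure_subadditive_finite lattice_ball_card) auto
    also have "\<dots> \<le> (\<Sum>z\<in>lattice_ball ?\<Lambda>. exp (- (16 * real r)))"
      using Bad by (rule sum_mono)
    also have "\<dots> = real (card (lattice_ball ?\<Lambda>)) * exp (- (16 * real r))" by simp
    also have "\<dots> \<le> 48 ^ (2 * m) * exp (- (16 * real r))"
      using lattice_ball_card(2)[of ?\<Lambda>] by (intro mult_right_mono) (auto simp: card_cartesian_product mult.commute)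
    also have "\<dots> \<le> exp 4 ^ (2 * r) * exp (- (16 * real r))"
    proof (intro mult_right_mono)
      have "(48::real) ^ (2 * m) \<le> 48 ^ (2 * r)" using m by (intro power_increasing) auto
      also have "\<dots> \<le> exp 4 ^ (2 * r)" using forty_eight_le_exp_4 by (intro power_mono) auto
      finally show "(48::real) ^ (2 * m) \<le> exp 4 ^ (2 * r)" .
    qed simp
    also have "\<dots> = exp (- (8 * real r))"
      unfolding exp_of_nat_mult[symmetric] exp_add[symmetric] by simp
    also have "\<dots> \<le> exp (- 8)" using m by simp
    also have "\<dots> \<le> 1 / 256" by (rule exp_minus_8_le)
    finally show ?thesis .
  qed
  moreover define B where "B = Bad_diag \<union> (\<Union>z\<in>lattice_ball ?\<Lambda>. Bad z)"
  have UN: "(\<Union>z\<in>lattice_ball ?\<Lambda>. Bad z) \<in> sets ?M"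
    using sets lattice_ball_card(1)[of ?\<Lambda>] by (intro sets.finite_UN) auto
  then have B: "B \<in> sets ?M" using sets by (auto simp: B_def)
  moreover have "measure ?M B \<le> measure ?M Bad_diag + measure ?M (\<Union>z\<in>lattice_ball ?\<Lambda>. Bad z)"
    unfolding B_def using sets UN by (intro measure_Un_le) auto
  ultimately have "0.99 \<le> measure ?M (space ?M - B)" using P.prob_compl[OF B] by simp
  moreover have "\<alpha> * (\<Sum>l<m. (norm (y l))\<^sup>2) \<le> sample_energy I k \<omega> (\<lambda>i. \<Sum>l<m. y l * e l i)"
    if \<omega>: "\<omega> \<in> space ?M - B" for \<omega> y
  proof -
    have unit: "\<alpha> \<le> sample_energy I k \<omega> (\<lambda>i. \<Sum>l<m. y l * e l i)"
      if "(\<Sum>l<m. (norm (y l))\<^sup>2) = 1" for y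
    proof -
      have "1 - 2 * \<tau> \<le> sample_energy I k \<omega> (\<lambda>i. \<Sum>l<m. y l * e l i)"
      proof (rule energy_lower_bound_from_grid[OF I e _ \<tau> u1 u _ _ that])
        show "nsq I (grid_point m u e z) - \<tau> < sample_energy I k \<omega> (grid_point m u e z)"
          if "z \<in> lattice_ball ?\<Lambda>" for z
          using \<omega> that by (auto simp: B_def Bad_def)
        show "(\<Sum>l\<in>?\<Lambda>. (sample_energy I k \<omega> (real_direction u e l) - nsq I (real_direction u e l))\<^sup>2)
            \<le> 2 * real m * \<tau>\<^sup>2"
          using \<omega> by (auto simp: B_def Bad_diag_def D_def)
      qed (use m in auto)
      moreover have "1 - 2 * \<tau> = \<alpha>" by (simp add: \<tau>_def field_simps)
      ultimately show ?thesis by simp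
    qed
    define Q where "Q = (\<Sum>l<m. (norm (y l))\<^sup>2)"
    show ?thesis
    proof (cases "Q = 0")
      case True
      then show ?thesis by (simp add: Q_def[symmetric])
    next
      case False
      moreover have "0 \<le> Q" unfolding Q_def by (intro sum_nonneg) auto
      ultimately have Q: "0 < Q" by simp
      define c :: 'f where "c = of_real (1 / sqrt Q)"
      have c: "(norm c)\<^sup>2 = 1 / Q" using Q by (simp add: c_def norm_divide power_divide)
      have "(\<Sum>l<m. (norm (c * y l))\<^sup>2) = (norm c)\<^sup>2 * Q"
        unfolding Q_def sum_distrib_left by (simp add: norm_mult power_mult_distrib)
      also have "\<dots> = 1" unfolding c using Q by simp
      finally have "(\<Sum>l<m. (norm (c * y l))\<^sup>2) = 1" .
      then have "\<alpha> \<le> sample_energy I k \<omega> (\<lambda>i. \<Sum>l<m. c * y l * e l i)" by (rule unit)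
      also have "\<dots> = sample_energy I k \<omega> (\<lambda>i. c * (\<Sum>l<m. y l * e l i))"
        by (simp add: sum_distrib_left mult.assoc)
      also have "\<dots> = sample_energy I k \<omega> (\<lambda>i. \<Sum>l<m. y l * e l i) / Q"
        by (simp add: sample_energy_scale c)
      finally show ?thesis using Q by (simp add: Q_def[symmetric] pos_le_divide_eq)
    qed
  qed
  ultimately show ?thesis using B by (intro bexI[of _ "space ?M - B"]) auto
qed

section \<open>Oblivious subspace injection\<close>

text \<open>
  The event of an injection quantifies over the uncountable set \<open>Z\<close>; by continuity a countable
  dense subset suffices.
\<close>

lemma sets_forall_nonneg:
  fixes F :: "'a \<Rightarrow> 'z::{metric_space, second_countable_topology} \<Rightarrow> real"
  assumes cont: "\<And>\<omega>. continuous_on UNIV (F \<omega>)"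
    and meas: "\<And>z. (\<lambda>\<omega>. F \<omega> z) \<in> borel_measurable M"
  shows "{\<omega> \<in> space M. \<forall>z\<in>Z. 0 \<le> F \<omega> z} \<in> sets M"
proof -
  obtain T where T: "countable T" "T \<subseteq> Z" "Z \<subseteq> closure T" using separable by blast
  have "(\<forall>z\<in>Z. 0 \<le> F \<omega> z) \<longleftrightarrow> (\<forall>z\<in>T. 0 \<le> F \<omega> z)" for \<omega>
  proof
    assume T0: "\<forall>z\<in>T. 0 \<le> F \<omega> z"
    have "closed {z. 0 \<le> F \<omega> z}"
      by (intro closed_Collect_le continuous_on_const cont)
    then have "closure T \<subseteq> {z. 0 \<le> F \<omega> z}" using T0 by (intro closure_minimal) auto
    with T(3) show "\<forall>z\<in>Z. 0 \<le> F \<omega> z" by blast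
  qed (use T in blast)
  then have "{\<omega> \<in> space M. \<forall>z\<in>Z. 0 \<le> F \<omega> z} = {\<omega> \<in> space M. \<forall>z\<in>T. 0 \<le> F \<omega> z}" by simp
  also have "\<dots> \<in> sets M"
    using meas by (intro sets.sets_Collect_countable_All'[OF _ T(1)]) measurable
  finally show ?thesis .
qed

lemma measurable_test_matrix_map:
  fixes \<nu> :: "('i \<Rightarrow> 'f::rc_field) measure"
  assumes "random_vector I \<nu>"
  shows "(\<lambda>\<omega>. restrict (\<lambda>(i, j). (1 / sqrt (real k)) *\<^sub>R \<omega> j i) (I \<times> {1..k}))
    \<in> measurable (Pi\<^sub>M {1..k} (\<lambda>_. \<nu>)) (Pi\<^sub>M (I \<times> {1..k}) (\<lambda>_. borel))"
proof (rule measurable_restrict)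
  fix p assume "p \<in> I \<times> {1..k}"
  then obtain i j where p: "p = (i, j)" "i \<in> I" "j \<in> {1..k}" by auto
  have comp: "(\<lambda>\<omega>. \<omega> j i) \<in> borel_measurable (Pi\<^sub>M {1..k} (\<lambda>_. \<nu>))"
    by (rule measurable_compose[OF measurable_component_singleton[OF p(3)]
        measurable_random_vector_component[OF assms p(2)]])
  show "(\<lambda>\<omega>. (\<lambda>(i, j). (1 / sqrt (real k)) *\<^sub>R \<omega> j i) p) \<in> borel_measurable (Pi\<^sub>M {1..k} (\<lambda>_. \<nu>))"
    unfolding p(1) prod.case by (rule borel_measurable_scaleR[OF borel_measurable_const comp])
qed

lemma sq_norm_adjoint_mult_test_matrix:
  fixes \<omega> :: "nat \<Rightarrow> 'i \<Rightarrow> 'f::rc_field"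
  shows "sq_norm_adjoint_mult I k (restrict (\<lambda>(i, j). (1 / sqrt (real k)) *\<^sub>R \<omega> j i) (I \<times> {1..k})) x =
    sample_energy I k \<omega> x"
proof -
  have "(norm (\<Sum>i\<in>I. conjugate (restrict (\<lambda>(i, j). (1 / sqrt (real k)) *\<^sub>R \<omega> j i) (I \<times> {1..k}) (i, j)) * x i))\<^sup>2
      = (norm (ip I (\<omega> j) x))\<^sup>2 / real k" if "j \<in> {1..k}" for j
  proof -
    have "(\<Sum>i\<in>I. conjugate (restrict (\<lambda>(i, j). (1 / sqrt (real k)) *\<^sub>R \<omega> j i) (I \<times> {1..k}) (i, j)) * x i)
        = of_real (1 / sqrt (real k)) * ip I (\<omega> j) x"
      unfolding ip_def sum_distrib_left using that
      by (intro sum.cong refl) (simp add: scaleR_conv_of_real conjugate_dist_mul flip: of_real_divide)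
    then show ?thesis by (simp add: norm_divide norm_mult power_divide power_mult_distrib)
  qed
  then show ?thesis
    unfolding sq_norm_adjoint_mult_def sample_energy_def sum_divide_distrib by (intro sum.cong refl) auto
qed

text \<open>
  Vectors of \<open>L\<close> are handled through their coefficients \<open>z\<close>, which are indexed by
  \<open>nat\<close>: the index type \<open>'i\<close> of the vectors may be uncountable, and then the space
  of all vectors is not second countable.
\<close>

theorem osi_of_rank_one_variance_bound:
  fixes \<nu> :: "('i \<Rightarrow> 'f::rc_field) measure"
  assumes I: "finite I" and \<nu>: "rank_one_variance_bound I \<nu> s" and k: "1 \<le> k" and r: "1 \<le> r"
    and \<alpha>: "\<alpha> < 1" and size: "100000 / (1 - \<alpha>)\<^sup>2 * s * real r \<le> real k"
  shows "oblivious_subspace_injection I k (test_matrix I k \<nu>) r \<alpha>"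
  unfolding oblivious_subspace_injection_def
proof (intro conjI allI impI)
  have iso: "isotropic I \<nu>" using \<nu> by (simp add: rank_one_variance_bound_def)
  then show "\<exists>\<nu>'. isotropic I \<nu>' \<and> test_matrix I k \<nu> = test_matrix I k \<nu>'" by blast
  have rv: "random_vector I \<nu>" using iso by (simp add: isotropic_def)
  then interpret \<nu>: prob_space \<nu> by (simp add: random_vector_def)
  interpret P: prob_space "Pi\<^sub>M {1..k} (\<lambda>_. \<nu>)" by (rule prob_space_PiM) unfold_locales
  let ?M = "Pi\<^sub>M {1..k} (\<lambda>_. \<nu>)" and ?N = "Pi\<^sub>M (I \<times> {1..k}) (\<lambda>_. borel) :: ('i \<times> nat \<Rightarrow> 'f) measure"
  let ?T = "\<lambda>\<omega>. restrict (\<lambda>(i, j). (1 / sqrt (real k)) *\<^sub>R \<omega> j i) (I \<times> {1..k})"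
  fix L :: "('i \<Rightarrow> 'f) set" assume "subspace_of_dim I r L"
  then obtain m e where m: "m \<le> r" and e: "orthonormal I m e"
    and L: "\<And>x. x \<in> L \<Longrightarrow> \<exists>z. \<forall>i\<in>I. x i = (\<Sum>l<m. z l * e l i)"
    using subspace_orthonormal_basis[OF I] by blast
  obtain G where G: "G \<in> sets ?M" "0.99 \<le> measure ?M G" and
    low: "\<And>\<omega> y. \<omega> \<in> G \<Longrightarrow> \<alpha> * (\<Sum>l<m. (norm (y l))\<^sup>2) \<le> sample_energy I k \<omega> (\<lambda>i. \<Sum>l<m. y l * e l i)"
    using uniform_lower_bound_at_most_one_direction[OF I \<nu> k e _ r \<alpha> size]
      uniform_lower_bound_many_directions[OF I \<nu> k e _ m \<alpha> size] by (cases "m \<le> 1") auto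
  define Z where "Z = {z. \<exists>x\<in>L. \<forall>i\<in>I. x i = (\<Sum>l<m. z l * e l i)}"
  define F where "F = (\<lambda>\<Omega> z. sq_norm_adjoint_mult I k \<Omega> (\<lambda>i. \<Sum>l<m. z l * e l i)
    - \<alpha> * (\<Sum>i\<in>I. (norm (\<Sum>l<m. z l * e l i))\<^sup>2))"
  define A where "A = {\<Omega> \<in> space ?N. \<forall>x\<in>L. \<alpha> * (\<Sum>i\<in>I. (norm (x i))\<^sup>2) \<le> sq_norm_adjoint_mult I k \<Omega> x}"
  have "(\<forall>x\<in>L. \<alpha> * (\<Sum>i\<in>I. (norm (x i))\<^sup>2) \<le> sq_norm_adjoint_mult I k \<Omega> x) \<longleftrightarrow> (\<forall>z\<in>Z. 0 \<le> F \<Omega> z)" for \<Omega>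
  proof -
    have "\<alpha> * (\<Sum>i\<in>I. (norm (x i))\<^sup>2) \<le> sq_norm_adjoint_mult I k \<Omega> x \<longleftrightarrow> 0 \<le> F \<Omega> z"
      if "\<forall>i\<in>I. x i = (\<Sum>l<m. z l * e l i)" for x z
      using that by (simp add: F_def sq_norm_adjoint_mult_def)
    with L show ?thesis unfolding Z_def by blast
  qed
  then have "A = {\<Omega> \<in> space ?N. \<forall>z\<in>Z. 0 \<le> F \<Omega> z}" by (simp add: A_def)
  also have "\<dots> \<in> sets ?N"
  proof (rule sets_forall_nonneg)
    have [continuous_intros]: "continuous_on UNIV (\<lambda>z::nat \<Rightarrow> 'f. z l)" for l
      by (rule continuous_on_product_coordinates)
    show "continuous_on UNIV (F \<Omega>)" for \<Omega>
      unfolding F_def sq_norm_adjoint_mult_def by (intro continuous_intros)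
    have comp: "(\<lambda>\<Omega>. conjugate (\<Omega> (i, j))) \<in> borel_measurable ?N" if "i \<in> I" "j \<in> {1..k}" for i j
    proof -
      have "(i, j) \<in> I \<times> {1..k}" using that by simp
      from measurable_compose[OF measurable_component_singleton[OF this] borel_measurable_conjugate]
      show ?thesis .
    qed
    have row: "(\<lambda>\<Omega>. (norm (\<Sum>i\<in>I. conjugate (\<Omega> (i, j)) * x i))\<^sup>2) \<in> borel_measurable ?N"
      if "j \<in> {1..k}" for j x
    proof -
      have "(\<lambda>\<Omega>. \<Sum>i\<in>I. conjugate (\<Omega> (i, j)) * x i) \<in> borel_measurable ?N"
        using that by (intro borel_measurable_sum borel_measurable_times borel_measurable_const comp)
      then show ?thesis by measurable
    qed
    show "(\<lambda>\<Omega>. F \<Omega> z) \<in> borel_measurable ?N" for z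
      unfolding F_def sq_norm_adjoint_mult_def
      by (intro borel_measurable_diff borel_measurable_sum borel_measurable_const row)
  qed
  finally have A: "A \<in> sets ?N" .
  have T: "?T \<in> measurable ?M ?N" by (rule measurable_test_matrix_map[OF rv])
  have "G \<subseteq> ?T -` A \<inter> space ?M"
  proof
    fix \<omega> assume \<omega>: "\<omega> \<in> G"
    then have sp: "\<omega> \<in> space ?M" using sets.sets_into_space[OF G(1)] by blast
    have "\<alpha> * (\<Sum>i\<in>I. (norm (x i))\<^sup>2) \<le> sample_energy I k \<omega> x" if x: "x \<in> L" for x
    proof -
      obtain z where z: "\<forall>i\<in>I. x i = (\<Sum>l<m. z l * e l i)" using L[OF x] by blast
      have "(\<Sum>i\<in>I. (norm (x i))\<^sup>2) = nsq I (\<lambda>i. \<Sum>l<m. z l * e l i)"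
        using z by (simp add: nsq_def)
      also have "\<dots> = (\<Sum>l<m. (norm (z l))\<^sup>2)" by (rule nsq_orthonormal_combination[OF I e])
      finally show ?thesis
        using low[OF \<omega>, of z] sample_energy_cong[of I x "\<lambda>i. \<Sum>l<m. z l * e l i"] z by simp
    qed
    then show "\<omega> \<in> ?T -` A \<inter> space ?M"
      using sp measurable_space[OF T sp] by (simp add: A_def sq_norm_adjoint_mult_test_matrix del: One_nat_def)
  qed
  then have "measure ?M G \<le> measure ?M (?T -` A \<inter> space ?M)"
    by (rule P.finite_measure_mono) (rule measurable_sets[OF T A])
  also have "\<dots> = measure (test_matrix I k \<nu>) A"
    unfolding test_matrix_def by (rule measure_distr[OF T A, symmetric])
  finally have "0.99 \<le> measure (test_matrix I k \<nu>) A" using G(2) by linarith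
  then show "0.99 \<le> measure (test_matrix I k \<nu>) {\<Omega> \<in> space (test_matrix I k \<nu>).
      \<forall>x\<in>L. \<alpha> * (\<Sum>i\<in>I. (norm (x i))\<^sup>2) \<le> sq_norm_adjoint_mult I k \<Omega> x}"
    by (simp add: A_def test_matrix_def)
qed

lemma rank_one_variance_bound_of_quadratic_form_condition:
  fixes \<nu> :: "('i \<Rightarrow> 'f::rc_field) measure"
  assumes I: "finite I" and \<nu>: "quadratic_form_condition I \<nu> a b"
  shows "rank_one_variance_bound I \<nu> (a + b)"
  unfolding rank_one_variance_bound_def
proof (intro conjI allI)
  show "0 \<le> a + b" and iso: "isotropic I \<nu>" using \<nu> by (auto simp: quadratic_form_condition_def)
  fix x :: "'i \<Rightarrow> 'f"
  define A where "A = (\<lambda>i j. x i * conjugate (x j))"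
  have quad: "quad_form I A \<omega> = of_real ((norm (ip I \<omega> x))\<^sup>2)" for \<omega>
  proof -
    have "quad_form I A \<omega> = ip I \<omega> x * ip I x \<omega>"
      unfolding quad_form_def A_def ip_def sum_product by (simp add: mult_ac)
    then show ?thesis by (simp add: of_real_norm_square conjugate_ip[OF I] del: of_real_power)
  qed
  have "0 \<le> quad_form I A \<omega>" for \<omega>
    unfolding quad of_real_norm_square by (rule conjugate_square_positive)
  then have "psd I A" by (simp add: psd_def A_def conjugate_dist_mul mult.commute)
  then have int: "integrable \<nu> (\<lambda>\<omega>. (norm (quad_form I A \<omega>))\<^sup>2)"
    and var: "var \<nu> (quad_form I A) \<le> a * frobenius_sq I A + b * (norm (mtrace I A))\<^sup>2"
    using \<nu> by (auto simp: quadratic_form_condition_def)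
  show "integrable \<nu> (\<lambda>\<omega>. ((norm (ip I \<omega> x))\<^sup>2)\<^sup>2)" using int by (simp add: quad norm_power)
  have mean: "(\<integral>\<omega>. quad_form I A \<omega> \<partial>\<nu>) = of_real (nsq I x)"
    unfolding quad isotropic_second_moment(2)[OF I iso, of x, symmetric]
    by (rule integral_bounded_linear[OF bounded_linear_of_real isotropic_second_moment(1)[OF I iso]])
  have "var \<nu> (quad_form I A) = (\<integral>\<omega>. ((norm (ip I \<omega> x))\<^sup>2 - nsq I x)\<^sup>2 \<partial>\<nu>)"
    unfolding var_def mean unfolding quad of_real_diff[symmetric] norm_of_real by simp
  moreover have "frobenius_sq I A = (nsq I x)\<^sup>2"
    by (simp add: frobenius_sq_def A_def nsq_def norm_mult power_mult_distrib sum_product power2_eq_square[of "sum _ _"])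
  moreover have "mtrace I A = of_real (nsq I x)"
    by (simp only: mtrace_def A_def nsq_def of_real_sum of_real_norm_square)
  ultimately show "(\<integral>\<omega>. ((norm (ip I \<omega> x))\<^sup>2 - nsq I x)\<^sup>2 \<partial>\<nu>) \<le> (a + b) * (nsq I x)\<^sup>2"
    using var by (simp add: distrib_right)
qed

lemma osi_of_matrix_quadratic_form_condition:
  fixes P :: "('i \<times> nat \<Rightarrow> 'f::rc_field) measure"
  assumes "finite I" "1 \<le> k" "matrix_quadratic_form_condition I k P a b" "1 \<le> r" "\<alpha> < 1"
    "100000 / (1 - \<alpha>)\<^sup>2 * (a + b) * real r \<le> real k"
  shows "oblivious_subspace_injection I k P r \<alpha>"
proof -
  obtain \<nu> where \<nu>: "quadratic_form_condition I \<nu> a b" and P: "P = test_matrix I k \<nu>"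
    using assms(3) unfolding matrix_quadratic_form_condition_def by blast
  show ?thesis
    unfolding P using rank_one_variance_bound_of_quadratic_form_condition[OF assms(1) \<nu>] assms(2,4-6)
    by (rule osi_of_rank_one_variance_bound[OF assms(1)])
qed

section \<open>Moments of linear forms in independent symmetric entries\<close>

text \<open>
  The properties of centred Gaussian laws of variance \<open>v\<close> that the moment bounds need. The
  moments are nonnegative integrals, so that no integrability has to be carried along.
\<close>

definition symmetric_law :: "'f::rc_field measure \<Rightarrow> real \<Rightarrow> bool" where
  "symmetric_law \<gamma> v \<longleftrightarrow> prob_space \<gamma> \<and> sets \<gamma> = sets borel \<and> 0 \<le> v \<and> distr \<gamma> borel uminus = \<gamma> \<and>
     (\<integral>\<^sup>+g. ennreal ((norm g)\<^sup>2) \<partial>\<gamma>) = ennreal v \<and>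
     (\<integral>\<^sup>+g. ennreal (((norm g)\<^sup>2)\<^sup>2) \<partial>\<gamma>) \<le> ennreal (3 * v\<^sup>2)"

text \<open>
  Averaging over the signs of \<open>g\<close> removes the terms of odd degree, so that mixed moments never
  have to be expanded.
\<close>

lemma symmetric_law_symmetrize:
  fixes F :: "'f::rc_field \<Rightarrow> real"
  assumes \<gamma>: "symmetric_law \<gamma> v" and [measurable]: "F \<in> borel_measurable borel" and F: "\<And>g. 0 \<le> F g"
  shows "(\<integral>\<^sup>+g. ennreal (F g) \<partial>\<gamma>) = (\<integral>\<^sup>+g. ennreal ((F g + F (- g)) / 2) \<partial>\<gamma>)"
proof -
  have [measurable_cong]: "sets \<gamma> = sets borel" and sym: "distr \<gamma> borel uminus = \<gamma>"
    using \<gamma> by (auto simp: symmetric_law_def)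
  have reflect: "(\<integral>\<^sup>+g. ennreal (F (- g)) \<partial>\<gamma>) = (\<integral>\<^sup>+g. ennreal (F g) \<partial>\<gamma>)"
  proof -
    have "(\<integral>\<^sup>+g. ennreal (F g) \<partial>distr \<gamma> borel uminus) = (\<integral>\<^sup>+g. ennreal (F (- g)) \<partial>\<gamma>)"
      by (rule nn_integral_distr) measurable
    then show ?thesis by (simp add: sym)
  qed
  have half: "ennreal (1/2) + ennreal (1/2) = 1"
    by (subst ennreal_plus[symmetric]) auto
  have "(\<integral>\<^sup>+g. ennreal ((F g + F (- g)) / 2) \<partial>\<gamma>) =
      (\<integral>\<^sup>+g. ennreal (1/2) * ennreal (F g) + ennreal (1/2) * ennreal (F (- g)) \<partial>\<gamma>)"
  proof (rule nn_integral_cong)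
    fix g
    have h: "0 \<le> (1/2::real)" by simp
    have "ennreal ((F g + F (- g)) / 2) = ennreal (1/2 * F g + 1/2 * F (- g))"
      by (simp add: field_simps)
    also have "\<dots> = ennreal (1/2 * F g) + ennreal (1/2 * F (- g))"
      using F by (intro ennreal_plus) auto
    finally show "ennreal ((F g + F (- g)) / 2) =
        ennreal (1/2) * ennreal (F g) + ennreal (1/2) * ennreal (F (- g))"
      by (simp only: ennreal_mult[OF h F])
  qed
  also have "\<dots> = ennreal (1/2) * (\<integral>\<^sup>+g. ennreal (F g) \<partial>\<gamma>) + ennreal (1/2) * (\<integral>\<^sup>+g. ennreal (F g) \<partial>\<gamma>)"
    by (subst nn_integral_add) (auto simp: nn_integral_cmult reflect)
  also have "\<dots> = (\<integral>\<^sup>+g. ennreal (F g) \<partial>\<gamma>)"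
    unfolding distrib_right[symmetric] half by simp
  finally show ?thesis by simp
qed

lemma (in prob_space) nn_integral_affine2:
  assumes [measurable]: "h1 \<in> borel_measurable M" "h2 \<in> borel_measurable M"
    and "\<And>x. 0 \<le> h1 x" "\<And>x. 0 \<le> h2 x" "0 \<le> a" "0 \<le> b" "0 \<le> c"
  shows "(\<integral>\<^sup>+x. ennreal (a + b * h1 x + c * h2 x) \<partial>M) =
    ennreal a + ennreal b * (\<integral>\<^sup>+x. ennreal (h1 x) \<partial>M) + ennreal c * (\<integral>\<^sup>+x. ennreal (h2 x) \<partial>M)"
proof -
  have "(\<integral>\<^sup>+x. ennreal (a + b * h1 x + c * h2 x) \<partial>M) =
      (\<integral>\<^sup>+x. (ennreal a + ennreal b * ennreal (h1 x)) + ennreal c * ennreal (h2 x) \<partial>M)"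
    using assms(3-) by (intro nn_integral_cong) (simp add: ennreal_mult' ennreal_plus)
  also have "\<dots> = (\<integral>\<^sup>+x. ennreal a + ennreal b * ennreal (h1 x) \<partial>M) + (\<integral>\<^sup>+x. ennreal c * ennreal (h2 x) \<partial>M)"
    by (rule nn_integral_add) auto
  also have "(\<integral>\<^sup>+x. ennreal a + ennreal b * ennreal (h1 x) \<partial>M) =
      (\<integral>\<^sup>+x. ennreal a \<partial>M) + (\<integral>\<^sup>+x. ennreal b * ennreal (h1 x) \<partial>M)"
    by (rule nn_integral_add) auto
  finally show ?thesis by (simp add: nn_integral_cmult emeasure_space_1)
qed

lemma (in prob_space) nn_integral_affine:
  assumes [measurable]: "h \<in> borel_measurable M"
    and "\<And>x. 0 \<le> h x" "0 \<le> a" "0 \<le> b"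
  shows "(\<integral>\<^sup>+x. ennreal (a + b * h x) \<partial>M) = ennreal a + ennreal b * (\<integral>\<^sup>+x. ennreal (h x) \<partial>M)"
  using nn_integral_affine2[of h "\<lambda>_. 0" a b 0] assms by simp

lemma nsq_parallelogram:
  fixes w z :: "'k \<Rightarrow> 'f::rc_field"
  shows "nsq K (\<lambda>k. w k + z k) + nsq K (\<lambda>k. w k - z k) = 2 * nsq K w + 2 * nsq K z"
  unfolding nsq_def by (simp add: sum.distrib[symmetric] norm_parallelogram sum_distrib_left)

text \<open>
  If \<open>p\<close> and \<open>q\<close> denote the two squared norms on the left, then \<open>p + q\<close>
  is known from the parallelogram law and
  \<open>\<bar>p - q\<bar> \<le> 4 \<parallel>w\<parallel> \<parallel>z\<parallel>\<close> by Cauchy-Schwarz;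
  then use \<open>p\<^sup>2 + q\<^sup>2 = ((p + q)\<^sup>2 + (p - q)\<^sup>2) / 2\<close>.
\<close>

lemma nsq_fourth_powers:
  fixes w z :: "'k \<Rightarrow> 'f::rc_field"
  shows "((nsq K (\<lambda>k. w k + z k))\<^sup>2 + (nsq K (\<lambda>k. w k - z k))\<^sup>2) / 2 \<le>
    (nsq K w)\<^sup>2 + 6 * nsq K w * nsq K z + (nsq K z)\<^sup>2"
proof -
  define p where "p = nsq K (\<lambda>k. w k + z k)"
  define q where "q = nsq K (\<lambda>k. w k - z k)"
  have coord: "\<bar>(norm (a + b))\<^sup>2 - (norm (a - b))\<^sup>2\<bar> \<le> 4 * (\<bar>norm a\<bar> * \<bar>norm b\<bar>)" for a b :: 'f
  proof -
    have "(norm (a + b))\<^sup>2 \<le> (norm a + norm b)\<^sup>2" "(norm (a - b))\<^sup>2 \<le> (norm a + norm b)\<^sup>2"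
      by (intro power_mono norm_triangle_ineq norm_triangle_ineq4 norm_ge_zero)+
    with norm_parallelogram[of a b] show ?thesis
      by (simp add: power2_eq_square algebra_simps abs_le_iff)
  qed
  have "\<bar>p - q\<bar> \<le> (\<Sum>k\<in>K. \<bar>(norm (w k + z k))\<^sup>2 - (norm (w k - z k))\<^sup>2\<bar>)"
    unfolding p_def q_def nsq_def sum_subtractf[symmetric] by (rule sum_abs)
  also have "\<dots> \<le> (\<Sum>k\<in>K. 4 * (\<bar>norm (w k)\<bar> * \<bar>norm (z k)\<bar>))" by (intro sum_mono coord)
  also have "\<dots> \<le> 4 * (L2_set (\<lambda>k. norm (w k)) K * L2_set (\<lambda>k. norm (z k)) K)"
    unfolding sum_distrib_left[symmetric] by (intro mult_left_mono L2_set_mult_ineq) auto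
  finally have "\<bar>p - q\<bar>\<^sup>2 \<le> (4 * (L2_set (\<lambda>k. norm (w k)) K * L2_set (\<lambda>k. norm (z k)) K))\<^sup>2"
    by (intro power_mono) auto
  also have "\<dots> = 16 * (nsq K w * nsq K z)"
    by (simp add: power_mult_distrib L2_set_def nsq_def[symmetric])
  finally have diff: "(p - q)\<^sup>2 \<le> 16 * (nsq K w * nsq K z)" by simp
  have sum: "p + q = 2 * nsq K w + 2 * nsq K z"
    unfolding p_def q_def by (rule nsq_parallelogram)
  have "p\<^sup>2 + q\<^sup>2 = ((p + q)\<^sup>2 + (p - q)\<^sup>2) / 2" by (simp add: power2_eq_square field_simps)
  also have "\<dots> \<le> ((2 * nsq K w + 2 * nsq K z)\<^sup>2 + 16 * (nsq K w * nsq K z)) / 2"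
    using diff by (simp add: sum)
  finally show ?thesis
    unfolding p_def[symmetric] q_def[symmetric] by (simp add: power2_eq_square field_simps)
qed

lemma symmetric_law_shift_moments:
  fixes w c :: "'k \<Rightarrow> 'f::rc_field"
  assumes \<gamma>: "symmetric_law \<gamma> v"
  shows "(\<integral>\<^sup>+g. ennreal (nsq K (\<lambda>k. w k + c k * g)) \<partial>\<gamma>) = ennreal (nsq K w + v * nsq K c)"
    and "(\<integral>\<^sup>+g. ennreal ((nsq K (\<lambda>k. w k + c k * g))\<^sup>2) \<partial>\<gamma>) \<le>
      ennreal ((nsq K w)\<^sup>2 + 6 * nsq K w * (v * nsq K c) + 3 * (v * nsq K c)\<^sup>2)"
proof -
  have [measurable_cong]: "sets \<gamma> = sets borel" and v: "0 \<le> v"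
    and m2: "(\<integral>\<^sup>+g. ennreal ((norm g)\<^sup>2) \<partial>\<gamma>) = ennreal v"
    and m4: "(\<integral>\<^sup>+g. ennreal (((norm g)\<^sup>2)\<^sup>2) \<partial>\<gamma>) \<le> ennreal (3 * v\<^sup>2)"
    using \<gamma> by (auto simp: symmetric_law_def)
  interpret prob_space \<gamma> using \<gamma> by (simp add: symmetric_law_def)
  have meas: "(\<lambda>g. nsq K (\<lambda>k. w k + c k * g)) \<in> borel_measurable borel"
    unfolding nsq_def by measurable
  have cg: "nsq K (\<lambda>k. c k * g) = nsq K c * (norm g)\<^sup>2" for g
    using nsq_scale[of K g c] by (simp add: mult.commute)
  have "(\<integral>\<^sup>+g. ennreal (nsq K (\<lambda>k. w k + c k * g)) \<partial>\<gamma>) =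
      (\<integral>\<^sup>+g. ennreal ((nsq K (\<lambda>k. w k + c k * g) + nsq K (\<lambda>k. w k + c k * (- g))) / 2) \<partial>\<gamma>)"
    by (rule symmetric_law_symmetrize[OF \<gamma> meas]) simp
  also have "\<dots> = (\<integral>\<^sup>+g. ennreal (nsq K w + nsq K c * (norm g)\<^sup>2) \<partial>\<gamma>)"
  proof -
    have "(nsq K (\<lambda>k. w k + c k * g) + nsq K (\<lambda>k. w k + c k * (- g))) / 2 = nsq K w + nsq K c * (norm g)\<^sup>2" for g
      using nsq_parallelogram[of K w "\<lambda>k. c k * g"] by (simp add: cg)
    then show ?thesis by (simp only:)
  qed
  also have "\<dots> = ennreal (nsq K w) + ennreal (nsq K c) * ennreal v"
    unfolding m2[symmetric] by (rule nn_integral_affine) auto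
  also have "\<dots> = ennreal (nsq K w + v * nsq K c)"
    using v by (simp add: ennreal_plus ennreal_mult' mult.commute)
  finally show "(\<integral>\<^sup>+g. ennreal (nsq K (\<lambda>k. w k + c k * g)) \<partial>\<gamma>) = ennreal (nsq K w + v * nsq K c)" .
  have "(\<integral>\<^sup>+g. ennreal ((nsq K (\<lambda>k. w k + c k * g))\<^sup>2) \<partial>\<gamma>) =
      (\<integral>\<^sup>+g. ennreal (((nsq K (\<lambda>k. w k + c k * g))\<^sup>2 + (nsq K (\<lambda>k. w k + c k * (- g)))\<^sup>2) / 2) \<partial>\<gamma>)"
    by (rule symmetric_law_symmetrize[OF \<gamma>]) (use meas in auto)
  also have "\<dots> \<le> (\<integral>\<^sup>+g. ennreal ((nsq K w)\<^sup>2 + (6 * nsq K w * nsq K c) * (norm g)\<^sup>2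
      + (nsq K c)\<^sup>2 * ((norm g)\<^sup>2)\<^sup>2) \<partial>\<gamma>)"
  proof (intro nn_integral_mono ennreal_leI)
    fix g
    show "((nsq K (\<lambda>k. w k + c k * g))\<^sup>2 + (nsq K (\<lambda>k. w k + c k * (- g)))\<^sup>2) / 2 \<le>
      (nsq K w)\<^sup>2 + (6 * nsq K w * nsq K c) * (norm g)\<^sup>2 + (nsq K c)\<^sup>2 * ((norm g)\<^sup>2)\<^sup>2"
      using nsq_fourth_powers[of K w "\<lambda>k. c k * g", unfolded cg]
      by (simp add: power_mult_distrib mult_ac)
  qed
  also have "\<dots> = ennreal ((nsq K w)\<^sup>2) + ennreal (6 * nsq K w * nsq K c) * ennreal v
      + ennreal ((nsq K c)\<^sup>2) * (\<integral>\<^sup>+g. ennreal (((norm g)\<^sup>2)\<^sup>2) \<partial>\<gamma>)"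
    unfolding m2[symmetric] by (rule nn_integral_affine2) auto
  also have "\<dots> \<le> ennreal ((nsq K w)\<^sup>2) + ennreal (6 * nsq K w * nsq K c) * ennreal v
      + ennreal ((nsq K c)\<^sup>2) * ennreal (3 * v\<^sup>2)"
    by (intro add_left_mono mult_left_mono m4) auto
  also have "\<dots> = ennreal ((nsq K w)\<^sup>2 + 6 * nsq K w * (v * nsq K c) + 3 * (v * nsq K c)\<^sup>2)"
    using v by (simp add: ennreal_plus[symmetric] ennreal_mult[symmetric] power_mult_distrib mult_ac
        del: ennreal_plus)
  finally show "(\<integral>\<^sup>+g. ennreal ((nsq K (\<lambda>k. w k + c k * g))\<^sup>2) \<partial>\<gamma>) \<le>
      ennreal ((nsq K w)\<^sup>2 + 6 * nsq K w * (v * nsq K c) + 3 * (v * nsq K c)\<^sup>2)" .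
qed

locale independent_entries =
  fixes \<gamma> :: "'e \<Rightarrow> 'f::rc_field measure"
  assumes prob_entry: "prob_space (\<gamma> e)" and sets_entry: "sets (\<gamma> e) = sets borel"
begin

sublocale product_sigma_finite \<gamma>
  by unfold_locales (rule prob_space_imp_sigma_finite[OF prob_entry, THEN sigma_finite_measure.sigma_finite_countable])

lemma prob_space_entries: "prob_space (Pi\<^sub>M E \<gamma>)"
  by (rule prob_space_PiM) (rule prob_entry)

lemma measurable_entry: "e \<in> E \<Longrightarrow> (\<lambda>g. g e) \<in> borel_measurable (Pi\<^sub>M E \<gamma>)"
  using measurable_component_singleton[of e E \<gamma>]
  by (simp add: measurable_cong_sets[OF refl sets_entry])

lemma measurable_nsq_linear:
  assumes "\<And>b. b \<in> B \<Longrightarrow> f b \<in> E"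
  shows "(\<lambda>g. nsq K (\<lambda>k. \<Sum>b\<in>B. c k b * g (f b))) \<in> borel_measurable (Pi\<^sub>M E \<gamma>)"
proof -
  have [measurable]: "(\<lambda>g. \<Sum>b\<in>B. c k b * g (f b)) \<in> borel_measurable (Pi\<^sub>M E \<gamma>)" for k
    using assms by (intro borel_measurable_sum borel_measurable_times borel_measurable_const measurable_entry)
  show ?thesis unfolding nsq_def by measurable
qed

text \<open>
  Add one entry at a time. By \<open>symmetric_law_shift_moments\<close> the bound \<open>3 S\<^sup>2\<close>
  becomes \<open>3 S\<^sup>2 + 6 S C + 3 C\<^sup>2 = 3 (S + C)\<^sup>2\<close> when the mean \<open>S\<close>
  grows by \<open>C\<close>. The entries are addressed through an injection \<open>f\<close> so that the lemma
  applies to subfamilies of one large family.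
\<close>

lemma linear_moments:
  assumes "finite B" "inj_on f B" "\<And>b. b \<in> B \<Longrightarrow> symmetric_law (\<gamma> (f b)) v" "0 \<le> v"
  shows "(\<integral>\<^sup>+g. ennreal (nsq K (\<lambda>k. \<Sum>b\<in>B. c k b * g (f b))) \<partial>Pi\<^sub>M (f ` B) \<gamma>) =
      ennreal (v * (\<Sum>b\<in>B. nsq K (\<lambda>k. c k b)))"
    and "(\<integral>\<^sup>+g. ennreal ((nsq K (\<lambda>k. \<Sum>b\<in>B. c k b * g (f b)))\<^sup>2) \<partial>Pi\<^sub>M (f ` B) \<gamma>) \<le>
      ennreal (3 * (v * (\<Sum>b\<in>B. nsq K (\<lambda>k. c k b)))\<^sup>2)"
proof -
  let ?N = "\<lambda>B g. nsq K (\<lambda>k. \<Sum>b\<in>B. c k b * g (f b))"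
  let ?S = "\<lambda>B. v * (\<Sum>b\<in>B. nsq K (\<lambda>k. c k b))"
  have "(\<integral>\<^sup>+g. ennreal (?N B g) \<partial>Pi\<^sub>M (f ` B) \<gamma>) = ennreal (?S B) \<and>
      (\<integral>\<^sup>+g. ennreal ((?N B g)\<^sup>2) \<partial>Pi\<^sub>M (f ` B) \<gamma>) \<le> ennreal (3 * (?S B)\<^sup>2)"
    using assms(1-3)
  proof (induction B)
    case empty
    then show ?case by (simp add: nsq_def)
  next
    case (insert b B)
    let ?C = "v * nsq K (\<lambda>k. c k b)"
    have law: "symmetric_law (\<gamma> (f b)) v" using insert.prems by simp
    have fb: "f b \<notin> f ` B" using insert.hyps insert.prems(1) by (auto simp: inj_on_def)
    have S0: "0 \<le> ?S B" using assms(4) by (intro mult_nonneg_nonneg sum_nonneg) auto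
    have C0: "0 \<le> ?C" using assms(4) by simp
    have IH: "(\<integral>\<^sup>+g. ennreal (?N B g) \<partial>Pi\<^sub>M (f ` B) \<gamma>) = ennreal (?S B)"
        "(\<integral>\<^sup>+g. ennreal ((?N B g)\<^sup>2) \<partial>Pi\<^sub>M (f ` B) \<gamma>) \<le> ennreal (3 * (?S B)\<^sup>2)"
      using insert.IH insert.prems by (auto simp: inj_on_def)
    interpret P: prob_space "Pi\<^sub>M (f ` B) \<gamma>" by (rule prob_space_entries)
    have meas: "?N B \<in> borel_measurable (Pi\<^sub>M (f ` B) \<gamma>)"
      by (rule measurable_nsq_linear) auto
    have meas': "?N (insert b B) \<in> borel_measurable (Pi\<^sub>M (f ` insert b B) \<gamma>)"
      by (rule measurable_nsq_linear) auto
    have split: "?N (insert b B) (x(f b := y)) = nsq K (\<lambda>k. (\<Sum>b\<in>B. c k b * x (f b)) + c k b * y)" for x y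
    proof -
      have "(\<Sum>b'\<in>B. c k b' * (x(f b := y)) (f b')) = (\<Sum>b'\<in>B. c k b' * x (f b'))" for k
      proof (intro sum.cong refl)
        fix b' assume "b' \<in> B"
        then have "f b' \<noteq> f b" using fb by (metis imageI)
        then show "c k b' * (x(f b := y)) (f b') = c k b' * x (f b')" by simp
      qed
      then show ?thesis using insert.hyps by (simp add: add.commute)
    qed
    have fold: "(\<integral>\<^sup>+g. ennreal (h (?N (insert b B) g)) \<partial>Pi\<^sub>M (f ` insert b B) \<gamma>) =
        (\<integral>\<^sup>+x. \<integral>\<^sup>+y. ennreal (h (nsq K (\<lambda>k. (\<Sum>b\<in>B. c k b * x (f b)) + c k b * y))) \<partial>\<gamma> (f b) \<partial>Pi\<^sub>M (f ` B) \<gamma>)"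
      if [measurable]: "h \<in> borel_measurable borel" for h :: "real \<Rightarrow> real"
      unfolding image_insert split[symmetric]
      by (rule product_nn_integral_insert)
         (use insert.hyps fb meas' in \<open>auto simp: image_insert[symmetric] simp del: image_insert\<close>)
    have "(\<integral>\<^sup>+g. ennreal (?N (insert b B) g) \<partial>Pi\<^sub>M (f ` insert b B) \<gamma>) =
        (\<integral>\<^sup>+x. ennreal (?C + 1 * ?N B x) \<partial>Pi\<^sub>M (f ` B) \<gamma>)"
      using fold[of "\<lambda>x. x"] unfolding symmetric_law_shift_moments(1)[OF law]
      by (simp add: add.commute del: image_insert)
    also have "\<dots> = ennreal ?C + ennreal 1 * ennreal (?S B)"
      unfolding IH(1)[symmetric] using C0 meas by (intro P.nn_integral_affine) auto
    also have "\<dots> = ennreal (?S (insert b B))"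
      using insert.hyps S0 C0 by (simp add: ennreal_plus[symmetric] distrib_left del: ennreal_plus)
    finally have 1: "(\<integral>\<^sup>+g. ennreal (?N (insert b B) g) \<partial>Pi\<^sub>M (f ` insert b B) \<gamma>) = ennreal (?S (insert b B))" .
    have "(\<integral>\<^sup>+g. ennreal ((?N (insert b B) g)\<^sup>2) \<partial>Pi\<^sub>M (f ` insert b B) \<gamma>) =
        (\<integral>\<^sup>+x. \<integral>\<^sup>+y. ennreal ((nsq K (\<lambda>k. (\<Sum>b\<in>B. c k b * x (f b)) + c k b * y))\<^sup>2) \<partial>\<gamma> (f b) \<partial>Pi\<^sub>M (f ` B) \<gamma>)"
      by (rule fold) simp
    also have "\<dots> \<le> (\<integral>\<^sup>+x. ennreal (3 * ?C\<^sup>2 + (6 * ?C) * ?N B x + 1 * (?N B x)\<^sup>2) \<partial>Pi\<^sub>M (f ` B) \<gamma>)"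
      by (intro nn_integral_mono order_trans[OF symmetric_law_shift_moments(2)[OF law]])
         (simp add: algebra_simps)
    also have "\<dots> = ennreal (3 * ?C\<^sup>2) + ennreal (6 * ?C) * ennreal (?S B)
        + ennreal 1 * (\<integral>\<^sup>+g. ennreal ((?N B g)\<^sup>2) \<partial>Pi\<^sub>M (f ` B) \<gamma>)"
      unfolding IH(1)[symmetric] using C0 meas by (intro P.nn_integral_affine2) auto
    also have "\<dots> \<le> ennreal (3 * ?C\<^sup>2) + ennreal (6 * ?C) * ennreal (?S B) + ennreal 1 * ennreal (3 * (?S B)\<^sup>2)"
      by (intro add_left_mono mult_left_mono IH(2)) auto
    also have "\<dots> = ennreal (3 * ?C\<^sup>2 + 6 * ?C * ?S B + 3 * (?S B)\<^sup>2)"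
      using S0 C0 by (simp add: ennreal_plus[symmetric] ennreal_mult[symmetric] del: ennreal_plus)
    also have "3 * ?C\<^sup>2 + 6 * ?C * ?S B + 3 * (?S B)\<^sup>2 = 3 * (?S (insert b B))\<^sup>2"
      using insert.hyps by (simp add: power2_eq_square algebra_simps)
    finally have 2: "(\<integral>\<^sup>+g. ennreal ((?N (insert b B) g)\<^sup>2) \<partial>Pi\<^sub>M (f ` insert b B) \<gamma>) \<le>
        ennreal (3 * (?S (insert b B))\<^sup>2)" .
    from 1 2 show ?case ..
  qed
  then show "(\<integral>\<^sup>+g. ennreal (?N B g) \<partial>Pi\<^sub>M (f ` B) \<gamma>) = ennreal (?S B)"
    "(\<integral>\<^sup>+g. ennreal ((?N B g)\<^sup>2) \<partial>Pi\<^sub>M (f ` B) \<gamma>) \<le> ennreal (3 * (?S B)\<^sup>2)" by auto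
qed

text \<open>
  The summands for different \<open>a\<close> depend on disjoint sets of entries, so they are independent,
  with a common mean \<open>Q\<close> and second moment at most \<open>3 Q\<^sup>2\<close>. The second moment
  of the sum of \<open>n\<close> of them is therefore at most \<open>(n\<^sup>2 + 2 n) Q\<^sup>2\<close>:
  averaging over many slices brings the factor 3 down to \<open>1 + 2 / n\<close>.
\<close>

lemma core_moments:
  fixes ent :: "'a \<Rightarrow> 'b \<Rightarrow> 'e" and v :: real and c :: "'k \<Rightarrow> 'b \<Rightarrow> 'f"
  defines "E \<equiv> \<lambda>A B. (\<lambda>(a, b). ent a b) ` (A \<times> B)"
  assumes "finite A" "finite B" "inj_on (\<lambda>(a, b). ent a b) (A \<times> B)"
    "\<And>a b. a \<in> A \<Longrightarrow> b \<in> B \<Longrightarrow> symmetric_law (\<gamma> (ent a b)) v" "0 \<le> v"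
  shows "(\<integral>\<^sup>+g. ennreal (\<Sum>a\<in>A. nsq K (\<lambda>k. \<Sum>b\<in>B. c k b * g (ent a b))) \<partial>Pi\<^sub>M (E A B) \<gamma>) =
      ennreal (real (card A) * (v * (\<Sum>b\<in>B. nsq K (\<lambda>k. c k b))))"
    and "(\<integral>\<^sup>+g. ennreal ((\<Sum>a\<in>A. nsq K (\<lambda>k. \<Sum>b\<in>B. c k b * g (ent a b)))\<^sup>2) \<partial>Pi\<^sub>M (E A B) \<gamma>) \<le>
      ennreal (((real (card A))\<^sup>2 + 2 * real (card A)) * (v * (\<Sum>b\<in>B. nsq K (\<lambda>k. c k b)))\<^sup>2)"
proof -
  let ?N = "\<lambda>a g. nsq K (\<lambda>k. \<Sum>b\<in>B. c k b * g (ent a b))"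
  let ?T = "\<lambda>A g. \<Sum>a\<in>A. ?N a g"
  define Q where "Q = v * (\<Sum>b\<in>B. nsq K (\<lambda>k. c k b))"
  have Q: "0 \<le> Q" using assms(6) by (auto simp: Q_def intro!: mult_nonneg_nonneg sum_nonneg)
  have "(\<integral>\<^sup>+g. ennreal (?T A g) \<partial>Pi\<^sub>M (E A B) \<gamma>) = ennreal (real (card A) * Q) \<and>
      (\<integral>\<^sup>+g. ennreal ((?T A g)\<^sup>2) \<partial>Pi\<^sub>M (E A B) \<gamma>) \<le> ennreal (((real (card A))\<^sup>2 + 2 * real (card A)) * Q\<^sup>2)"
    using assms(2,4,5)
  proof (induction A)
    case empty
    then show ?case by simp
  next
    case (insert a A)
    define n where "n = real (card A)"
    have n0: "0 \<le> n" by (simp add: n_def)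
    have IH: "(\<integral>\<^sup>+g. ennreal (?T A g) \<partial>Pi\<^sub>M (E A B) \<gamma>) = ennreal (n * Q)"
        "(\<integral>\<^sup>+g. ennreal ((?T A g)\<^sup>2) \<partial>Pi\<^sub>M (E A B) \<gamma>) \<le> ennreal ((n\<^sup>2 + 2 * n) * Q\<^sup>2)"
      using insert.IH insert.prems by (auto simp: inj_on_def n_def)
    have T0: "0 \<le> ?T A g" for g by (intro sum_nonneg) auto
    have EAB: "E (insert a A) B = E A B \<union> ent a ` B" by (auto simp: E_def)
    have disj: "E A B \<inter> ent a ` B = {}"
    proof (rule ccontr)
      assume "E A B \<inter> ent a ` B \<noteq> {}"
      then obtain a' b' b where ab: "a' \<in> A" "b' \<in> B" "b \<in> B" "ent a' b' = ent a b"
        by (auto simp: E_def)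
      then have "(a', b') = (a, b)"
        using inj_onD[OF insert.prems(1), of "(a', b')" "(a, b)"] by auto
      with ab insert.hyps show False by auto
    qed
    have fin: "finite (E A B)" "finite (ent a ` B)"
      using insert.hyps assms(3) by (auto simp: E_def)
    have inj_a: "inj_on (ent a) B"
    proof (rule inj_onI)
      fix b b' assume "b \<in> B" "b' \<in> B" "ent a b = ent a b'"
      then show "b = b'" using inj_onD[OF insert.prems(1), of "(a, b)" "(a, b')"] by auto
    qed
    have law: "symmetric_law (\<gamma> (ent a b)) v" if "b \<in> B" for b using insert.prems(2) that by simp
    have block: "(\<integral>\<^sup>+g. ennreal (?N a g) \<partial>Pi\<^sub>M (ent a ` B) \<gamma>) = ennreal Q"
        "(\<integral>\<^sup>+g. ennreal ((?N a g)\<^sup>2) \<partial>Pi\<^sub>M (ent a ` B) \<gamma>) \<le> ennreal (3 * Q\<^sup>2)"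
      using linear_moments[OF assms(3) inj_a law assms(6)] by (auto simp: Q_def)
    interpret P1: prob_space "Pi\<^sub>M (E A B) \<gamma>" by (rule prob_space_entries)
    interpret P2: prob_space "Pi\<^sub>M (ent a ` B) \<gamma>" by (rule prob_space_entries)
    have measN: "?N a \<in> borel_measurable (Pi\<^sub>M (ent a ` B) \<gamma>)"
      by (rule measurable_nsq_linear) auto
    have measT: "?T A \<in> borel_measurable (Pi\<^sub>M (E A B) \<gamma>)"
      by (intro borel_measurable_sum measurable_nsq_linear) (auto simp: E_def)
    have measT': "?T (insert a A) \<in> borel_measurable (Pi\<^sub>M (E A B \<union> ent a ` B) \<gamma>)"
      by (intro borel_measurable_sum measurable_nsq_linear) (auto simp: E_def)
    have split: "?T (insert a A) (merge (E A B) (ent a ` B) (x, y)) = ?T A x + ?N a y" for x y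
    proof -
      have "?T A (merge (E A B) (ent a ` B) (x, y)) = ?T A x"
        by (intro sum.cong refl nsq_cong) (auto simp: merge_def E_def)
      moreover have "?N a (merge (E A B) (ent a ` B) (x, y)) = ?N a y"
        by (intro nsq_cong sum.cong refl) (use disj in \<open>auto simp: merge_def\<close>)
      ultimately show ?thesis using insert.hyps by simp
    qed
    have fold: "(\<integral>\<^sup>+g. ennreal (h (?T (insert a A) g)) \<partial>Pi\<^sub>M (E (insert a A) B) \<gamma>) =
        (\<integral>\<^sup>+x. \<integral>\<^sup>+y. ennreal (h (?T A x + ?N a y)) \<partial>Pi\<^sub>M (ent a ` B) \<gamma> \<partial>Pi\<^sub>M (E A B) \<gamma>)"
      if [measurable]: "h \<in> borel_measurable borel" for h :: "real \<Rightarrow> real"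
      unfolding EAB split[symmetric]
      by (rule product_nn_integral_fold[OF disj fin]) (use measT' in measurable)
    have "(\<integral>\<^sup>+g. ennreal (?T (insert a A) g) \<partial>Pi\<^sub>M (E (insert a A) B) \<gamma>) =
        (\<integral>\<^sup>+x. \<integral>\<^sup>+y. ennreal (?T A x + 1 * ?N a y) \<partial>Pi\<^sub>M (ent a ` B) \<gamma> \<partial>Pi\<^sub>M (E A B) \<gamma>)"
      using fold[of "\<lambda>x. x"] by simp
    also have "\<dots> = (\<integral>\<^sup>+x. ennreal (?T A x) + ennreal 1 * ennreal Q \<partial>Pi\<^sub>M (E A B) \<gamma>)"
      unfolding block(1)[symmetric]
      by (intro nn_integral_cong P2.nn_integral_affine measN) (auto intro: T0)
    also have "\<dots> = (\<integral>\<^sup>+x. ennreal (Q + 1 * ?T A x) \<partial>Pi\<^sub>M (E A B) \<gamma>)"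
      using Q T0 by (intro nn_integral_cong) (simp add: ennreal_plus add.commute)
    also have "\<dots> = ennreal Q + ennreal 1 * ennreal (n * Q)"
      unfolding IH(1)[symmetric] by (intro P1.nn_integral_affine measT T0 Q) auto
    also have "\<dots> = ennreal (real (card (insert a A)) * Q)"
      using insert.hyps Q n0 by (simp add: n_def ennreal_plus[symmetric] distrib_right del: ennreal_plus)
    finally have 1: "(\<integral>\<^sup>+g. ennreal (?T (insert a A) g) \<partial>Pi\<^sub>M (E (insert a A) B) \<gamma>) =
        ennreal (real (card (insert a A)) * Q)" .
    have "(\<integral>\<^sup>+g. ennreal ((?T (insert a A) g)\<^sup>2) \<partial>Pi\<^sub>M (E (insert a A) B) \<gamma>) =
        (\<integral>\<^sup>+x. \<integral>\<^sup>+y. ennreal ((?T A x)\<^sup>2 + (2 * ?T A x) * ?N a y + 1 * (?N a y)\<^sup>2) \<partial>Pi\<^sub>M (ent a ` B) \<gamma> \<partial>Pi\<^sub>M (E A B) \<gamma>)"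
      using fold[of "\<lambda>x. x\<^sup>2"] by (simp add: power2_sum algebra_simps)
    also have "\<dots> = (\<integral>\<^sup>+x. ennreal ((?T A x)\<^sup>2) + ennreal (2 * ?T A x) * ennreal Q
        + ennreal 1 * (\<integral>\<^sup>+y. ennreal ((?N a y)\<^sup>2) \<partial>Pi\<^sub>M (ent a ` B) \<gamma>) \<partial>Pi\<^sub>M (E A B) \<gamma>)"
      unfolding block(1)[symmetric] using measN T0
      by (intro nn_integral_cong P2.nn_integral_affine2) auto
    also have "\<dots> \<le> (\<integral>\<^sup>+x. ennreal ((?T A x)\<^sup>2) + ennreal (2 * ?T A x) * ennreal Q
        + ennreal 1 * ennreal (3 * Q\<^sup>2) \<partial>Pi\<^sub>M (E A B) \<gamma>)"
      by (intro nn_integral_mono add_left_mono mult_left_mono block(2)) auto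
    also have "\<dots> = (\<integral>\<^sup>+x. ennreal (3 * Q\<^sup>2 + (2 * Q) * ?T A x + 1 * (?T A x)\<^sup>2) \<partial>Pi\<^sub>M (E A B) \<gamma>)"
      using Q T0 by (intro nn_integral_cong)
        (simp add: ennreal_plus[symmetric] ennreal_mult[symmetric] algebra_simps del: ennreal_plus)
    also have "\<dots> = ennreal (3 * Q\<^sup>2) + ennreal (2 * Q) * ennreal (n * Q)
        + ennreal 1 * (\<integral>\<^sup>+g. ennreal ((?T A g)\<^sup>2) \<partial>Pi\<^sub>M (E A B) \<gamma>)"
      unfolding IH(1)[symmetric] using measT T0 Q by (intro P1.nn_integral_affine2) auto
    also have "\<dots> \<le> ennreal (3 * Q\<^sup>2) + ennreal (2 * Q) * ennreal (n * Q) + ennreal 1 * ennreal ((n\<^sup>2 + 2 * n) * Q\<^sup>2)"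
      by (intro add_left_mono mult_left_mono IH(2)) auto
    also have "\<dots> = ennreal (3 * Q\<^sup>2 + 2 * Q * (n * Q) + (n\<^sup>2 + 2 * n) * Q\<^sup>2)"
      using Q n0 by (simp add: ennreal_plus[symmetric] ennreal_mult[symmetric] del: ennreal_plus)
    also have "3 * Q\<^sup>2 + 2 * Q * (n * Q) + (n\<^sup>2 + 2 * n) * Q\<^sup>2 =
        ((real (card (insert a A)))\<^sup>2 + 2 * real (card (insert a A))) * Q\<^sup>2"
      using insert.hyps by (simp add: n_def power2_eq_square algebra_simps)
    finally have 2: "(\<integral>\<^sup>+g. ennreal ((?T (insert a A) g)\<^sup>2) \<partial>Pi\<^sub>M (E (insert a A) B) \<gamma>) \<le>
        ennreal (((real (card (insert a A)))\<^sup>2 + 2 * real (card (insert a A))) * Q\<^sup>2)" .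
    from 1 2 show ?case ..
  qed
  then show "(\<integral>\<^sup>+g. ennreal (?T A g) \<partial>Pi\<^sub>M (E A B) \<gamma>) =
      ennreal (real (card A) * (v * (\<Sum>b\<in>B. nsq K (\<lambda>k. c k b))))"
    "(\<integral>\<^sup>+g. ennreal ((?T A g)\<^sup>2) \<partial>Pi\<^sub>M (E A B) \<gamma>) \<le>
      ennreal (((real (card A))\<^sup>2 + 2 * real (card A)) * (v * (\<Sum>b\<in>B. nsq K (\<lambda>k. c k b)))\<^sup>2)"
    by (simp_all add: Q_def)
qed

end

section \<open>Contraction of matrix product states\<close>

lemma sum_PiE_insert:
  fixes f :: "('a \<Rightarrow> 'b) \<Rightarrow> 'c::comm_monoid_add"
  assumes "x \<notin> S"
  shows "(\<Sum>i\<in>Pi\<^sub>E (insert x S) T. f i) = (\<Sum>i\<in>Pi\<^sub>E S T. \<Sum>y\<in>T x. f (i(x := y)))"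
proof -
  have "(\<Sum>i\<in>Pi\<^sub>E (insert x S) T. f i) = (\<Sum>p\<in>T x \<times> Pi\<^sub>E S T. f ((snd p)(x := fst p)))"
    unfolding PiE_insert_eq using inj_combinator[OF assms, of T]
    by (subst sum.reindex) (auto simp: case_prod_unfold comp_def)
  also have "\<dots> = (\<Sum>y\<in>T x. \<Sum>i\<in>Pi\<^sub>E S T. f (i(x := y)))"
    by (simp add: sum.cartesian_product case_prod_unfold)
  also have "\<dots> = (\<Sum>i\<in>Pi\<^sub>E S T. \<Sum>y\<in>T x. f (i(x := y)))" by (rule sum.swap)
  finally show ?thesis .
qed

text \<open>
  The row vector obtained by multiplying the first \<open>p + 1\<close> cores at the physical indices
  \<open>i\<close>; its entries are indexed by the bond between the cores \<open>p + 1\<close> and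
  \<open>p + 2\<close>.
\<close>

primrec bond_vector :: "nat \<Rightarrow> (core_entry \<Rightarrow> 'f::rc_field) \<Rightarrow> (nat \<Rightarrow> nat) \<Rightarrow> nat \<Rightarrow> nat \<Rightarrow> 'f" where
  "bond_vector D G i 0 \<beta> = G (First (i 1) \<beta>)"
| "bond_vector D G i (Suc p) \<beta> =
    (\<Sum>\<alpha>=1..D. bond_vector D G i p \<alpha> * G (Inner (p + 2) \<alpha> (i (p + 2)) \<beta>))"

text \<open>
  The sum over all bond indices in \<open>mps_entry\<close> is the path expansion of a product of matrices.
  The test function \<open>\<phi>\<close> of the last bond index lets the induction absorb one core after the
  other.
\<close>

lemma bond_vector_paths:
  "(\<Sum>\<alpha>\<in>{1..Suc p} \<rightarrow>\<^sub>E {1..D}. G (First (i 1) (\<alpha> 1)) *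
      (\<Prod>q\<in>{1<..<p + 2}. G (Inner q (\<alpha> (q - 1)) (i q) (\<alpha> q))) * \<phi> (\<alpha> (Suc p))) =
    (\<Sum>\<beta>=1..D. bond_vector D G i p \<beta> * \<phi> \<beta>)"
proof (induction p arbitrary: \<phi>)
  case 0
  have e: "{1..Suc 0} = insert (1::nat) {}" "{1<..<0 + 2::nat} = {}" by auto
  show ?case unfolding e by (subst sum_PiE_insert) auto
next
  case (Suc p)
  have e: "{1..Suc (Suc p)} = insert (p + 2) {1..Suc p}" by auto
  have e': "{1<..<Suc p + 2} = insert (p + 2) {1<..<p + 2}" by auto
  have "(\<Sum>\<alpha>\<in>{1..Suc (Suc p)} \<rightarrow>\<^sub>E {1..D}. G (First (i 1) (\<alpha> 1)) *
      (\<Prod>q\<in>{1<..<Suc p + 2}. G (Inner q (\<alpha> (q - 1)) (i q) (\<alpha> q))) * \<phi> (\<alpha> (Suc (Suc p)))) =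
    (\<Sum>\<alpha>\<in>{1..Suc p} \<rightarrow>\<^sub>E {1..D}. G (First (i 1) (\<alpha> 1)) *
      (\<Prod>q\<in>{1<..<p + 2}. G (Inner q (\<alpha> (q - 1)) (i q) (\<alpha> q))) *
      (\<Sum>\<beta>=1..D. G (Inner (p + 2) (\<alpha> (Suc p)) (i (p + 2)) \<beta>) * \<phi> \<beta>))"
    unfolding e
  proof (subst sum_PiE_insert, simp, rule sum.cong[OF refl])
    fix \<alpha> :: "nat \<Rightarrow> nat"
    have prod: "(\<Prod>q\<in>{1<..<p + 2}. G (Inner q ((\<alpha>(p + 2 := \<beta>)) (q - 1)) (i q) ((\<alpha>(p + 2 := \<beta>)) q))) =
        (\<Prod>q\<in>{1<..<p + 2}. G (Inner q (\<alpha> (q - 1)) (i q) (\<alpha> q)))" for \<beta>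
      by (intro prod.cong refl) auto
    have "(\<Prod>q\<in>{1<..<Suc p + 2}. G (Inner q ((\<alpha>(p + 2 := \<beta>)) (q - 1)) (i q) ((\<alpha>(p + 2 := \<beta>)) q))) =
        G (Inner (p + 2) (\<alpha> (Suc p)) (i (p + 2)) \<beta>) *
        (\<Prod>q\<in>{1<..<p + 2}. G (Inner q (\<alpha> (q - 1)) (i q) (\<alpha> q)))" for \<beta>
      unfolding e' prod[of \<beta>, symmetric] by (subst prod.insert) auto
    then show "(\<Sum>\<beta>=1..D. G (First (i 1) ((\<alpha>(p + 2 := \<beta>)) 1)) *
        (\<Prod>q\<in>{1<..<Suc p + 2}. G (Inner q ((\<alpha>(p + 2 := \<beta>)) (q - 1)) (i q) ((\<alpha>(p + 2 := \<beta>)) q))) *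
        \<phi> ((\<alpha>(p + 2 := \<beta>)) (Suc (Suc p)))) =
      G (First (i 1) (\<alpha> 1)) * (\<Prod>q\<in>{1<..<p + 2}. G (Inner q (\<alpha> (q - 1)) (i q) (\<alpha> q))) *
        (\<Sum>\<beta>=1..D. G (Inner (p + 2) (\<alpha> (Suc p)) (i (p + 2)) \<beta>) * \<phi> \<beta>)"
      unfolding sum_distrib_left by (intro sum.cong refl) (simp add: mult_ac)
  qed
  also have "\<dots> = (\<Sum>\<alpha>=1..D. bond_vector D G i p \<alpha> *
      (\<Sum>\<beta>=1..D. G (Inner (p + 2) \<alpha> (i (p + 2)) \<beta>) * \<phi> \<beta>))"
    by (rule Suc.IH)
  also have "\<dots> = (\<Sum>\<alpha>=1..D. \<Sum>\<beta>=1..D.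
      bond_vector D G i p \<alpha> * G (Inner (p + 2) \<alpha> (i (p + 2)) \<beta>) * \<phi> \<beta>)"
    by (simp add: sum_distrib_left mult.assoc)
  also have "\<dots> = (\<Sum>\<beta>=1..D. \<Sum>\<alpha>=1..D.
      bond_vector D G i p \<alpha> * G (Inner (p + 2) \<alpha> (i (p + 2)) \<beta>) * \<phi> \<beta>)"
    by (rule sum.swap)
  finally show ?case by (simp add: sum_distrib_right)
qed

lemma mps_entry_bond_vector:
  "mps_entry D (p + 2) G i = (\<Sum>\<alpha>=1..D. bond_vector D G i p \<alpha> * G (Last \<alpha> (i (p + 2))))"
  unfolding mps_entry_def
  using bond_vector_paths[where p = p and D = D and G = G and i = i and \<phi> = "\<lambda>\<alpha>. G (Last \<alpha> (i (p + 2)))"]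
  by simp

lemma bond_vector_update: "p + 1 < q \<Longrightarrow> bond_vector D G (i(q := j)) p \<beta> = bond_vector D G i p \<beta>"
  by (induction p arbitrary: \<beta>) auto

text \<open>
  The entries of the cores \<open>1, \<dots>, p + 1\<close>, on which \<open>bond_vector\<close> depends.
\<close>

definition left_entries :: "nat \<Rightarrow> nat \<Rightarrow> nat \<Rightarrow> core_entry set" where
  "left_entries d D p = {First i \<alpha> | i \<alpha>. i \<in> {1..d} \<and> \<alpha> \<in> {1..D}} \<union>
     {Inner q \<alpha> i \<beta> | q \<alpha> i \<beta>. q \<in> {1<..<p + 2} \<and> \<alpha> \<in> {1..D} \<and> i \<in> {1..d} \<and> \<beta> \<in> {1..D}}"

definition inner_core :: "nat \<Rightarrow> nat \<Rightarrow> nat \<Rightarrow> core_entry set" where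
  "inner_core d D q = (\<lambda>(\<alpha>, j, \<beta>). Inner q \<alpha> j \<beta>) ` ({1..D} \<times> {1..d} \<times> {1..D})"

definition last_core :: "nat \<Rightarrow> nat \<Rightarrow> core_entry set" where
  "last_core d D = (\<lambda>(\<alpha>, j). Last \<alpha> j) ` ({1..D} \<times> {1..d})"

lemma left_entries_0: "left_entries d D 0 = (\<lambda>(j, \<beta>). First j \<beta>) ` ({1..d} \<times> {1..D})"
  by (auto simp: left_entries_def image_iff)

lemma left_entries_Suc: "left_entries d D (Suc p) = inner_core d D (p + 2) \<union> left_entries d D p"
proof -
  have "q \<in> {1<..<Suc p + 2} \<longleftrightarrow> q = p + 2 \<or> q \<in> {1<..<p + 2}" for q by auto
  then show ?thesis unfolding left_entries_def inner_core_def by (auto simp: image_iff)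
qed

lemma core_entries_split: "core_entries d D (p + 2) = last_core d D \<union> left_entries d D p"
  unfolding core_entries_def left_entries_def last_core_def by (auto simp: image_iff)

lemma finite_cores: "finite (inner_core d D q)" "finite (last_core d D)" "finite (left_entries d D p)"
proof -
  show "finite (inner_core d D q)" "finite (last_core d D)" by (auto simp: inner_core_def last_core_def)
  show "finite (left_entries d D p)"
    by (induction p) (auto simp: left_entries_0 left_entries_Suc inner_core_def)
qed

lemma disjoint_cores:
  "inner_core d D (p + 2) \<inter> left_entries d D p = {}" "last_core d D \<inter> left_entries d D p = {}"
  by (auto simp: inner_core_def last_core_def left_entries_def)

lemma bond_vector_cong:
  assumes "\<And>e. e \<in> left_entries d D p \<Longrightarrow> G e = G' e" "\<And>q. q \<in> {1..Suc p} \<Longrightarrow> i q \<in> {1..d}" "\<beta> \<in> {1..D}"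
  shows "bond_vector D G i p \<beta> = bond_vector D G' i p \<beta>"
  using assms
proof (induction p arbitrary: \<beta>)
  case 0
  have "First (i 1) \<beta> \<in> left_entries d D 0"
    using "0.prems"(2)[of 1] "0.prems"(3) by (auto simp: left_entries_0 image_iff)
  then show ?case using "0.prems"(1) by simp
next
  case (Suc p)
  have "bond_vector D G i p \<alpha> * G (Inner (p + 2) \<alpha> (i (p + 2)) \<beta>) =
      bond_vector D G' i p \<alpha> * G' (Inner (p + 2) \<alpha> (i (p + 2)) \<beta>)" if "\<alpha> \<in> {1..D}" for \<alpha>
  proof (rule arg_cong2[of _ _ _ _ "(*)"])
    show "bond_vector D G i p \<alpha> = bond_vector D G' i p \<alpha>"
      using Suc.prems(1,2) that by (intro Suc.IH) (auto simp: left_entries_Suc)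
    have "Inner (p + 2) \<alpha> (i (p + 2)) \<beta> \<in> inner_core d D (p + 2)"
      using Suc.prems(2)[of "p + 2"] Suc.prems(3) that by (auto simp: inner_core_def image_iff)
    then show "G (Inner (p + 2) \<alpha> (i (p + 2)) \<beta>) = G' (Inner (p + 2) \<alpha> (i (p + 2)) \<beta>)"
      using Suc.prems(1) by (auto simp: left_entries_Suc)
  qed
  then show ?case by simp
qed

definition left_indices :: "nat \<Rightarrow> nat \<Rightarrow> nat \<Rightarrow> ((nat \<Rightarrow> nat) \<times> nat) set" where
  "left_indices d D p = ({1..Suc p} \<rightarrow>\<^sub>E {1..d}) \<times> {1..D}"

text \<open>
  The first \<open>p + 1\<close> cores contracted with a tensor \<open>Y\<close> that has \<open>p + 1\<close>
  physical indices and one bond index.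
\<close>

definition left_contraction ::
    "nat \<Rightarrow> nat \<Rightarrow> nat \<Rightarrow> ((nat \<Rightarrow> nat) \<times> nat \<Rightarrow> 'f::rc_field) \<Rightarrow> (core_entry \<Rightarrow> 'f) \<Rightarrow> 'f" where
  "left_contraction d D p Y G = (\<Sum>(i, \<beta>)\<in>left_indices d D p. Y (i, \<beta>) * bond_vector D G i p \<beta>)"

lemma left_contraction_cong:
  assumes "\<And>e. e \<in> left_entries d D p \<Longrightarrow> G e = G' e"
  shows "left_contraction d D p Y G = left_contraction d D p Y G'"
  unfolding left_contraction_def
proof (rule sum.cong[OF refl], clarify)
  fix i \<beta> assume "(i, \<beta>) \<in> left_indices d D p"
  then have "bond_vector D G i p \<beta> = bond_vector D G' i p \<beta>"
    by (intro bond_vector_cong[of d D p G G' i \<beta>] assms) (auto simp: left_indices_def PiE_iff)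
  then show "Y (i, \<beta>) * bond_vector D G i p \<beta> = Y (i, \<beta>) * bond_vector D G' i p \<beta>" by simp
qed

text \<open>
  Contracting the core \<open>p + 2\<close> with \<open>Y\<close> first gives a tensor of the same kind with
  one physical index less. As the moment bounds hold for all \<open>Y\<close>, this makes an induction over
  the cores possible.
\<close>

lemma left_contraction_Suc:
  "left_contraction d D (Suc p) Y G =
    left_contraction d D p
      (\<lambda>(i, \<alpha>). \<Sum>(j, \<beta>)\<in>{1..d} \<times> {1..D}. Y (i(p + 2 := j), \<beta>) * G (Inner (p + 2) \<alpha> j \<beta>)) G"
proof -
  have e: "{1..Suc (Suc p)} = insert (p + 2) {1..Suc p}" by auto
  let ?I = "{1..Suc p} \<rightarrow>\<^sub>E {1..d}"
  let ?t = "\<lambda>i j \<beta> \<alpha>. Y (i(p + 2 := j), \<beta>) * (bond_vector D G i p \<alpha> * G (Inner (p + 2) \<alpha> j \<beta>))"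
  have "left_contraction d D (Suc p) Y G =
      (\<Sum>i\<in>?I. \<Sum>j=1..d. \<Sum>\<beta>=1..D. Y (i(p + 2 := j), \<beta>) * bond_vector D G (i(p + 2 := j)) (Suc p) \<beta>)"
    unfolding left_contraction_def left_indices_def sum.cartesian_product[symmetric] e
    by (subst sum_PiE_insert) auto
  also have "\<dots> = (\<Sum>i\<in>?I. \<Sum>j=1..d. \<Sum>\<beta>=1..D. \<Sum>\<alpha>=1..D. ?t i j \<beta> \<alpha>)"
    by (simp add: bond_vector_update sum_distrib_left)
  also have "\<dots> = (\<Sum>i\<in>?I. \<Sum>jb\<in>{1..d} \<times> {1..D}. \<Sum>\<alpha>=1..D. ?t i (fst jb) (snd jb) \<alpha>)"
    by (rule sum.cong[OF refl], subst sum.cartesian_product) (simp add: case_prod_unfold)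
  also have "\<dots> = (\<Sum>i\<in>?I. \<Sum>\<alpha>=1..D. \<Sum>jb\<in>{1..d} \<times> {1..D}. ?t i (fst jb) (snd jb) \<alpha>)"
    by (rule sum.cong[OF refl]) (rule sum.swap)
  also have "\<dots> = left_contraction d D p
      (\<lambda>(i, \<alpha>). \<Sum>(j, \<beta>)\<in>{1..d} \<times> {1..D}. Y (i(p + 2 := j), \<beta>) * G (Inner (p + 2) \<alpha> j \<beta>)) G"
    unfolding left_contraction_def left_indices_def sum.cartesian_product[symmetric] prod.case sum_distrib_right
    by (simp add: sum.cartesian_product case_prod_unfold mult_ac)
  finally show ?thesis .
qed

lemma mps_contraction:
  "(\<Sum>i\<in>multi_indices d (p + 2). y i * mps_entry D (p + 2) G i) =
    left_contraction d D p (\<lambda>(i, \<alpha>). \<Sum>j=1..d. y (i(p + 2 := j)) * G (Last \<alpha> j)) G"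
proof -
  have e: "{1..p + 2} = insert (p + 2) {1..Suc p}" by auto
  let ?I = "{1..Suc p} \<rightarrow>\<^sub>E {1..d}"
  let ?t = "\<lambda>i j \<alpha>. y (i(p + 2 := j)) * (bond_vector D G i p \<alpha> * G (Last \<alpha> j))"
  have "(\<Sum>i\<in>multi_indices d (p + 2). y i * mps_entry D (p + 2) G i) =
      (\<Sum>i\<in>?I. \<Sum>j=1..d. y (i(p + 2 := j)) * mps_entry D (p + 2) G (i(p + 2 := j)))"
    unfolding multi_indices_def e by (rule sum_PiE_insert) auto
  also have "\<dots> = (\<Sum>i\<in>?I. \<Sum>j=1..d. \<Sum>\<alpha>=1..D. ?t i j \<alpha>)"
    unfolding mps_entry_bond_vector by (simp add: bond_vector_update sum_distrib_left)
  also have "\<dots> = (\<Sum>i\<in>?I. \<Sum>\<alpha>=1..D. \<Sum>j=1..d. ?t i j \<alpha>)"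
    by (rule sum.cong[OF refl]) (rule sum.swap)
  also have "\<dots> = left_contraction d D p (\<lambda>(i, \<alpha>). \<Sum>j=1..d. y (i(p + 2 := j)) * G (Last \<alpha> j)) G"
    unfolding left_contraction_def left_indices_def sum.cartesian_product[symmetric] prod.case sum_distrib_right
    by (simp add: mult_ac)
  finally show ?thesis .
qed

section \<open>Moments of random matrix product states\<close>

lemma left_contraction_coeff_cong:
  assumes "\<And>q. q \<in> left_indices d D p \<Longrightarrow> Y q = Y' q"
  shows "left_contraction d D p Y G = left_contraction d D p Y' G"
  unfolding left_contraction_def using assms by (intro sum.cong refl) auto

locale core_law = independent_entries \<gamma> for \<gamma> :: "core_entry \<Rightarrow> 'f::rc_field measure" +
  fixes D :: nat
  assumes D: "1 \<le> D" and law: "symmetric_law (\<gamma> e) (core_variance D e)"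
begin

lemma measurable_bond_vector:
  assumes "left_entries d D p \<subseteq> E" "\<And>q. q \<in> {1..Suc p} \<Longrightarrow> i q \<in> {1..d}" "\<beta> \<in> {1..D}"
  shows "(\<lambda>g. bond_vector D g i p \<beta>) \<in> borel_measurable (Pi\<^sub>M E \<gamma>)"
  using assms
proof (induction p arbitrary: \<beta>)
  case 0
  have "First (i 1) \<beta> \<in> left_entries d D 0"
    using "0.prems"(2)[of 1] "0.prems"(3) by (auto simp: left_entries_0 image_iff)
  then have "First (i 1) \<beta> \<in> E" using "0.prems"(1) by blast
  then show ?case unfolding bond_vector.simps by (rule measurable_entry)
next
  case (Suc p)
  have "Inner (p + 2) \<alpha> (i (p + 2)) \<beta> \<in> E" if "\<alpha> \<in> {1..D}" for \<alpha>
  proof -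
    have "Inner (p + 2) \<alpha> (i (p + 2)) \<beta> \<in> inner_core d D (p + 2)"
      using Suc.prems(2)[of "p + 2"] Suc.prems(3) that by (auto simp: inner_core_def image_iff)
    then show ?thesis using Suc.prems(1) by (auto simp: left_entries_Suc)
  qed
  moreover have "(\<lambda>g. bond_vector D g i p \<alpha>) \<in> borel_measurable (Pi\<^sub>M E \<gamma>)" if "\<alpha> \<in> {1..D}" for \<alpha>
    using Suc.prems(1,2) that by (intro Suc.IH) (auto simp: left_entries_Suc)
  ultimately show ?case
    unfolding bond_vector.simps by (intro borel_measurable_sum borel_measurable_times measurable_entry)
qed

lemma measurable_left_contraction:
  assumes "left_entries d D p \<subseteq> E"
    and "\<And>q. q \<in> left_indices d D p \<Longrightarrow> (\<lambda>g. Y g q) \<in> borel_measurable (Pi\<^sub>M E \<gamma>)"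
  shows "(\<lambda>g. left_contraction d D p (Y g) g) \<in> borel_measurable (Pi\<^sub>M E \<gamma>)"
proof -
  have "(\<lambda>g. Y g q * bond_vector D g (fst q) p (snd q)) \<in> borel_measurable (Pi\<^sub>M E \<gamma>)"
    if q: "q \<in> left_indices d D p" for q
  proof (intro borel_measurable_times assms(2)[OF q])
    show "(\<lambda>g. bond_vector D g (fst q) p (snd q)) \<in> borel_measurable (Pi\<^sub>M E \<gamma>)"
      by (rule measurable_bond_vector[OF assms(1)]) (use q in \<open>auto simp: left_indices_def PiE_iff\<close>)
  qed
  then have "(\<lambda>g. \<Sum>q\<in>left_indices d D p. Y g q * bond_vector D g (fst q) p (snd q)) \<in> borel_measurable (Pi\<^sub>M E \<gamma>)"
    by (rule borel_measurable_sum)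
  then show ?thesis unfolding left_contraction_def by (simp add: case_prod_unfold)
qed

text \<open>
  One step of the induction, for inner cores and the last core alike. Given the entries of the new core, the
  bounds for the earlier cores apply to the contracted tensor, and \<open>core_moments\<close> gives the
  moments of the squared norm of that tensor.
\<close>

lemma contract_core:
  fixes ent :: "nat \<Rightarrow> 'b \<Rightarrow> core_entry" and c :: "(nat \<Rightarrow> nat) \<Rightarrow> 'b \<Rightarrow> 'f" and v \<kappa> M :: real
    and B :: "'b set" and d p :: nat
  defines "S \<equiv> \<Sum>b\<in>B. nsq ({1..Suc p} \<rightarrow>\<^sub>E {1..d}) (\<lambda>i. c i b)"
    and "X \<equiv> \<lambda>g. left_contraction d D p (\<lambda>(i, \<alpha>). \<Sum>b\<in>B. c i b * g (ent \<alpha> b)) g"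
  assumes B: "finite B" and inj: "inj_on (\<lambda>(\<alpha>, b). ent \<alpha> b) ({1..D} \<times> B)"
    and core: "Core = (\<lambda>(\<alpha>, b). ent \<alpha> b) ` ({1..D} \<times> B)" and disj: "Core \<inter> left_entries d D p = {}"
    and v: "\<And>\<alpha> b. core_variance D (ent \<alpha> b) = v" "0 \<le> v" and nonneg: "0 \<le> \<kappa>" "0 \<le> M"
    and m2: "\<And>Y. (\<integral>\<^sup>+g. ennreal ((norm (left_contraction d D p Y g))\<^sup>2) \<partial>Pi\<^sub>M (left_entries d D p) \<gamma>) =
      ennreal (\<kappa> * nsq (left_indices d D p) Y)"
    and m4: "\<And>Y. (\<integral>\<^sup>+g. ennreal (((norm (left_contraction d D p Y g))\<^sup>2)\<^sup>2) \<partial>Pi\<^sub>M (left_entries d D p) \<gamma>) \<le>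
      ennreal (M * (nsq (left_indices d D p) Y)\<^sup>2)"
  shows "(\<integral>\<^sup>+g. ennreal ((norm (X g))\<^sup>2) \<partial>Pi\<^sub>M (Core \<union> left_entries d D p) \<gamma>) =
      ennreal (\<kappa> * (real D * (v * S)))"
    and "(\<integral>\<^sup>+g. ennreal (((norm (X g))\<^sup>2)\<^sup>2) \<partial>Pi\<^sub>M (Core \<union> left_entries d D p) \<gamma>) \<le>
      ennreal (M * (((real D)\<^sup>2 + 2 * real D) * (v * S)\<^sup>2))"
proof -
  let ?L = "left_entries d D p"
  let ?I = "{1..Suc p} \<rightarrow>\<^sub>E {1..d}"
  define Z where "Z = (\<lambda>g. \<lambda>(i, \<alpha>). \<Sum>b\<in>B. c i b * g (ent \<alpha> b))"
  define T where "T = (\<lambda>g. \<Sum>\<alpha>\<in>{1..D}. nsq ?I (\<lambda>i. \<Sum>b\<in>B. c i b * g (ent \<alpha> b)))"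
  have X: "X g = left_contraction d D p (Z g) g" for g by (simp add: X_def Z_def)
  have ZT: "nsq (left_indices d D p) (Z g) = T g" for g
  proof -
    have "nsq (left_indices d D p) (Z g) = (\<Sum>i\<in>?I. \<Sum>\<alpha>\<in>{1..D}. (norm (\<Sum>b\<in>B. c i b * g (ent \<alpha> b)))\<^sup>2)"
      unfolding nsq_def left_indices_def sum.cartesian_product Z_def by (intro sum.cong refl) auto
    also have "\<dots> = T g" unfolding T_def nsq_def by (rule sum.swap)
    finally show ?thesis .
  qed
  have inCore: "ent \<alpha> b \<in> Core" if "\<alpha> \<in> {1..D}" "b \<in> B" for \<alpha> b using that by (auto simp: core)
  have X_merge: "X (merge Core ?L (x, y)) = left_contraction d D p (Z x) y" for x y
  proof -
    have "X (merge Core ?L (x, y)) = left_contraction d D p (Z x) (merge Core ?L (x, y))"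
      unfolding X
    proof (rule left_contraction_coeff_cong)
      fix q assume "q \<in> left_indices d D p"
      then obtain i \<alpha> where q: "q = (i, \<alpha>)" "\<alpha> \<in> {1..D}" by (auto simp: left_indices_def)
      show "Z (merge Core ?L (x, y)) q = Z x q"
        unfolding q(1) Z_def prod.case using inCore[OF q(2)] by (intro sum.cong refl) (simp add: merge_def)
    qed
    also have "\<dots> = left_contraction d D p (Z x) y"
      by (rule left_contraction_cong) (use disj in \<open>auto simp: merge_def\<close>)
    finally show ?thesis .
  qed
  have measX: "X \<in> borel_measurable (Pi\<^sub>M (Core \<union> ?L) \<gamma>)"
    unfolding X
  proof (rule measurable_left_contraction)
    fix q assume "q \<in> left_indices d D p"
    then obtain i \<alpha> where q: "q = (i, \<alpha>)" "\<alpha> \<in> {1..D}" by (auto simp: left_indices_def)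
    show "(\<lambda>g. Z g q) \<in> borel_measurable (Pi\<^sub>M (Core \<union> ?L) \<gamma>)"
      unfolding q(1) Z_def prod.case using inCore[OF q(2)]
      by (intro borel_measurable_sum borel_measurable_times borel_measurable_const measurable_entry) auto
  qed auto
  have finCore: "finite Core" using B by (simp add: core)
  have fold: "(\<integral>\<^sup>+g. ennreal (h (X g)) \<partial>Pi\<^sub>M (Core \<union> ?L) \<gamma>) =
      (\<integral>\<^sup>+x. \<integral>\<^sup>+y. ennreal (h (left_contraction d D p (Z x) y)) \<partial>Pi\<^sub>M ?L \<gamma> \<partial>Pi\<^sub>M Core \<gamma>)"
    if h: "h \<in> borel_measurable borel" for h :: "'f \<Rightarrow> real"
    unfolding X_merge[symmetric]
    by (rule product_nn_integral_fold[OF disj finCore finite_cores(3)])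
       (intro measurable_compose[OF measurable_compose[OF measX h] measurable_ennreal])
  note cm = core_moments[where A = "{1..D}" and B = B and ent = ent and K = ?I and c = c and v = v,
      OF _ B inj _ v(2), folded S_def core]
  have ent_law: "symmetric_law (\<gamma> (ent \<alpha> b)) v" for \<alpha> b using law[of "ent \<alpha> b"] v(1) by simp
  have cmT: "(\<integral>\<^sup>+g. ennreal (T g) \<partial>Pi\<^sub>M Core \<gamma>) = ennreal (real D * (v * S))"
      "(\<integral>\<^sup>+g. ennreal ((T g)\<^sup>2) \<partial>Pi\<^sub>M Core \<gamma>) \<le> ennreal (((real D)\<^sup>2 + 2 * real D) * (v * S)\<^sup>2)"
    using cm[OF finite_atLeastAtMost ent_law] unfolding T_def by simp_all
  have T0: "0 \<le> T g" for g by (simp add: T_def sum_nonneg)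
  have measT: "T \<in> borel_measurable (Pi\<^sub>M Core \<gamma>)"
    unfolding T_def using inCore by (intro borel_measurable_sum measurable_nsq_linear)
  have "(\<integral>\<^sup>+g. ennreal ((norm (X g))\<^sup>2) \<partial>Pi\<^sub>M (Core \<union> ?L) \<gamma>) = (\<integral>\<^sup>+x. ennreal \<kappa> * ennreal (T x) \<partial>Pi\<^sub>M Core \<gamma>)"
    using fold[of "\<lambda>z. (norm z)\<^sup>2"] nonneg T0 by (simp add: m2 ZT ennreal_mult)
  also have "\<dots> = ennreal \<kappa> * ennreal (real D * (v * S))"
    using cmT(1) measT by (simp add: nn_integral_cmult)
  also have "\<dots> = ennreal (\<kappa> * (real D * (v * S)))"
    using nonneg(1) by (rule ennreal_mult'[symmetric])
  finally show "(\<integral>\<^sup>+g. ennreal ((norm (X g))\<^sup>2) \<partial>Pi\<^sub>M (Core \<union> ?L) \<gamma>) = ennreal (\<kappa> * (real D * (v * S)))" .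
  have "(\<integral>\<^sup>+g. ennreal (((norm (X g))\<^sup>2)\<^sup>2) \<partial>Pi\<^sub>M (Core \<union> ?L) \<gamma>) =
      (\<integral>\<^sup>+x. \<integral>\<^sup>+y. ennreal (((norm (left_contraction d D p (Z x) y))\<^sup>2)\<^sup>2) \<partial>Pi\<^sub>M ?L \<gamma> \<partial>Pi\<^sub>M Core \<gamma>)"
    by (rule fold) measurable
  also have "\<dots> \<le> (\<integral>\<^sup>+x. ennreal (M * (T x)\<^sup>2) \<partial>Pi\<^sub>M Core \<gamma>)"
    by (intro nn_integral_mono) (use m4[of "Z _"] in \<open>simp add: ZT\<close>)
  also have "\<dots> = ennreal M * (\<integral>\<^sup>+x. ennreal ((T x)\<^sup>2) \<partial>Pi\<^sub>M Core \<gamma>)"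
    using nonneg measT by (simp add: ennreal_mult nn_integral_cmult)
  also have "\<dots> \<le> ennreal M * ennreal (((real D)\<^sup>2 + 2 * real D) * (v * S)\<^sup>2)"
    using cmT(2) by (intro mult_left_mono) auto
  also have "\<dots> = ennreal (M * (((real D)\<^sup>2 + 2 * real D) * (v * S)\<^sup>2))"
    using nonneg(2) by (rule ennreal_mult'[symmetric])
  finally show "(\<integral>\<^sup>+g. ennreal (((norm (X g))\<^sup>2)\<^sup>2) \<partial>Pi\<^sub>M (Core \<union> ?L) \<gamma>) \<le>
      ennreal (M * (((real D)\<^sup>2 + 2 * real D) * (v * S)\<^sup>2))" .
qed

lemma left_contraction_moments:
  "(\<integral>\<^sup>+g. ennreal ((norm (left_contraction d D p Y g))\<^sup>2) \<partial>Pi\<^sub>M (left_entries d D p) \<gamma>) =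
      ennreal (1 / sqrt (real D) * nsq (left_indices d D p) Y)" (is "?m2 p Y")
  "(\<integral>\<^sup>+g. ennreal (((norm (left_contraction d D p Y g))\<^sup>2)\<^sup>2) \<partial>Pi\<^sub>M (left_entries d D p) \<gamma>) \<le>
      ennreal (3 * (1 + 2 / real D) ^ p / real D * (nsq (left_indices d D p) Y)\<^sup>2)" (is "?m4 p Y")
proof -
  have "(\<forall>Y. ?m2 p Y) \<and> (\<forall>Y. ?m4 p Y)"
  proof (induction p)
    case 0
    have e: "{1..Suc 0} = insert (1::nat) {}" by auto
    let ?B = "{1..d} \<times> {1..D}"
    define ent where "ent = (\<lambda>(j, \<beta>). First j \<beta>)"
    have inj: "inj_on ent ?B" by (auto simp: inj_on_def ent_def)
    have ent_law: "symmetric_law (\<gamma> (ent b)) (1 / sqrt (real D))" for b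
      using law[of "ent b"] by (cases b) (simp add: ent_def)
    have "?m2 0 Y \<and> ?m4 0 Y" for Y
    proof -
      define c where "c = (\<lambda>(_::unit) (j, \<beta>). Y ((\<lambda>_. undefined)(1 := j), \<beta>))"
      have X: "left_contraction d D 0 Y g = (\<Sum>b\<in>?B. c () b * g (ent b))" for g
      proof -
        have "left_contraction d D 0 Y g =
            (\<Sum>i\<in>insert 1 {} \<rightarrow>\<^sub>E {1..d}. \<Sum>\<beta>=1..D. Y (i, \<beta>) * g (First (i 1) \<beta>))"
          unfolding left_contraction_def left_indices_def sum.cartesian_product[symmetric] e by simp
        also have "\<dots> = (\<Sum>i\<in>{} \<rightarrow>\<^sub>E {1..d}. \<Sum>j=1..d. \<Sum>\<beta>=1..D.
            Y (i(1 := j), \<beta>) * g (First ((i(1 := j)) 1) \<beta>))"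
          by (rule sum_PiE_insert) simp
        also have "\<dots> = (\<Sum>j=1..d. \<Sum>\<beta>=1..D. c () (j, \<beta>) * g (ent (j, \<beta>)))"
          by (simp add: c_def ent_def fun_upd_def)
        finally show ?thesis by (simp add: sum.cartesian_product case_prod_unfold)
      qed
      have N: "nsq (left_indices d D 0) Y = (\<Sum>b\<in>?B. nsq {()} (\<lambda>k. c k b))"
      proof -
        have "nsq (left_indices d D 0) Y =
            (\<Sum>i\<in>insert 1 {} \<rightarrow>\<^sub>E {1..d}. \<Sum>\<beta>=1..D. (norm (Y (i, \<beta>)))\<^sup>2)"
          unfolding nsq_def left_indices_def sum.cartesian_product e by (simp add: case_prod_unfold)
        also have "\<dots> = (\<Sum>i\<in>{} \<rightarrow>\<^sub>E {1..d}. \<Sum>j=1..d. \<Sum>\<beta>=1..D. (norm (Y (i(1 := j), \<beta>)))\<^sup>2)"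
          by (rule sum_PiE_insert) simp
        also have "\<dots> = (\<Sum>j=1..d. \<Sum>\<beta>=1..D. nsq {()} (\<lambda>k. c k (j, \<beta>)))"
          by (simp add: c_def nsq_def fun_upd_def)
        also have "\<dots> = (\<Sum>b\<in>?B. nsq {()} (\<lambda>k. c k b))"
          by (simp add: sum.cartesian_product case_prod_unfold)
        finally show ?thesis .
      qed
      have x: "(norm (left_contraction d D 0 Y g))\<^sup>2 = nsq {()} (\<lambda>k. \<Sum>b\<in>?B. c k b * g (ent b))" for g
        unfolding X by (simp add: nsq_def)
      have E: "left_entries d D 0 = ent ` ?B" by (simp add: left_entries_0 ent_def)
      have v: "0 \<le> 1 / sqrt (real D)" by simp
      have fin: "finite ?B" by simp
      show ?thesis
        using linear_moments[OF fin inj ent_law v, of "{()}" c]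
        unfolding x E N by (simp add: power_mult_distrib power_divide)
    qed
    then show ?case by blast
  next
    case (Suc p)
    let ?B = "{1..d} \<times> {1..D}"
    let ?I = "{1..Suc p} \<rightarrow>\<^sub>E {1..d}"
    define ent where "ent = (\<lambda>\<alpha>. \<lambda>(j, \<beta>). Inner (p + 2) \<alpha> j \<beta>)"
    have inj: "inj_on (\<lambda>(\<alpha>, b). ent \<alpha> b) ({1..D} \<times> ?B)" by (auto simp: inj_on_def ent_def)
    have core: "inner_core d D (p + 2) = (\<lambda>(\<alpha>, b). ent \<alpha> b) ` ({1..D} \<times> ?B)"
      by (simp add: inner_core_def ent_def)
    have v: "core_variance D (ent \<alpha> b) = 1 / real D" "0 \<le> 1 / real D" for \<alpha> b
      by (cases b) (simp_all add: ent_def)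
    have fin: "finite ?B" by simp
    have nonneg: "0 \<le> 1 / sqrt (real D)" "0 \<le> 3 * (1 + 2 / real D) ^ p / real D" by auto
    have "?m2 (Suc p) Y \<and> ?m4 (Suc p) Y" for Y
    proof -
      define c where "c = (\<lambda>i (j, \<beta>). Y (i(p + 2 := j), \<beta>))"
      have X: "left_contraction d D (Suc p) Y g =
          left_contraction d D p (\<lambda>(i, \<alpha>). \<Sum>b\<in>?B. c i b * g (ent \<alpha> b)) g" for g
        unfolding left_contraction_Suc c_def ent_def by (simp add: case_prod_unfold)
      have e: "{1..Suc (Suc p)} = insert (p + 2) {1..Suc p}" by auto
      have S: "(\<Sum>b\<in>?B. nsq ?I (\<lambda>i. c i b)) = nsq (left_indices d D (Suc p)) Y"
      proof -
        have "nsq (left_indices d D (Suc p)) Y =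
            (\<Sum>i\<in>{1..Suc (Suc p)} \<rightarrow>\<^sub>E {1..d}. \<Sum>\<beta>=1..D. (norm (Y (i, \<beta>)))\<^sup>2)"
          unfolding nsq_def left_indices_def sum.cartesian_product by (simp add: case_prod_unfold)
        also have "\<dots> = (\<Sum>i\<in>?I. \<Sum>j=1..d. \<Sum>\<beta>=1..D. (norm (Y (i(p + 2 := j), \<beta>)))\<^sup>2)"
          unfolding e by (rule sum_PiE_insert) auto
        also have "\<dots> = (\<Sum>i\<in>?I. \<Sum>b\<in>?B. (norm (c i b))\<^sup>2)"
          by (rule sum.cong[OF refl]) (simp add: sum.cartesian_product c_def case_prod_unfold)
        also have "\<dots> = (\<Sum>b\<in>?B. nsq ?I (\<lambda>i. c i b))" unfolding nsq_def by (rule sum.swap)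
        finally show ?thesis by simp
      qed
      note cc = contract_core[OF fin inj core disjoint_cores(1) v nonneg Suc[THEN conjunct1, rule_format]
          Suc[THEN conjunct2, rule_format], of c, folded X left_entries_Suc, unfolded S]
      have D0: "real D > 0" using D by simp
      have a: "1 / sqrt (real D) * (real D * (1 / real D * nsq (left_indices d D (Suc p)) Y)) =
          1 / sqrt (real D) * nsq (left_indices d D (Suc p)) Y"
        using D0 by simp
      have b: "3 * (1 + 2 / real D) ^ p / real D *
          (((real D)\<^sup>2 + 2 * real D) * (1 / real D * nsq (left_indices d D (Suc p)) Y)\<^sup>2) =
          3 * (1 + 2 / real D) ^ Suc p / real D * (nsq (left_indices d D (Suc p)) Y)\<^sup>2"
      proof -
        have "((real D)\<^sup>2 + 2 * real D) * (1 / real D)\<^sup>2 = 1 + 2 / real D"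
          using D0 by (simp add: power2_eq_square field_simps)
        then have "((real D)\<^sup>2 + 2 * real D) * (1 / real D * nsq (left_indices d D (Suc p)) Y)\<^sup>2 =
            (1 + 2 / real D) * (nsq (left_indices d D (Suc p)) Y)\<^sup>2"
          unfolding power_mult_distrib by (metis mult.assoc)
        then show ?thesis by simp
      qed
      show ?thesis using cc unfolding a b by blast
    qed
    then show ?case by blast
  qed
  then show "?m2 p Y" "?m4 p Y" by auto
qed

lemma measurable_mps_entry:
  assumes "i \<in> multi_indices d (p + 2)"
  shows "(\<lambda>g. mps_entry D (p + 2) g i) \<in> borel_measurable (Pi\<^sub>M (core_entries d D (p + 2)) \<gamma>)"
proof -
  have i: "i q \<in> {1..d}" if "q \<in> {1..p + 2}" for q
    using assms that by (auto simp: multi_indices_def PiE_iff)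
  have "Last \<alpha> (i (p + 2)) \<in> core_entries d D (p + 2)" if "\<alpha> \<in> {1..D}" for \<alpha>
    unfolding core_entries_split last_core_def using i[of "p + 2"] that by (auto simp: image_iff)
  moreover have "(\<lambda>g. bond_vector D g i p \<alpha>) \<in> borel_measurable (Pi\<^sub>M (core_entries d D (p + 2)) \<gamma>)"
    if "\<alpha> \<in> {1..D}" for \<alpha>
  proof (rule measurable_bond_vector[of d])
    show "left_entries d D p \<subseteq> core_entries d D (p + 2)" unfolding core_entries_split by blast
  qed (use i that in auto)
  ultimately show ?thesis
    unfolding mps_entry_bond_vector by (intro borel_measurable_sum borel_measurable_times measurable_entry)
qed

lemma mps_moments:
  fixes y :: "(nat \<Rightarrow> nat) \<Rightarrow> 'f" and d p :: nat
  defines "X \<equiv> \<lambda>g. \<Sum>i\<in>multi_indices d (p + 2). y i * mps_entry D (p + 2) g i"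
  shows "(\<integral>\<^sup>+g. ennreal ((norm (X g))\<^sup>2) \<partial>Pi\<^sub>M (core_entries d D (p + 2)) \<gamma>) =
      ennreal (nsq (multi_indices d (p + 2)) y)"
    and "(\<integral>\<^sup>+g. ennreal (((norm (X g))\<^sup>2)\<^sup>2) \<partial>Pi\<^sub>M (core_entries d D (p + 2)) \<gamma>) \<le>
      ennreal (3 * (1 + 2 / real D) ^ (p + 1) * (nsq (multi_indices d (p + 2)) y)\<^sup>2)"
proof -
  let ?B = "{1..d}"
  let ?I = "{1..Suc p} \<rightarrow>\<^sub>E {1..d}"
  define N where "N = nsq (multi_indices d (p + 2)) y"
  define c where "c = (\<lambda>i j. y (i(p + 2 := j)))"
  have inj: "inj_on (\<lambda>(\<alpha>, b). Last \<alpha> b) ({1..D} \<times> ?B)" by (auto simp: inj_on_def)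
  have v: "core_variance D (Last \<alpha> b) = 1 / sqrt (real D)" "0 \<le> 1 / sqrt (real D)" for \<alpha> b by simp_all
  have fin: "finite ?B" by simp
  have nonneg: "0 \<le> 1 / sqrt (real D)" "0 \<le> 3 * (1 + 2 / real D) ^ p / real D" by auto
  have X: "X g = left_contraction d D p (\<lambda>(i, \<alpha>). \<Sum>b\<in>?B. c i b * g (Last \<alpha> b)) g" for g
    unfolding X_def mps_contraction c_def ..
  have e: "{1..p + 2} = insert (p + 2) {1..Suc p}" by auto
  have S: "(\<Sum>b\<in>?B. nsq ?I (\<lambda>i. c i b)) = N"
  proof -
    have "N = (\<Sum>i\<in>?I. \<Sum>j=1..d. (norm (c i j))\<^sup>2)"
      unfolding N_def nsq_def multi_indices_def e c_def by (rule sum_PiE_insert) auto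
    also have "\<dots> = (\<Sum>b\<in>?B. nsq ?I (\<lambda>i. c i b))" unfolding nsq_def by (rule sum.swap)
    finally show ?thesis by simp
  qed
  note cc = contract_core[where c = c, OF fin inj last_core_def disjoint_cores(2) v nonneg left_contraction_moments,
      folded X core_entries_split, unfolded S]
  have D0: "real D > 0" using D by simp
  have a: "1 / sqrt (real D) * (real D * (1 / sqrt (real D) * N)) = N"
    using D0 by (simp add: field_simps)
  have b: "3 * (1 + 2 / real D) ^ p / real D * (((real D)\<^sup>2 + 2 * real D) * (1 / sqrt (real D) * N)\<^sup>2) =
      3 * (1 + 2 / real D) ^ (p + 1) * N\<^sup>2"
  proof -
    have "((real D)\<^sup>2 + 2 * real D) * (1 / sqrt (real D))\<^sup>2 / real D = 1 + 2 / real D"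
      using D0 by (simp add: power_divide power2_eq_square field_simps)
    moreover have "3 * q / real D * (K * (W * N\<^sup>2)) = 3 * q * (K * W / real D) * N\<^sup>2" for q K W :: real
      by simp
    ultimately show ?thesis unfolding power_mult_distrib[of _ N] by (simp only: power_add power_one_right mult.assoc)
  qed
  show "(\<integral>\<^sup>+g. ennreal ((norm (X g))\<^sup>2) \<partial>Pi\<^sub>M (core_entries d D (p + 2)) \<gamma>) =
      ennreal (nsq (multi_indices d (p + 2)) y)"
    using cc(1) unfolding a unfolding N_def .
  show "(\<integral>\<^sup>+g. ennreal (((norm (X g))\<^sup>2)\<^sup>2) \<partial>Pi\<^sub>M (core_entries d D (p + 2)) \<gamma>) \<le>
      ennreal (3 * (1 + 2 / real D) ^ (p + 1) * (nsq (multi_indices d (p + 2)) y)\<^sup>2)"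
    using cc(2) unfolding b unfolding N_def .
qed

end

section \<open>Isotropy and the variance bound for random matrix product states\<close>

lemma bounded_linear_conjugate: "bounded_linear (conjugate :: 'f::rc_field \<Rightarrow> 'f)"
  by (rule bounded_linear_intro[where K = 1])
     (simp_all add: conjugate_dist_add scaleR_conv_of_real conjugate_dist_mul)

text \<open>
  Polarization. The moment of \<open>\<omega> i * conjugate (\<omega> j)\<close>, called \<open>z\<close> in
  the proof, appears in the second moment in the direction \<open>e\<^sub>i + conjugate z e\<^sub>j\<close> as
  the additional term \<open>2 \<bar>z\<bar>\<^sup>2\<close>, which must vanish. Choosing the direction by
  \<open>z\<close> treats both fields at once.
\<close>

lemma isotropicI:
  fixes \<nu> :: "('i \<Rightarrow> 'f::rc_field) measure"
  assumes I: "finite I" and rv: "random_vector I \<nu>"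
    and m2: "\<And>x. (\<integral>\<^sup>+\<omega>. ennreal ((norm (ip I \<omega> x))\<^sup>2) \<partial>\<nu>) = ennreal (nsq I x)"
  shows "isotropic I \<nu>"
  unfolding isotropic_def
proof (intro conjI ballI)
  show "random_vector I \<nu>" by fact
  interpret prob_space \<nu> using rv by (simp add: random_vector_def)
  have int: "integrable \<nu> (\<lambda>\<omega>. (norm (ip I \<omega> x))\<^sup>2)" for x
    using measurable_ip[OF rv] m2 by (intro integrableI_nn_integral_finite[of _ _ "nsq I x"]) auto
  have E: "(\<integral>\<omega>. (norm (ip I \<omega> x))\<^sup>2 \<partial>\<nu>) = nsq I x" for x
    using measurable_ip[OF rv] m2 by (subst integral_eq_nn_integral) auto
  fix i j assume i: "i \<in> I" and j: "j \<in> I"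
  define unit where "unit = (\<lambda>j (i::'i). if i = j then 1 else 0 :: 'f)"
  have unit: "ip I \<omega> (unit l) = conjugate (\<omega> l)" "nsq I (unit l) = 1" if "l \<in> I" for \<omega> l
    using I that by (simp_all add: ip_def nsq_def unit_def if_distrib[of "\<lambda>x. _ * x"]
        if_distrib[of "\<lambda>x. (norm x)\<^sup>2"] cong: if_cong)
  have int1: "integrable \<nu> (\<lambda>\<omega>. (norm (\<omega> l))\<^sup>2)" "(\<integral>\<omega>. (norm (\<omega> l))\<^sup>2 \<partial>\<nu>) = 1" if "l \<in> I" for l
    using int[of "unit l"] E[of "unit l"] that by (simp_all add: unit)
  note comp = measurable_random_vector_component[OF rv]
  have prod_meas: "(\<lambda>\<omega>. \<omega> i * conjugate (\<omega> j)) \<in> borel_measurable \<nu>"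
    by (intro borel_measurable_times comp i measurable_compose[OF comp[OF j] borel_measurable_conjugate])
  show prod_int: "integrable \<nu> (\<lambda>\<omega>. \<omega> i * conjugate (\<omega> j))"
  proof (rule Bochner_Integration.integrable_bound[OF _ prod_meas])
    show "integrable \<nu> (\<lambda>\<omega>. (norm (\<omega> i))\<^sup>2 + (norm (\<omega> j))\<^sup>2)" using int1 i j by simp
    have "norm (\<omega> i * conjugate (\<omega> j)) \<le> (norm (\<omega> i))\<^sup>2 + (norm (\<omega> j))\<^sup>2" for \<omega> :: "'i \<Rightarrow> 'f"
    proof -
      have "0 \<le> norm (\<omega> i) * norm (\<omega> j)" by simp
      then show ?thesis using sum_squares_bound[of "norm (\<omega> i)" "norm (\<omega> j)"]
        unfolding norm_mult norm_conjugate by linarith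
    qed
    then show "AE \<omega> in \<nu>. norm (\<omega> i * conjugate (\<omega> j)) \<le> norm ((norm (\<omega> i))\<^sup>2 + (norm (\<omega> j))\<^sup>2)"
      by (intro AE_I2) (simp add: order_trans[OF _ abs_ge_self])
  qed
  show "(\<integral>\<omega>. \<omega> i * conjugate (\<omega> j) \<partial>\<nu>) = (if i = j then 1 else 0)"
  proof (cases "i = j")
    case True
    have "(\<integral>\<omega>. of_real ((norm (\<omega> i))\<^sup>2) \<partial>\<nu>) = (of_real (\<integral>\<omega>. (norm (\<omega> i))\<^sup>2 \<partial>\<nu>) :: 'f)"
      by (rule integral_bounded_linear[OF bounded_linear_of_real int1(1)[OF i]])
    then show ?thesis using int1(2)[OF i] True by (simp only: of_real_norm_square) simp
  next
    case False
    define z where "z = (\<integral>\<omega>. \<omega> i * conjugate (\<omega> j) \<partial>\<nu>)"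
    define x where "x = (\<lambda>l. unit i l + conjugate z * unit j l)"
    have ipx: "ip I \<omega> x = conjugate (\<omega> i) + conjugate z * conjugate (\<omega> j)" for \<omega>
      unfolding x_def ip_add_right ip_scale_right by (simp add: unit i j)
    have nx: "nsq I x = 1 + (norm z)\<^sup>2"
    proof -
      have "nsq I x = (\<Sum>l\<in>I. (if l = i then 1 else 0) + (if l = j then (norm z)\<^sup>2 else 0))"
        unfolding nsq_def x_def unit_def using False by (intro sum.cong refl) auto
      then show ?thesis using I i j by (simp add: sum.distrib)
    qed
    define w where "w = (\<lambda>\<omega>. \<omega> i * conjugate (\<omega> j) * conjugate z)"
    have w: "integrable \<nu> w" "(\<integral>\<omega>. w \<omega> \<partial>\<nu>) = z * conjugate z"
      unfolding w_def using prod_int by (simp_all add: z_def)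
    have cw: "integrable \<nu> (\<lambda>\<omega>. conjugate (w \<omega>))" "(\<integral>\<omega>. conjugate (w \<omega>) \<partial>\<nu>) = conjugate (z * conjugate z)"
      using integrable_bounded_linear[OF bounded_linear_conjugate w(1)]
        integral_bounded_linear[OF bounded_linear_conjugate w(1)] w(2) by simp_all
    have expand: "(of_real ((norm (ip I \<omega> x))\<^sup>2) :: 'f) =
        of_real ((norm (\<omega> i))\<^sup>2 + (norm z)\<^sup>2 * (norm (\<omega> j))\<^sup>2) + (w \<omega> + conjugate (w \<omega>))" for \<omega>
      unfolding ipx norm_add_square of_real_add
      by (simp add: w_def norm_mult power_mult_distrib conjugate_dist_mul mult_ac)
    have "(of_real (1 + (norm z)\<^sup>2) :: 'f) = (\<integral>\<omega>. of_real ((norm (ip I \<omega> x))\<^sup>2) \<partial>\<nu>)"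
      unfolding nx[symmetric] E[symmetric] by (rule integral_bounded_linear[OF bounded_linear_of_real int, symmetric])
    also have "\<dots> = (\<integral>\<omega>. of_real ((norm (\<omega> i))\<^sup>2 + (norm z)\<^sup>2 * (norm (\<omega> j))\<^sup>2) \<partial>\<nu>)
        + ((\<integral>\<omega>. w \<omega> \<partial>\<nu>) + (\<integral>\<omega>. conjugate (w \<omega>) \<partial>\<nu>))"
    proof -
      have "integrable \<nu> (\<lambda>\<omega>. (norm (\<omega> i))\<^sup>2 + (norm z)\<^sup>2 * (norm (\<omega> j))\<^sup>2)"
        using int1 i j by simp
      then have "integrable \<nu> (\<lambda>\<omega>. of_real ((norm (\<omega> i))\<^sup>2 + (norm z)\<^sup>2 * (norm (\<omega> j))\<^sup>2) :: 'f)"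
        by (rule integrable_bounded_linear[OF bounded_linear_of_real])
      with w(1) cw(1) show ?thesis
        unfolding expand by (simp del: of_real_add of_real_mult of_real_power)
    qed
    also have "(\<integral>\<omega>. of_real ((norm (\<omega> i))\<^sup>2 + (norm z)\<^sup>2 * (norm (\<omega> j))\<^sup>2) \<partial>\<nu>) = (of_real (1 + (norm z)\<^sup>2) :: 'f)"
    proof -
      have "integrable \<nu> (\<lambda>\<omega>. (norm (\<omega> i))\<^sup>2 + (norm z)\<^sup>2 * (norm (\<omega> j))\<^sup>2)"
        using int1 i j by simp
      from integral_bounded_linear[OF bounded_linear_of_real this]
      show ?thesis using int1 i j by simp
    qed
    finally have "z * conjugate z + conjugate (z * conjugate z) = 0"
      unfolding w(2) cw(2) by simp
    then have "(of_real (2 * (norm z)\<^sup>2) :: 'f) = of_real 0"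
      by (simp add: of_real_norm_square[symmetric] del: of_real_power)
    then have "z = 0" by (simp only: of_real_eq_iff) simp
    then show ?thesis using False by (simp add: z_def)
  qed
qed

lemma rank_one_variance_boundI:
  fixes \<nu> :: "('i \<Rightarrow> 'f::rc_field) measure"
  assumes I: "finite I" and rv: "random_vector I \<nu>" and s: "0 \<le> s"
    and m2: "\<And>x. (\<integral>\<^sup>+\<omega>. ennreal ((norm (ip I \<omega> x))\<^sup>2) \<partial>\<nu>) = ennreal (nsq I x)"
    and m4: "\<And>x. (\<integral>\<^sup>+\<omega>. ennreal (((norm (ip I \<omega> x))\<^sup>2)\<^sup>2) \<partial>\<nu>) \<le> ennreal ((1 + s) * (nsq I x)\<^sup>2)"
  shows "rank_one_variance_bound I \<nu> s"
  unfolding rank_one_variance_bound_def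
proof (intro conjI allI s)
  show iso: "isotropic I \<nu>" by (rule isotropicI[OF I rv m2])
  interpret prob_space \<nu> using rv by (simp add: random_vector_def)
  fix x
  have [measurable]: "(\<lambda>\<omega>. ip I \<omega> x) \<in> borel_measurable \<nu>" by (rule measurable_ip[OF rv])
  show int4: "integrable \<nu> (\<lambda>\<omega>. ((norm (ip I \<omega> x))\<^sup>2)\<^sup>2)"
  proof (rule integrableI_nonneg)
    show "(\<integral>\<^sup>+\<omega>. ennreal (((norm (ip I \<omega> x))\<^sup>2)\<^sup>2) \<partial>\<nu>) < \<infinity>"
      using le_less_trans[OF m4[of x] ennreal_less_top] by simp
  qed auto
  have E4: "(\<integral>\<omega>. ((norm (ip I \<omega> x))\<^sup>2)\<^sup>2 \<partial>\<nu>) \<le> (1 + s) * (nsq I x)\<^sup>2"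
    using s by (intro integral_real_bounded m4) auto
  show "(\<integral>\<omega>. ((norm (ip I \<omega> x))\<^sup>2 - nsq I x)\<^sup>2 \<partial>\<nu>) \<le> s * (nsq I x)\<^sup>2"
    using E4 unfolding rank_one_variance_eq[OF I iso int4] by (simp add: distrib_right)
qed

text \<open>
  This is where a bond dimension of at least the order \<open>n = p + 2\<close> enters: it bounds the product
  of the factors \<open>1 + 2 / D\<close> over the cores by \<open>exp 2 \<le> 9\<close>.
\<close>

lemma bond_factor_le:
  assumes "1 \<le> D" "p + 2 \<le> D"
  shows "3 * (1 + 2 / real D) ^ (p + 1) \<le> 1 + 26"
proof -
  have "(1 + 2 / real D) ^ (p + 1) \<le> exp (2 / real D) ^ (p + 1)"
    by (intro power_mono) auto
  also have "\<dots> = exp (real (p + 1) * (2 / real D))"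
    by (rule exp_of_nat_mult[symmetric])
  also have "\<dots> \<le> exp (real 2 * 1)"
    using assms by (simp add: field_simps)
  also have "\<dots> = exp 1 ^ 2" by (rule exp_of_nat_mult)
  also have "\<dots> \<le> 3 ^ 2" by (intro power_mono exp_le) auto
  finally show ?thesis by simp
qed

lemma rmps_rank_one_variance_bound:
  fixes gauss :: "real \<Rightarrow> 'f::rc_field measure"
  assumes gauss: "\<And>v. 0 < v \<Longrightarrow> symmetric_law (gauss v) v" and D: "1 \<le> D" and n: "2 \<le> n" "n \<le> D"
  shows "rank_one_variance_bound (multi_indices d n) (rmps gauss d D n) 26"
proof -
  define p where "p = n - 2"
  have p: "n = p + 2" using n(1) by (simp add: p_def)
  let ?\<gamma> = "\<lambda>e. gauss (core_variance D e)"
  let ?I = "multi_indices d (p + 2)"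
  let ?M = "Pi\<^sub>M (core_entries d D (p + 2)) ?\<gamma>"
  have "0 < core_variance D e" for e using D by (cases e) auto
  then have law: "symmetric_law (?\<gamma> e) (core_variance D e)" for e by (rule gauss)
  have "prob_space (?\<gamma> e)" "sets (?\<gamma> e) = sets borel" for e
    using law[of e] by (simp_all add: symmetric_law_def)
  then interpret core_law ?\<gamma> D
    by (intro core_law.intro independent_entries.intro core_law_axioms.intro law D)
  interpret M: prob_space ?M by (rule prob_space_entries)
  have I: "finite ?I" by (auto simp: multi_indices_def intro!: finite_PiE)
  define T :: "(core_entry \<Rightarrow> 'f) \<Rightarrow> (nat \<Rightarrow> nat) \<Rightarrow> 'f" where
    "T = (\<lambda>g. restrict (mps_entry D (p + 2) g) ?I)"
  have T: "T \<in> measurable ?M (Pi\<^sub>M ?I (\<lambda>_. borel))"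
    unfolding T_def by (intro measurable_restrict measurable_mps_entry)
  have \<nu>: "rmps gauss d D n = distr ?M (Pi\<^sub>M ?I (\<lambda>_. borel)) T"
    by (simp add: rmps_def T_def p)
  have rv: "random_vector ?I (rmps gauss d D n)"
    unfolding random_vector_def \<nu> using M.prob_space_distr[OF T] by simp
  have ip_T: "norm (ip ?I (T g) x) = norm (\<Sum>i\<in>?I. conjugate (x i) * mps_entry D (p + 2) g i)" for g x
  proof -
    have "ip ?I (T g) x = conjugate (ip ?I x (mps_entry D (p + 2) g))"
      unfolding conjugate_ip[OF I] by (rule ip_cong) (auto simp: T_def)
    then show ?thesis by (simp add: ip_def)
  qed
  have nsq_conj: "nsq ?I (\<lambda>i. conjugate (x i)) = nsq ?I x" for x :: "(nat \<Rightarrow> nat) \<Rightarrow> 'f"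
    by (simp add: nsq_def)
  have distr: "(\<integral>\<^sup>+\<omega>. ennreal (h (norm (ip ?I \<omega> x))) \<partial>rmps gauss d D n) =
      (\<integral>\<^sup>+g. ennreal (h (norm (\<Sum>i\<in>?I. conjugate (x i) * mps_entry D (p + 2) g i))) \<partial>?M)"
    if [measurable]: "h \<in> borel_measurable borel" for h x
  proof -
    have [measurable]: "(\<lambda>\<omega>. ip ?I \<omega> x) \<in> borel_measurable (distr ?M (Pi\<^sub>M ?I (\<lambda>_. borel)) T)"
      using measurable_ip[OF rv] unfolding \<nu> .
    show ?thesis unfolding \<nu> ip_T[symmetric] by (rule nn_integral_distr[OF T]) measurable
  qed
  have "(\<integral>\<^sup>+\<omega>. ennreal ((norm (ip ?I \<omega> x))\<^sup>2) \<partial>rmps gauss d D n) = ennreal (nsq ?I x)" for x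
    by (subst distr) (simp_all only: mps_moments(1) nsq_conj, measurable)
  moreover have "(\<integral>\<^sup>+\<omega>. ennreal (((norm (ip ?I \<omega> x))\<^sup>2)\<^sup>2) \<partial>rmps gauss d D n) \<le> ennreal ((1 + 26) * (nsq ?I x)\<^sup>2)" for x
  proof -
    have "(\<integral>\<^sup>+\<omega>. ennreal (((norm (ip ?I \<omega> x))\<^sup>2)\<^sup>2) \<partial>rmps gauss d D n) =
        (\<integral>\<^sup>+g. ennreal (((norm (\<Sum>i\<in>?I. conjugate (x i) * mps_entry D (p + 2) g i))\<^sup>2)\<^sup>2) \<partial>?M)"
      by (rule distr) measurable
    also have "\<dots> \<le> ennreal (3 * (1 + 2 / real D) ^ (p + 1) * (nsq ?I x)\<^sup>2)"
      using mps_moments(2)[of d p "\<lambda>i. conjugate (x i)"] unfolding nsq_conj .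
    also have "\<dots> \<le> ennreal ((1 + 26) * (nsq ?I x)\<^sup>2)"
      using bond_factor_le[OF D, of p] n p by (intro ennreal_leI mult_right_mono) auto
    finally show ?thesis .
  qed
  ultimately show ?thesis using rank_one_variance_boundI[OF I, of "rmps gauss d D n" 26] rv unfolding p by simp
qed

section \<open>Gaussian laws\<close>

lemma symmetric_law_real_gaussian:
  assumes v: "0 < v"
  shows "symmetric_law (real_gaussian v) v"
proof -
  define \<sigma> where "\<sigma> = sqrt v"
  have \<sigma>: "0 < \<sigma>" "\<sigma>\<^sup>2 = v" using v by (auto simp: \<sigma>_def)
  let ?f = "\<lambda>x. ennreal (normal_density 0 \<sigma> x)"
  have g: "real_gaussian v = density lborel ?f" by (simp add: real_gaussian_def \<sigma>_def)
  interpret prob_space "density lborel ?f" by (rule prob_space_normal_density[OF \<sigma>(1)])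
  have "distributed (density lborel ?f) lborel (\<lambda>x. x) ?f"
    unfolding distributed_def by (auto simp: distr_id2 cong: distr_cong)
  from normal_density_affine[OF this \<sigma>(1), of "-1" 0]
  have "distributed (density lborel ?f) lborel uminus ?f" by simp
  then have "distr (density lborel ?f) lborel uminus = density lborel ?f" by (simp add: distributed_def)
  then have sym: "distr (density lborel ?f) borel uminus = density lborel ?f"
    by (simp cong: distr_cong)
  have moment: "(\<integral>\<^sup>+x. ennreal (x ^ (2 * k)) \<partial>density lborel ?f) = ennreal (fact (2 * k) / ((2 / \<sigma>\<^sup>2) ^ k * fact k))" for k
  proof -
    note nm = normal_moment_even[OF \<sigma>(1), of 0 k]
    have "(\<integral>\<^sup>+x. ennreal (x ^ (2 * k)) \<partial>density lborel ?f) = (\<integral>\<^sup>+x. ?f x * ennreal (x ^ (2 * k)) \<partial>lborel)"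
      by (rule nn_integral_density) auto
    also have "\<dots> = (\<integral>\<^sup>+x. ennreal (normal_density 0 \<sigma> x * (x - 0) ^ (2 * k)) \<partial>lborel)"
      by (intro nn_integral_cong) (simp add: ennreal_mult')
    also have "\<dots> = ennreal (\<integral>x. normal_density 0 \<sigma> x * (x - 0) ^ (2 * k) \<partial>lborel)"
      using nm by (intro nn_integral_eq_integral) (auto simp: has_bochner_integral_iff)
    finally show ?thesis using nm by (simp add: has_bochner_integral_iff)
  qed
  have "(\<integral>\<^sup>+x. ennreal ((norm x)\<^sup>2) \<partial>density lborel ?f) = ennreal v"
    using moment[of 1] \<sigma> by simp
  moreover have "(\<integral>\<^sup>+x. ennreal (((norm x)\<^sup>2)\<^sup>2) \<partial>density lborel ?f) = ennreal (3 * v\<^sup>2)"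
    using moment[of 2] \<sigma> by (simp add: fact_numeral power_divide)
  ultimately show ?thesis
    unfolding symmetric_law_def g using sym v prob_space_axioms by simp
qed

lemma symmetric_law_complex_gaussian:
  assumes v: "0 < v"
  shows "symmetric_law (complex_gaussian v) v"
proof -
  let ?R = "real_gaussian (v / 2)"
  let ?C = "\<lambda>(g1, g2). Complex g1 g2"
  have R: "symmetric_law ?R (v / 2)" using v by (intro symmetric_law_real_gaussian) simp
  then have sets_R [measurable_cong]: "sets ?R = sets borel" and sym: "distr ?R borel uminus = ?R"
    and m2: "(\<integral>\<^sup>+g. ennreal (g\<^sup>2) \<partial>?R) = ennreal (v / 2)"
    and m4: "(\<integral>\<^sup>+g. ennreal ((g\<^sup>2)\<^sup>2) \<partial>?R) \<le> ennreal (3 * (v / 2)\<^sup>2)"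
    by (auto simp: symmetric_law_def)
  interpret R: prob_space ?R using R by (simp add: symmetric_law_def)
  interpret RR: pair_prob_space ?R ?R by unfold_locales
  have "(\<lambda>p. of_real (fst p) + \<i> * of_real (snd p)) \<in> borel_measurable (?R \<Otimes>\<^sub>M ?R)"
    by measurable
  then have C [measurable]: "?C \<in> borel_measurable (?R \<Otimes>\<^sub>M ?R)"
    by (simp add: Complex_eq case_prod_unfold)
  have neg: "(\<lambda>(x, y). (- x, - y)) \<in> measurable (?R \<Otimes>\<^sub>M ?R) (?R \<Otimes>\<^sub>M ?R)"
    by measurable
  have RR_sym: "distr (?R \<Otimes>\<^sub>M ?R) (?R \<Otimes>\<^sub>M ?R) (\<lambda>(x, y). (- x, - y)) = ?R \<Otimes>\<^sub>M ?R"
  proof -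
    have "distr ?R borel uminus \<Otimes>\<^sub>M distr ?R borel uminus =
        distr (?R \<Otimes>\<^sub>M ?R) (borel \<Otimes>\<^sub>M borel) (\<lambda>(x, y). (- x, - y))"
      by (rule pair_measure_distr) (auto simp: sym R.sigma_finite_measure_axioms)
    then have "?R \<Otimes>\<^sub>M ?R = distr (?R \<Otimes>\<^sub>M ?R) (borel \<Otimes>\<^sub>M borel) (\<lambda>(x, y). (- x, - y))" by (simp only: sym)
    also have "\<dots> = distr (?R \<Otimes>\<^sub>M ?R) (?R \<Otimes>\<^sub>M ?R) (\<lambda>(x, y). (- x, - y))"
      by (rule distr_cong[OF refl]) (auto intro!: sets_pair_measure_cong simp: sets_R)
    finally show ?thesis ..
  qed
  have sym': "distr (complex_gaussian v) borel uminus = complex_gaussian v"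
  proof -
    have "distr (complex_gaussian v) borel uminus = distr (?R \<Otimes>\<^sub>M ?R) borel (uminus \<circ> ?C)"
      unfolding complex_gaussian_def by (rule distr_distr) measurable
    also have "\<dots> = distr (?R \<Otimes>\<^sub>M ?R) borel (?C \<circ> (\<lambda>(x, y). (- x, - y)))"
      by (rule arg_cong[where f = "distr _ _"]) (auto simp: fun_eq_iff complex_eq_iff)
    also have "\<dots> = distr (distr (?R \<Otimes>\<^sub>M ?R) (?R \<Otimes>\<^sub>M ?R) (\<lambda>(x, y). (- x, - y))) borel ?C"
      by (rule distr_distr[symmetric, OF C neg])
    finally show ?thesis by (simp add: RR_sym complex_gaussian_def)
  qed
  have polar: "(\<integral>\<^sup>+z. ennreal (h ((norm z)\<^sup>2)) \<partial>complex_gaussian v) =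
      (\<integral>\<^sup>+x. \<integral>\<^sup>+y. ennreal (h (x\<^sup>2 + y\<^sup>2)) \<partial>?R \<partial>?R)"
    if [measurable]: "h \<in> borel_measurable borel" for h
  proof -
    have "(\<integral>\<^sup>+z. ennreal (h ((norm z)\<^sup>2)) \<partial>complex_gaussian v) =
        (\<integral>\<^sup>+p. ennreal (h ((norm (?C p))\<^sup>2)) \<partial>(?R \<Otimes>\<^sub>M ?R))"
      unfolding complex_gaussian_def by (rule nn_integral_distr[OF C]) measurable
    also have "\<dots> = (\<integral>\<^sup>+p. ennreal (h ((fst p)\<^sup>2 + (snd p)\<^sup>2)) \<partial>(?R \<Otimes>\<^sub>M ?R))"
      by (intro nn_integral_cong) (simp add: case_prod_unfold cmod_power2)
    also have "\<dots> = (\<integral>\<^sup>+x. \<integral>\<^sup>+y. ennreal (h ((fst (x, y))\<^sup>2 + (snd (x, y))\<^sup>2)) \<partial>?R \<partial>?R)"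
      by (rule R.nn_integral_fst[symmetric]) measurable
    finally show ?thesis by simp
  qed
  have "(\<integral>\<^sup>+z. ennreal ((norm z)\<^sup>2) \<partial>complex_gaussian v) = ennreal v"
  proof -
    have "(\<integral>\<^sup>+z. ennreal ((norm z)\<^sup>2) \<partial>complex_gaussian v) = (\<integral>\<^sup>+x. \<integral>\<^sup>+y. ennreal (x\<^sup>2 + 1 * y\<^sup>2) \<partial>?R \<partial>?R)"
      using polar[of "\<lambda>x. x"] by simp
    also have "\<dots> = (\<integral>\<^sup>+x. ennreal (x\<^sup>2) + ennreal 1 * ennreal (v / 2) \<partial>?R)"
      unfolding m2[symmetric] by (intro nn_integral_cong R.nn_integral_affine) auto
    also have "\<dots> = (\<integral>\<^sup>+x. ennreal (v / 2 + 1 * x\<^sup>2) \<partial>?R)"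
      using v by (intro nn_integral_cong) (simp add: ennreal_plus add.commute)
    also have "\<dots> = ennreal (v / 2) + ennreal 1 * (\<integral>\<^sup>+x. ennreal (x\<^sup>2) \<partial>?R)"
      using v by (intro R.nn_integral_affine) auto
    also have "\<dots> = ennreal (v / 2) + ennreal 1 * ennreal (v / 2)" unfolding m2 ..
    also have "\<dots> = ennreal v" using v by (simp add: ennreal_plus[symmetric] del: ennreal_plus)
    finally show ?thesis .
  qed
  moreover have "(\<integral>\<^sup>+z. ennreal (((norm z)\<^sup>2)\<^sup>2) \<partial>complex_gaussian v) \<le> ennreal (3 * v\<^sup>2)"
  proof -
    have "(\<integral>\<^sup>+z. ennreal (((norm z)\<^sup>2)\<^sup>2) \<partial>complex_gaussian v) =
        (\<integral>\<^sup>+x. \<integral>\<^sup>+y. ennreal ((x\<^sup>2 + y\<^sup>2)\<^sup>2) \<partial>?R \<partial>?R)"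
      by (rule polar) measurable
    also have "\<dots> = (\<integral>\<^sup>+x. \<integral>\<^sup>+y. ennreal ((x\<^sup>2)\<^sup>2 + (2 * x\<^sup>2) * y\<^sup>2 + 1 * (y\<^sup>2)\<^sup>2) \<partial>?R \<partial>?R)"
      by (simp add: power2_sum algebra_simps)
    also have "\<dots> = (\<integral>\<^sup>+x. ennreal ((x\<^sup>2)\<^sup>2) + ennreal (2 * x\<^sup>2) * ennreal (v / 2)
        + ennreal 1 * (\<integral>\<^sup>+y. ennreal ((y\<^sup>2)\<^sup>2) \<partial>?R) \<partial>?R)"
      unfolding m2[symmetric] by (intro nn_integral_cong R.nn_integral_affine2) auto
    also have "\<dots> \<le> (\<integral>\<^sup>+x. ennreal ((x\<^sup>2)\<^sup>2) + ennreal (2 * x\<^sup>2) * ennreal (v / 2)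
        + ennreal 1 * ennreal (3 * (v / 2)\<^sup>2) \<partial>?R)"
      by (intro nn_integral_mono add_left_mono mult_left_mono m4) auto
    also have "\<dots> = (\<integral>\<^sup>+x. ennreal (3 * (v / 2)\<^sup>2 + v * x\<^sup>2 + 1 * (x\<^sup>2)\<^sup>2) \<partial>?R)"
      using v by (intro nn_integral_cong)
        (simp add: ennreal_plus[symmetric] ennreal_mult[symmetric] algebra_simps del: ennreal_plus)
    also have "\<dots> = ennreal (3 * (v / 2)\<^sup>2) + ennreal v * ennreal (v / 2)
        + ennreal 1 * (\<integral>\<^sup>+y. ennreal ((y\<^sup>2)\<^sup>2) \<partial>?R)"
      unfolding m2[symmetric] using v by (intro R.nn_integral_affine2) auto
    also have "\<dots> \<le> ennreal (3 * (v / 2)\<^sup>2) + ennreal v * ennreal (v / 2) + ennreal 1 * ennreal (3 * (v / 2)\<^sup>2)"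
      by (intro add_left_mono mult_left_mono m4) auto
    also have "\<dots> = ennreal (2 * v\<^sup>2)"
      using v by (simp add: ennreal_plus[symmetric] ennreal_mult[symmetric] power2_eq_square del: ennreal_plus)
    also have "\<dots> \<le> ennreal (3 * v\<^sup>2)" by (intro ennreal_leI) simp
    finally show ?thesis .
  qed
  moreover have "prob_space (complex_gaussian v)"
    unfolding complex_gaussian_def by (rule RR.prob_space_distr[OF C])
  moreover have "sets (complex_gaussian v) = sets borel" by (simp add: complex_gaussian_def)
  ultimately show ?thesis unfolding symmetric_law_def using sym' v by simp
qed

section \<open>Oblivious subspace injections from sampling\<close>

lemma osi_of_rmps:
  fixes gauss :: "real \<Rightarrow> 'f::rc_field measure"
  assumes "\<And>v. 0 < v \<Longrightarrow> symmetric_law (gauss v) v" "1 \<le> D" "2 \<le> n" "1 \<le> k" "1 \<le> r"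
    "10400000 * real r \<le> real k" "1 * real n \<le> real D"
  shows "oblivious_subspace_injection (multi_indices d n) k (rmps_test_matrix gauss d D n k) r (1 / 2)"
  unfolding rmps_test_matrix_def
proof (rule osi_of_rank_one_variance_bound)
  show "rank_one_variance_bound (multi_indices d n) (rmps gauss d D n) 26"
    using assms by (intro rmps_rank_one_variance_bound) auto
  show "finite (multi_indices d n)" by (auto simp: multi_indices_def intro!: finite_PiE)
  show "100000 / (1 - 1 / 2)\<^sup>2 * 26 * real r \<le> real k" using assms by (simp add: power2_eq_square)
qed (use assms in auto)

theorem proposition5p2:
  shows
    "(\<exists>C>0::real.
        (\<forall>(N::nat) (k::nat) (P :: (nat \<times> nat \<Rightarrow> real) measure) (a::real) (b::real) (r::nat) (\<alpha>::real).
           1 \<le> k \<longrightarrow> matrix_quadratic_form_condition {1..N} k P a b \<longrightarrow>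
           1 \<le> r \<longrightarrow> 0 < \<alpha> \<longrightarrow> \<alpha> < 1 \<longrightarrow>
           real k \<ge> C / (1 - \<alpha>)\<^sup>2 * (a + b) * real r \<longrightarrow>
           oblivious_subspace_injection {1..N} k P r \<alpha>) \<and>
        (\<forall>(N::nat) (k::nat) (P :: (nat \<times> nat \<Rightarrow> complex) measure) (a::real) (b::real) (r::nat) (\<alpha>::real).
           1 \<le> k \<longrightarrow> matrix_quadratic_form_condition {1..N} k P a b \<longrightarrow>
           1 \<le> r \<longrightarrow> 0 < \<alpha> \<longrightarrow> \<alpha> < 1 \<longrightarrow>
           real k \<ge> C / (1 - \<alpha>)\<^sup>2 * (a + b) * real r \<longrightarrow>
           oblivious_subspace_injection {1..N} k P r \<alpha>))
     \<and>
     (\<exists>C\<^sub>1>0::real. \<exists>C\<^sub>2>0::real.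
        (\<forall>(d::nat) (D::nat) (n::nat) (k::nat) (r::nat).
           1 \<le> d \<longrightarrow> 1 \<le> D \<longrightarrow> 2 \<le> n \<longrightarrow> 1 \<le> k \<longrightarrow> 1 \<le> r \<longrightarrow>
           real k \<ge> C\<^sub>1 * real r \<longrightarrow> real D \<ge> C\<^sub>2 * real n \<longrightarrow>
           (\<exists>\<alpha>\<ge>1/2. oblivious_subspace_injection (multi_indices d n) k
              (rmps_test_matrix real_gaussian d D n k) r \<alpha>)) \<and>
        (\<forall>(d::nat) (D::nat) (n::nat) (k::nat) (r::nat).
           1 \<le> d \<longrightarrow> 1 \<le> D \<longrightarrow> 2 \<le> n \<longrightarrow> 1 \<le> k \<longrightarrow> 1 \<le> r \<longrightarrow>
           real k \<ge> C\<^sub>1 * real r \<longrightarrow> real D \<ge> C\<^sub>2 * real n \<longrightarrow>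
           (\<exists>\<alpha>\<ge>1/2. oblivious_subspace_injection (multi_indices d n) k
              (rmps_test_matrix complex_gaussian d D n k) r \<alpha>)))"
proof (rule conjI, goal_cases)
  case 1
  show ?case
    by (intro exI[of _ 100000] conjI allI impI)
      (simp, (rule osi_of_matrix_quadratic_form_condition[OF finite_atLeastAtMost]; assumption)+)
next
  case 2
  show ?case
  \<comment> \<open>The first constant is \<open>100000 \<cdot> 26 / (1 - 1/2)\<^sup>2\<close>.\<close>
  proof (rule exI[of _ 10400000], rule conjI[rotated], rule exI[of _ 1], intro conjI allI impI)
    fix d D n k r :: nat
    assume h: "1 \<le> D" "2 \<le> n" "1 \<le> k" "1 \<le> r" "10400000 * real r \<le> real k" "1 * real n \<le> real D"
    show "\<exists>\<alpha>\<ge>1/2. oblivious_subspace_injection (multi_indices d n) k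
        (rmps_test_matrix real_gaussian d D n k) r \<alpha>"
      using osi_of_rmps[OF symmetric_law_real_gaussian h, of d] by blast
    show "\<exists>\<alpha>\<ge>1/2. oblivious_subspace_injection (multi_indices d n) k
        (rmps_test_matrix complex_gaussian d D n k) r \<alpha>"
      using osi_of_rmps[OF symmetric_law_complex_gaussian h, of d] by blast
  qed simp_all
qed

end
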